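(* Let $\mathcal X,\mathcal Y$ be finite sets and $P_{XY}\in\mathcal P(\mathcal X\times\mathcal Y)$ with marginals $P_X,P_Y$. Consider the sequence of hypothesis testing problems with null hypothesis $(X^n,Y^n)\sim P_{XY}^{\times n}$ and alternative hypothesis "$X^n$ and $Y^n$ are independent and $(X^n,Y^n)$ is permutation invariant", i.e. $\mathcal Q_n=\{Q_{X^n}\times Q_{Y^n}:Q_{X^n}\in\mathcal P^{\rm sym}(\mathcal X^n),\,Q_{Y^n}\in\mathcal P^{\rm sym}(\mathcal Y^n)\}$. (In fact it is sufficient to require that either $X^n$ or $Y^n$ be permutation invariant.) Let $$I_s^{\downarrow\downarrow}(X\!:\!Y)=\min_{Q_X\in\mathcal P(\mathcal X),\,Q_Y\in\mathcal P(\mathcal Y)}D_s(P_{XY}\|Q_X\times Q_Y).$$ The threshold of this problem is the mutual information $I(X\!:\!Y)=D(P_{XY}\|P_X\times P_Y)$, and for $R$ sufficiently close to the threshold $I(X\!:\!Y)$ the error exponent and the strong converse exponent are $$\mathrm e_R=\sup_{s\in(\frac12,1)}\frac{1-s}{s}\big(I_s^{\downarrow\downarrow}(X\!:\!Y)-R\big)\qquad\text{and}\qquad\mathrm{sc}_R=\sup_{s>1}\frac{s-1}{s}\big(R-I_s^{\downarrow\downarrow}(X\!:\!Y)\big).$$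
   Context: $\mathcal P(\cdot)$ is the set of probability mass functions on a finite set; $\mathcal P^{\rm sym}(\mathcal X^n)\subseteq\mathcal P(\mathcal X^n)$ is the subset of distributions invariant under all permutations of the $n$ coordinates; $P^{\times n}$ is the $n$-fold i.i.d. product. $\log$ and $\exp$ are inverse to each other, in any fixed base; $-\log0=+\infty$. For a finite set $\mathcal A$, $P\in\mathcal P(\mathcal A)$, $\mathcal Q_n\subseteq\mathcal P(\mathcal A^n)$ (here $\mathcal A=\mathcal X\times\mathcal Y$, $P=P_{XY}$) and a test $T:\mathcal A^n\to[0,1]$ put $\alpha(T)=\sum_{a^n}P^{\times n}(a^n)(1-T(a^n))$, $\beta(T)=\sup_{Q\in\mathcal Q_n}\sum_{a^n}Q(a^n)T(a^n)$, and $\hat\alpha_n(\mu)=\min_T\{\alpha(T):\beta(T)\le\mu\}$. Threshold rate: $\sup\{R\in\mathbb R:\limsup_n\hat\alpha_n(\exp(-nR))=0\}$; error exponent: $\mathrm e_R=\liminf_n-\frac1n\log\hat\alpha_n(\exp(-nR))$; strong converse exponent: $\mathrm{sc}_R=\limsup_n-\frac1n\log(1-\hat\alpha_n(\exp(-nR)))$ (both for $R>0$). Rényi divergence: for $s\in(0,1)\cup(1,\infty)$, $D_s(P\|Q)=\frac1{s-1}\log\sum_{a:P(a)>0}P(a)^sQ(a)^{1-s}$ (equal to $+\infty$ if $s>1$ and $Q(a)=0<P(a)$ for some $a$, or if $s<1$ and the sum is $0$); $D_1(P\|Q)=D(P\|Q)=\sum_aP(a)(\log P(a)-\log Q(a)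)$.
   Formalization: The error exponent formula for R below I(X:Y) is not claimed when P_XY/(P_X×P_Y) is constant on the support of P_XY and X, Y have no nontrivial common part; there it is false, e.g. P_XY uniform on pairs x≠y over three letters. *)

theory Defs
  imports "HOL-Probability.Probability" "HOL-Combinatorics.Permutations"
begin

text \<open>
  Finite alphabets are types of class \<open>finite\<close>, and the n-tuples over an alphabet are the
  lists of length \<open>n\<close>.  All logarithms are to a base \<open>b > 1\<close>, and the matching
  exponential is \<open>b powr x\<close>.
\<close>

section \<open>Distributions on tuples\<close>

definition seq_pmfs :: "nat \<Rightarrow> 'a list pmf set" where
  "seq_pmfs n = {q. set_pmf q \<subseteq> {xs. length xs = n}}"

definition sym_pmfs :: "nat \<Rightarrow> 'a list pmf set" where
  "sym_pmfs n =
     {q \<in> seq_pmfs n. \<forall>\<pi>. \<pi> permutes {..<n} \<longrightarrow> map_pmf (permute_list \<pi>) q = q}"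

text \<open>The product of distributions of \<open>X\<^sup>n\<close> and \<open>Y\<^sup>n\<close>, as a distribution of the
  n-tuple of pairs.\<close>

definition zip_pmf :: "'a list pmf \<Rightarrow> 'b list pmf \<Rightarrow> ('a \<times> 'b) list pmf" where
  "zip_pmf q r = map_pmf (\<lambda>(xs, ys). zip xs ys) (pair_pmf q r)"

definition alt_sym :: "nat \<Rightarrow> ('a \<times> 'b) list pmf set" where
  "alt_sym n = {zip_pmf q r | q r. q \<in> sym_pmfs n \<and> r \<in> sym_pmfs n}"

definition alt_sym_left :: "nat \<Rightarrow> ('a \<times> 'b) list pmf set" where
  "alt_sym_left n = {zip_pmf q r | q r. q \<in> sym_pmfs n \<and> r \<in> seq_pmfs n}"

definition alt_sym_right :: "nat \<Rightarrow> ('a \<times> 'b) list pmf set" where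
  "alt_sym_right n = {zip_pmf q r | q r. q \<in> seq_pmfs n \<and> r \<in> sym_pmfs n}"

section \<open>Composite hypothesis testing\<close>

definition tests :: "nat \<Rightarrow> ('a list \<Rightarrow> real) set" where
  "tests n = {T. \<forall>as. length as = n \<longrightarrow> 0 \<le> T as \<and> T as \<le> 1}"

text \<open>\<open>T as\<close> is the probability of accepting the null hypothesis.\<close>

definition err1 :: "'a::finite pmf \<Rightarrow> nat \<Rightarrow> ('a list \<Rightarrow> real) \<Rightarrow> real" where
  "err1 P n T = (\<Sum>as | length as = n. pmf (replicate_pmf n P) as * (1 - T as))"

definition err2 ::
    "(nat \<Rightarrow> 'a::finite list pmf set) \<Rightarrow> nat \<Rightarrow> ('a list \<Rightarrow> real) \<Rightarrow> real" where
  "err2 \<Q> n T = (SUP Q\<in>\<Q> n. \<Sum>as | length as = n. pmf Q as * T as)"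

text \<open>For \<open>\<mu> \<ge> 0\<close> the infimum is a minimum over a nonempty compact set of tests.\<close>

definition opt_err ::
    "'a::finite pmf \<Rightarrow> (nat \<Rightarrow> 'a list pmf set) \<Rightarrow> nat \<Rightarrow> real \<Rightarrow> real" where
  "opt_err P \<Q> n \<mu> = (INF T\<in>{T \<in> tests n. err2 \<Q> n T \<le> \<mu>}. err1 P n T)"

definition neg_log :: "real \<Rightarrow> real \<Rightarrow> ereal" where
  "neg_log b x = (if x = 0 then \<infinity> else ereal (- log b x))"

definition threshold_rate ::
    "real \<Rightarrow> 'a::finite pmf \<Rightarrow> (nat \<Rightarrow> 'a list pmf set) \<Rightarrow> ereal" where
  "threshold_rate b P \<Q> =
     Sup (ereal ` {R. limsup (\<lambda>n. ereal (opt_err P \<Q> n (b powr (- (real n * R))))) = 0})"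

definition error_exponent ::
    "real \<Rightarrow> 'a::finite pmf \<Rightarrow> (nat \<Rightarrow> 'a list pmf set) \<Rightarrow> real \<Rightarrow> ereal" where
  "error_exponent b P \<Q> R =
     liminf (\<lambda>n. ereal (1 / real n) * neg_log b (opt_err P \<Q> n (b powr (- (real n * R)))))"

definition strong_converse_exponent ::
    "real \<Rightarrow> 'a::finite pmf \<Rightarrow> (nat \<Rightarrow> 'a list pmf set) \<Rightarrow> real \<Rightarrow> ereal" where
  "strong_converse_exponent b P \<Q> R =
     limsup (\<lambda>n. ereal (1 / real n) * neg_log b (1 - opt_err P \<Q> n (b powr (- (real n * R)))))"

section \<open>Renyi divergence and information measures\<close>

text \<open>The order \<open>s\<close> is meant to be positive.  Note that \<open>0 powr x = 0\<close> for all \<open>x\<close>;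
  zeros of \<open>Q\<close> only reach \<open>powr\<close> and \<open>log\<close> below when \<open>s < 1\<close>, where this is the
  intended value.\<close>

definition renyi_div :: "real \<Rightarrow> real \<Rightarrow> 'a::finite pmf \<Rightarrow> 'a pmf \<Rightarrow> ereal" where
  "renyi_div b s P Q =
     (if s \<ge> 1 \<and> (\<exists>a\<in>set_pmf P. pmf Q a = 0) then \<infinity>
      else if s = 1 then ereal (\<Sum>a\<in>set_pmf P. pmf P a * (log b (pmf P a) - log b (pmf Q a)))
      else let S = (\<Sum>a\<in>set_pmf P. pmf P a powr s * pmf Q a powr (1 - s))
           in if S = 0 then \<infinity> else ereal (1 / (s - 1) * log b S))"

definition mutual_info :: "real \<Rightarrow> ('a::finite \<times> 'b::finite) pmf \<Rightarrow> ereal" where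
  "mutual_info b P = renyi_div b 1 P (pair_pmf (map_pmf fst P) (map_pmf snd P))"

text \<open>The infimum is attained, by compactness and lower semicontinuity.\<close>

definition renyi_info_dd :: "real \<Rightarrow> real \<Rightarrow> ('a::finite \<times> 'b::finite) pmf \<Rightarrow> ereal" where
  "renyi_info_dd b s P = (INF (q, r)\<in>UNIV. renyi_div b s P (pair_pmf q r))"

section \<open>The degenerate case of the error exponent\<close>

text \<open>
  The information density \<open>log (P x y / (P\<^sub>X x * P\<^sub>Y y))\<close> is constant on the support, i.e. the
  information variance vanishes.
\<close>

definition const_info_density :: "('a \<times> 'b) pmf \<Rightarrow> bool" where
  "const_info_density P \<longleftrightarrow>
     (\<exists>c. \<forall>(x, y)\<in>set_pmf P. pmf P (x, y) = c * pmf (map_pmf fst P) x * pmf (map_pmf snd P) y)"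

text \<open>\<open>X\<close> and \<open>Y\<close> have a nontrivial common part: an event of probability
  strictly between 0 and 1 that almost surely is a function of \<open>X\<close> as well as of \<open>Y\<close>.\<close>

definition has_common_part :: "('a \<times> 'b) pmf \<Rightarrow> bool" where
  "has_common_part P \<longleftrightarrow>
     (\<exists>A B. (\<forall>(x, y)\<in>set_pmf P. x \<in> A \<longleftrightarrow> y \<in> B) \<and>
            0 < measure_pmf.prob (map_pmf fst P) A \<and> measure_pmf.prob (map_pmf fst P) A < 1)"

text \<open>
  For degenerate \<open>P\<close> with mutual information \<open>I > 0\<close>, \<open>renyi_info_dd b s P = I\<close> for all
  \<open>s \<in> {1/2<..<1}\<close>, so the Renyi expression for the error exponent is \<open>I - R\<close>
  for \<open>R < I\<close>.  The error exponent itself is the minimum of \<open>D(t || P)\<close> over the joint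
  distributions \<open>t\<close> with mutual information at most \<open>R\<close>; since
  \<open>D(t || P) + I(t) = I + D(t\<^bsub>X|Y\<^esub> || P\<^bsub>X|Y\<^esub> | t\<^sub>Y) + D(t\<^bsub>Y|X\<^esub> || P\<^bsub>Y|X\<^esub> | t\<^sub>X) > I\<close>
  for every \<open>t \<noteq> P\<close> supported in the support of \<open>P\<close>, it is strictly larger than \<open>I - R\<close>.
  An example is the uniform distribution on the pairs \<open>(x, y)\<close> with \<open>x \<noteq> y\<close> over
  a three-letter alphabet.
\<close>

definition degenerate :: "('a \<times> 'b) pmf \<Rightarrow> bool" where
  "degenerate P \<longleftrightarrow> const_info_density P \<and> \<not> has_common_part P"

end

theory Submission
  imports Defs "HOL-Combinatorics.Multiset_Permutations" "HOL-Real_Asymp.Real_Asymp"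
begin

text \<open>
  Both types of error are determined by the joint type \<open>t\<close> of the sample: it occurs with probability
  about \<open>exp (- n D(t || P))\<close> under the null hypothesis, and the best single alternative
  gives it probability about \<open>exp (- n I(t))\<close>, even if only one of the two factors is
  permutation invariant.  Hence (for natural logarithms) the error exponent is the minimum of
  \<open>D(t || P)\<close> over \<open>I(t) \<le> R\<close>, and the strong converse exponent is the minimum of
  \<open>D(t || P) + max 0 (R - I(t))\<close>.

  For \<open>\<bar>c\<bar> \<le> 1\<close> the function \<open>D(t || P) + c I(t)\<close> is convex in \<open>t\<close>, although \<open>I\<close> is not.
  A minimax argument therefore turns \<open>min D + max 0 (I - R)\<close> into the supremum over \<open>0 < c < 1\<close> of
  \<open>min D + c (I - R)\<close>, which is \<open>c (I\<^sub>s - R)\<close> for the Renyi information \<open>I\<^sub>s\<close> of order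
  \<open>s = 1 / (1 + c)\<close>, and likewise with \<open>R - I\<close> and \<open>s = 1 / (1 - c)\<close>.  It remains to replace the penalty
  \<open>max 0 (I - R)\<close> by the constraint \<open>I \<le> R\<close>.  If \<open>P\<close> does not minimize \<open>D + I\<close>, then for \<open>R\<close>
  close to the threshold a penalized minimizer that violates the constraint would be a local, hence
  global, minimizer of \<open>D + I\<close>, which is impossible.  If \<open>P\<close> does minimize \<open>D + I\<close>, then the
  information density is constant, and reweighting the values of the common part gives a
  feasible \<open>t\<close> with the required value of \<open>D\<close>.
\<close>

section \<open>Convexity of relative entropy terms\<close>

text \<open>The ranges of \<open>s\<close> in the two formulas are exactly those for which the
  multiplier \<open>c\<close> lies strictly between 0 and 1. Convexity is visible at the ends: with
  \<open>H\<close> for entropy, \<open>D(t || P) + I(t)\<close> is \<open>- H(Y|X) - H(X|Y)\<close>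
  plus a linear term, and in \<open>D(t || P) - I(t)\<close> the joint entropies cancel, leaving
  \<open>- H(X) - H(Y)\<close> plus a linear term.

  The two Renyi formulas differ in difficulty. \<open>(1 - s) D_s(P || Q)\<close> is the minimum
  over \<open>t\<close> of \<open>s D(t || P) + (1 - s) D(t || Q)\<close>. For \<open>s < 1\<close>
  the infimum over products merely joins this minimum. For \<open>s > 1\<close> the coefficient of
  \<open>D(t || Q)\<close> is negative and a min-max problem remains; the minimizer of
  \<open>D - c I\<close> and the product of its marginals form a saddle point.

  The penalty is intrinsic to the strong converse exponent, whose formula therefore holds for all
  \<open>R\<close>. For the error exponent the penalized value is only a lower bound. The matching
  upper bound comes from a single type class and asks for strict feasibility,
  \<open>I(t) < R\<close>, because types only approximate \<open>t\<close>. This makes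
  \<open>R = I\<close> a case of its own.\<close>

definition xlnx :: "real \<Rightarrow> real" where "xlnx u = u * ln u"

lemma xlnx_0 [simp]: "xlnx 0 = 0"
  by (simp add: xlnx_def)

lemma continuous_on_xlnx: "continuous_on {0..} xlnx"
proof (rule continuous_on_eq_continuous_within [THEN iffD2], rule ballI)
  fix x :: real assume x: "x \<in> {0..}"
  show "continuous (at x within {0..}) xlnx"
  proof (cases "x = 0")
    case True
    have "((\<lambda>u::real. u * ln u) \<longlongrightarrow> 0) (at_right 0)" by real_asymp
    then show ?thesis
      by (simp add: True continuous_within xlnx_def [abs_def] at_within_Ici_at_right)
  next
    case False
    then have "isCont (\<lambda>u. u * ln u) x" using x by (intro continuous_intros) auto
    then show ?thesis
      by (simp add: xlnx_def [abs_def] continuous_at_imp_continuous_at_within)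
  qed
qed

lemma continuous_on_xlnx_comp [continuous_intros]:
  assumes "continuous_on S h" "\<And>t. t \<in> S \<Longrightarrow> 0 \<le> h t"
  shows "continuous_on S (\<lambda>t. xlnx (h t))"
  by (rule continuous_on_compose2 [OF continuous_on_xlnx assms(1)]) (use assms(2) in auto)

text \<open>The function \<open>a ln (a / u)\<close> of the pair \<open>(a, u)\<close> is convex and
  homogeneous of degree one; the left-hand side is its tangent plane at \<open>(A, U)\<close>. Both
  the Gibbs inequality and joint convexity are read off from it.\<close>

lemma relative_entropy_term_tangent:
  fixes a u A U :: real
  assumes "0 \<le> a" "0 \<le> u" "0 < a \<Longrightarrow> 0 < u" "0 < A" "0 < U"
  shows "a * (ln A - ln U) + a - u * A / U \<le> a * (ln a - ln u)"
proof (cases "a = 0")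
  case True then show ?thesis using assms by auto
next
  case False
  then have a: "a > 0" "u > 0" using assms by auto
  have "ln ((u * A) / (a * U)) \<le> (u * A) / (a * U) - 1"
    using a assms by (intro ln_le_minus_one) auto
  then have "ln u + ln A - ln a - ln U \<le> (u * A) / (a * U) - 1"
    using a assms by (simp add: ln_div ln_mult)
  then have "a * (ln u + ln A - ln a - ln U) \<le> a * ((u * A) / (a * U) - 1)"
    using a by (intro mult_left_mono) auto
  also have "\<dots> = u * A / U - a" using a assms by (simp add: field_simps)
  finally show ?thesis by (simp add: algebra_simps)
qed

text \<open>Sum of the tangent bounds at the point \<open>(1, sum w A)\<close> formed by the two
  totals. The weights \<open>w\<close> are left unnormalized because the weights
  \<open>P^s Q^(1-s)\<close> of the Renyi divergence will be inserted.\<close>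

lemma gibbs_inequality:
  fixes p w :: "'a \<Rightarrow> real"
  assumes "finite A" "\<And>a. a \<in> A \<Longrightarrow> 0 \<le> p a" "\<And>a. a \<in> A \<Longrightarrow> 0 \<le> w a"
    and "\<And>a. a \<in> A \<Longrightarrow> 0 < p a \<Longrightarrow> 0 < w a" and "sum p A = 1"
  shows "- ln (sum w A) \<le> (\<Sum>a\<in>A. p a * (ln (p a) - ln (w a)))"
proof -
  obtain a where a: "a \<in> A" "0 < p a"
    using assms(2,5) by (metis less_eq_real_def sum.neutral zero_neq_one)
  have pos: "0 < sum w A"
    using assms a by (intro sum_pos2 [of A a]) auto
  have "- ln (sum w A) = (\<Sum>a\<in>A. p a * (ln 1 - ln (sum w A)) + p a - w a * 1 / sum w A)"
    using assms(5) pos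
    by (simp add: sum.distrib sum_subtractf flip: sum_distrib_right sum_divide_distrib)
  also have "\<dots> \<le> (\<Sum>a\<in>A. p a * (ln (p a) - ln (w a)))"
    using assms pos by (intro sum_mono relative_entropy_term_tangent) auto
  finally show ?thesis .
qed

lemma relative_entropy_term_convex:
  fixes a1 a2 u1 u2 \<theta> :: real
  assumes "0 \<le> a1" "0 \<le> a2" "0 \<le> u1" "0 \<le> u2" "0 < a1 \<Longrightarrow> 0 < u1" "0 < a2 \<Longrightarrow> 0 < u2"
    and \<theta>: "0 \<le> \<theta>" "\<theta> \<le> 1"
  defines "A \<equiv> (1 - \<theta>) * a1 + \<theta> * a2" and "U \<equiv> (1 - \<theta>) * u1 + \<theta> * u2"
  shows "A * (ln A - ln U) \<le> (1 - \<theta>) * (a1 * (ln a1 - ln u1)) + \<theta> * (a2 * (ln a2 - ln u2))"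
proof (cases "A = 0")
  case True
  then have "(1 - \<theta>) * a1 = 0" "\<theta> * a2 = 0"
    unfolding A_def using assms(1,2) \<theta> by (simp_all add: add_nonneg_eq_0_iff)
  then have "(1 - \<theta>) * (a1 * (ln a1 - ln u1)) = 0" "\<theta> * (a2 * (ln a2 - ln u2)) = 0"
    by (metis mult.assoc mult_zero_left)+
  then show ?thesis using True by (simp only:)
next
  case False
  have A: "A > 0" using False assms(1,2) \<theta> by (simp add: A_def less_le)
  have "(1 - \<theta>) * a1 > 0 \<or> \<theta> * a2 > 0"
  proof (rule ccontr)
    assume "\<not> ?thesis"
    then show False using A unfolding A_def by auto
  qed
  then have U: "U > 0"
  proof
    assume "(1 - \<theta>) * a1 > 0"
    then have "(1 - \<theta>) * u1 > 0"
      using assms(1,5) \<theta> by (auto simp: zero_less_mult_iff)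
    moreover have "\<theta> * u2 \<ge> 0" using assms(4) \<theta> by simp
    ultimately show ?thesis by (simp add: U_def)
  next
    assume "\<theta> * a2 > 0"
    then have "\<theta> * u2 > 0"
      using assms(2,6) \<theta> by (auto simp: zero_less_mult_iff)
    moreover have "(1 - \<theta>) * u1 \<ge> 0" using assms(3) \<theta> by simp
    ultimately show ?thesis by (simp add: U_def)
  qed
  \<comment> \<open>By homogeneity the tangent plane at the mixture passes through the origin, so
    averaging its two values returns the value at the mixture.\<close>
  have "A * (ln A - ln U) = (1 - \<theta>) * (a1 * (ln A - ln U) + a1 - u1 * A / U)
      + \<theta> * (a2 * (ln A - ln U) + a2 - u2 * A / U)"
  proof -
    have "(1 - \<theta>) * (a1 * (ln A - ln U) + a1 - u1 * A / U)
      + \<theta> * (a2 * (ln A - ln U) + a2 - u2 * A / U) = A * (ln A - ln U) + A - U * A / U"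
      unfolding A_def U_def by (simp add: algebra_simps add_divide_distrib diff_divide_distrib)
    then show ?thesis using U by simp
  qed
  also have "\<dots> \<le> (1 - \<theta>) * (a1 * (ln a1 - ln u1)) + \<theta> * (a2 * (ln a2 - ln u2))"
    using assms(1-6) A U \<theta>
    by (intro add_mono mult_left_mono relative_entropy_term_tangent) auto
  finally show ?thesis .
qed

lemma xlnx_convex:
  fixes a1 a2 \<theta> :: real
  assumes "0 \<le> a1" "0 \<le> a2" "0 \<le> \<theta>" "\<theta> \<le> 1"
  shows "xlnx ((1 - \<theta>) * a1 + \<theta> * a2) \<le> (1 - \<theta>) * xlnx a1 + \<theta> * xlnx a2"
  using relative_entropy_term_convex [of a1 a2 1 1 \<theta>] assms by (simp add: xlnx_def)

section \<open>A minimax theorem for two convex functions\<close>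

text \<open>The open quadrant below \<open>(v, v)\<close> does not meet the upward closure of the
  image of \<open>(F, G)\<close>, and that closure is convex. The normal of a separating line,
  scaled to coordinate sum one, supplies the two weights.\<close>

lemma convex_pair_minimax:
  fixes F G :: "'a::real_vector \<Rightarrow> real"
  assumes "convex_on C F" "convex_on C G" "C \<noteq> {}"
    and v: "\<And>t. t \<in> C \<Longrightarrow> v \<le> max (F t) (G t)"
  obtains \<theta> where "0 \<le> \<theta>" "\<theta> \<le> 1" "\<And>t. t \<in> C \<Longrightarrow> v \<le> (1 - \<theta>) * F t + \<theta> * G t"
proof -
  define S where "S = {z::real \<times> real. fst z < v \<and> snd z < v}"
  define T where "T = {z::real \<times> real. \<exists>t\<in>C. F t \<le> fst z \<and> G t \<le> snd z}"
  have "convex S"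
  proof -
    have "S = {..<v} \<times> {..<v}" by (auto simp: S_def)
    then show ?thesis by (simp add: convex_Times)
  qed
  moreover have "convex T"
  proof (rule convexI)
    fix y z :: "real \<times> real" and \<alpha> \<beta> :: real
    assume *: "y \<in> T" "z \<in> T" and ab: "0 \<le> \<alpha>" "0 \<le> \<beta>" "\<alpha> + \<beta> = 1"
    from * obtain t u where t: "t \<in> C" "F t \<le> fst y" "G t \<le> snd y"
      and u: "u \<in> C" "F u \<le> fst z" "G u \<le> snd z" by (auto simp: T_def)
    let ?w = "\<alpha> *\<^sub>R t + \<beta> *\<^sub>R u"
    have "?w \<in> C"
      using convex_on_imp_convex [OF assms(1)] t u ab by (simp add: convex_def)
    moreover have "F ?w \<le> \<alpha> * F t + \<beta> * F u" "G ?w \<le> \<alpha> * G t + \<beta> * G u"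
      using assms(1,2) t(1) u(1) ab by (auto simp: convex_on_def)
    moreover have "\<alpha> * F t + \<beta> * F u \<le> \<alpha> * fst y + \<beta> * fst z"
      "\<alpha> * G t + \<beta> * G u \<le> \<alpha> * snd y + \<beta> * snd z"
      using t u ab by (intro add_mono mult_left_mono; simp)+
    ultimately show "\<alpha> *\<^sub>R y + \<beta> *\<^sub>R z \<in> T"
      unfolding T_def by (force intro: bexI [of _ ?w])
  qed
  moreover have "S \<noteq> {}" by (auto simp: S_def intro!: exI [of _ "v - 1"])
  moreover have "T \<noteq> {}" using assms(3) by (auto simp: T_def)
  moreover have "S \<inter> T = {}" using v by (fastforce simp: S_def T_def max_def split: if_splits)
  ultimately obtain a \<beta> where a: "a \<noteq> 0" and aS: "\<And>z. z \<in> S \<Longrightarrow> inner a z \<le> \<beta>"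
    and aT: "\<And>z. z \<in> T \<Longrightarrow> \<beta> \<le> inner a z"
    using separating_hyperplane_sets [of S T] by metis
  obtain a1 a2 where a_eq: "a = (a1, a2)" by (cases a)
  obtain t0 where t0: "t0 \<in> C" using assms(3) by auto
  \<comment> \<open>\<open>T\<close> is closed upwards, so a negative coordinate of the normal would
    make \<open>inner a\<close> unbounded below on \<open>T\<close>.\<close>
  have T_ray: "\<beta> \<le> a1 * (F t0 + k) + a2 * (G t0 + l)" if "0 \<le> k" "0 \<le> l" for k l
  proof -
    have "(F t0 + k, G t0 + l) \<in> T" using t0 that by (auto simp: T_def intro!: bexI [of _ t0])
    then show ?thesis using aT [of "(F t0 + k, G t0 + l)"] by (simp add: a_eq)
  qed
  have a1: "a1 \<ge> 0"
  proof (rule ccontr)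
    assume "\<not> a1 \<ge> 0"
    define k where "k = (\<bar>\<beta> - a1 * F t0 - a2 * G t0\<bar> + 1) / (- a1)"
    have "k \<ge> 0" using \<open>\<not> a1 \<ge> 0\<close> by (auto simp: k_def intro!: divide_nonneg_neg divide_nonneg_pos)
    moreover have "a1 * k = - (\<bar>\<beta> - a1 * F t0 - a2 * G t0\<bar> + 1)"
      using \<open>\<not> a1 \<ge> 0\<close> by (simp add: k_def)
    ultimately show False using T_ray [of k 0] by (auto simp: algebra_simps)
  qed
  have a2: "a2 \<ge> 0"
  proof (rule ccontr)
    assume "\<not> a2 \<ge> 0"
    define k where "k = (\<bar>\<beta> - a1 * F t0 - a2 * G t0\<bar> + 1) / (- a2)"
    have "k \<ge> 0" using \<open>\<not> a2 \<ge> 0\<close> by (auto simp: k_def intro!: divide_nonneg_neg divide_nonneg_pos)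
    moreover have "a2 * k = - (\<bar>\<beta> - a1 * F t0 - a2 * G t0\<bar> + 1)"
      using \<open>\<not> a2 \<ge> 0\<close> by (simp add: k_def)
    ultimately show False using T_ray [of 0 k] by (auto simp: algebra_simps)
  qed
  have pos: "a1 + a2 > 0" using a a1 a2 a_eq by (auto simp: less_le zero_prod_def)
  \<comment> \<open>The corner \<open>(v, v)\<close> is not in \<open>S\<close> but is a limit of
    the diagonal points \<open>(v - d, v - d)\<close>.\<close>
  have lim: "(a1 + a2) * v \<le> \<beta>"
  proof (rule field_le_epsilon)
    fix e :: real assume "e > 0"
    define d where "d = e / (a1 + a2)"
    have "d > 0" using \<open>e > 0\<close> pos by (simp add: d_def)
    have "inner a (v - d, v - d) \<le> \<beta>" using \<open>d > 0\<close> by (intro aS) (auto simp: S_def)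
    then have "(a1 + a2) * v - (a1 + a2) * d \<le> \<beta>" by (simp add: a_eq algebra_simps)
    moreover have "(a1 + a2) * d = e" using pos by (simp add: d_def)
    ultimately show "(a1 + a2) * v \<le> \<beta> + e" by simp
  qed
  show ?thesis
  proof (rule that [of "a2 / (a1 + a2)"])
    show "0 \<le> a2 / (a1 + a2)" "a2 / (a1 + a2) \<le> 1" using a1 a2 pos by (auto simp: divide_simps)
    fix t assume "t \<in> C"
    then have "\<beta> \<le> a1 * F t + a2 * G t" using aT [of "(F t, G t)"] by (auto simp: T_def a_eq)
    with lim have "(a1 + a2) * v \<le> a1 * F t + a2 * G t" by simp
    then have "v \<le> (a1 * F t + a2 * G t) / (a1 + a2)" using pos by (simp add: field_simps)
    also have "\<dots> = (1 - a2 / (a1 + a2)) * F t + a2 / (a1 + a2) * G t"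
    proof -
      have "1 - a2 / (a1 + a2) = a1 / (a1 + a2)" using pos by (simp add: field_simps)
      then show ?thesis by (simp add: add_divide_distrib)
    qed
    finally show "v \<le> (1 - a2 / (a1 + a2)) * F t + a2 / (a1 + a2) * G t" .
  qed
qed

text \<open>Since \<open>max 0 (k t)\<close> is the supremum of \<open>c * k t\<close> over
  \<open>0 < c < 1\<close>, this exchanges supremum and infimum. The penalized function is the
  larger of the two ends \<open>f\<close> and \<open>f + k\<close>, so convexity at the ends feeds
  \<open>convex_pair_minimax\<close>.\<close>

lemma minimax_positive_part:
  fixes f k :: "'a::real_normed_vector \<Rightarrow> real"
  assumes "compact C" "C \<noteq> {}" "continuous_on C f" "continuous_on C k"
    and "convex_on C f" "convex_on C (\<lambda>t. f t + k t)"
  shows "(SUP c\<in>{0<..<1::real}. ereal (INF t\<in>C. f t + c * k t)) =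
    ereal (INF t\<in>C. f t + max 0 (k t))"
proof -
  let ?\<phi> = "\<lambda>c. INF t\<in>C. f t + c * k t"
  define v where "v = (INF t\<in>C. f t + max 0 (k t))"
  have cont: "continuous_on C (\<lambda>t. f t + c * k t)" for c
    using assms by (intro continuous_intros)
  have bdd: "bdd_below ((\<lambda>t. f t + c * k t) ` C)" for c
    by (intro bounded_imp_bdd_below compact_imp_bounded compact_continuous_image cont assms(1))
  have bdd2: "bdd_below ((\<lambda>t. f t + max 0 (k t)) ` C)"
    using assms(1,3,4)
    by (intro bounded_imp_bdd_below compact_imp_bounded compact_continuous_image continuous_intros)
  have v_le: "v \<le> f t + max 0 (k t)" if "t \<in> C" for t
    unfolding v_def using that bdd2 by (intro cINF_lower)
  have "v \<le> max (f t) (f t + k t)" if "t \<in> C" for t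
    using v_le [OF that] by (simp add: max_def split: if_splits)
  then obtain \<theta> where \<theta>: "0 \<le> \<theta>" "\<theta> \<le> 1"
    and "\<And>t. t \<in> C \<Longrightarrow> v \<le> (1 - \<theta>) * f t + \<theta> * (f t + k t)"
    using convex_pair_minimax [OF assms(5,6,2), of v] by blast
  then have \<theta>_le: "\<And>t. t \<in> C \<Longrightarrow> v \<le> f t + \<theta> * k t"
    by (simp add: algebra_simps)
  show ?thesis unfolding v_def [symmetric]
  proof (rule antisym)
    show "(SUP c\<in>{0<..<1}. ereal (?\<phi> c)) \<le> ereal v"
    proof (rule SUP_least)
      fix c :: real assume l: "c \<in> {0<..<1}"
      have "?\<phi> c \<le> v" unfolding v_def
      proof (rule cINF_mono [OF assms(2) bdd])
        fix t assume "t \<in> C"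
        have "c * k t \<le> max 0 (k t)"
          using l by (cases "k t \<ge> 0") (auto simp: max_def mult_nonneg_nonpos mult_left_le_one_le)
        then show "\<exists>n\<in>C. f n + c * k n \<le> f t + max 0 (k t)" using \<open>t \<in> C\<close> by (intro bexI [of _ t]) auto
      qed
      then show "ereal (?\<phi> c) \<le> ereal v" by simp
    qed
    show "ereal v \<le> (SUP c\<in>{0<..<1}. ereal (?\<phi> c))"
    proof (rule ereal_le_epsilon2)
      fix e :: real assume e: "0 < e"
      define w where "w = ?\<phi> (1/2)"
      define \<delta> where "\<delta> = min (1/2) (e / (\<bar>v - w\<bar> + 1))"
      have \<delta>: "0 < \<delta>" "\<delta> \<le> 1/2" using e by (simp_all only: \<delta>_def min_less_iff_conj min.cobounded1) auto
      have "\<delta> * \<bar>v - w\<bar> \<le> e / (\<bar>v - w\<bar> + 1) * \<bar>v - w\<bar>"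
        by (intro mult_right_mono) (auto simp: \<delta>_def)
      also have "\<dots> \<le> e" using e by (simp add: field_simps)
      finally have \<delta>e: "\<delta> * \<bar>v - w\<bar> \<le> e" .
      \<comment> \<open>The optimal weight \<theta> may be 0 or 1, which corresponds to no
        admissible Renyi order. It is pulled towards \<open>1/2\<close>, with \<delta> chosen so
        that the value drops by at most \<open>e\<close>.\<close>
      define c where "c = (1 - \<delta>) * \<theta> + \<delta> / 2"
      have "(1 - \<delta>) * \<theta> \<ge> 0" "(1 - \<delta>) * \<theta> \<le> 1 - \<delta>"
        using \<theta> \<delta> by (auto intro: mult_left_le)
      then have "0 < c" "c \<le> 1 - \<delta> + \<delta> / 2" using \<delta> unfolding c_def by linarith+
      then have l: "c \<in> {0<..<1}" using \<delta> by auto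
      have "(1 - \<delta>) * v + \<delta> * w \<le> ?\<phi> c"
      proof (rule cINF_greatest [OF assms(2)])
        fix t assume t: "t \<in> C"
        have "w \<le> f t + 1/2 * k t" unfolding w_def using t bdd by (intro cINF_lower)
        then have "(1 - \<delta>) * v + \<delta> * w \<le> (1 - \<delta>) * (f t + \<theta> * k t) + \<delta> * (f t + 1/2 * k t)"
          using \<theta>_le [OF t] \<delta> by (intro add_mono mult_left_mono) auto
        also have "\<dots> = f t + c * k t" by (simp add: c_def algebra_simps)
        finally show "(1 - \<delta>) * v + \<delta> * w \<le> f t + c * k t" .
      qed
      moreover have "v - e \<le> (1 - \<delta>) * v + \<delta> * w"
      proof -
        have "\<delta> * (v - w) \<le> \<delta> * \<bar>v - w\<bar>" using \<delta> by (intro mult_left_mono) auto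
        then show ?thesis using \<delta>e by (simp add: algebra_simps)
      qed
      ultimately have "ereal v \<le> ereal (?\<phi> c) + ereal e" by simp
      also have "\<dots> \<le> (SUP c\<in>{0<..<1}. ereal (?\<phi> c)) + ereal e"
        using l by (intro add_right_mono SUP_upper) auto
      finally show "ereal v \<le> (SUP c\<in>{0<..<1}. ereal (?\<phi> c)) + ereal e" .
    qed
  qed
qed

section \<open>Relative entropy and mutual information on the simplex\<close>

text \<open>Distributions are Euclidean vectors, so that compactness and convexity arguments apply.
  Confining them to the support of \<open>P\<close> is what keeps \<open>D(t || P)\<close> finite:
  where \<open>ln (pmf P a)\<close> is a mere default value, \<open>t $ a\<close> vanishes.\<close>

definition prob_on :: "'a::finite set \<Rightarrow> (real^'a) set" where
  "prob_on A = {t. (\<forall>a. 0 \<le> t $ a) \<and> (\<forall>a. a \<notin> A \<longrightarrow> t $ a = 0) \<and> (\<Sum>a\<in>UNIV. t $ a) = 1}"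

definition pmf_vec :: "'a::finite pmf \<Rightarrow> real^'a" where
  "pmf_vec P = (\<chi> a. pmf P a)"

definition marg1 :: "real^('x::finite \<times> 'y::finite) \<Rightarrow> 'x \<Rightarrow> real" where
  "marg1 t x = (\<Sum>y\<in>UNIV. t $ (x, y))"

definition marg2 :: "real^('x::finite \<times> 'y::finite) \<Rightarrow> 'y \<Rightarrow> real" where
  "marg2 t y = (\<Sum>x\<in>UNIV. t $ (x, y))"

definition rel_ent :: "'a::finite pmf \<Rightarrow> real^'a \<Rightarrow> real" where
  "rel_ent P t = (\<Sum>a\<in>UNIV. xlnx (t $ a) - t $ a * ln (pmf P a))"

text \<open>In the form \<open>H(X) + H(Y) - H(X, Y)\<close> it is a sum of continuous functions of
  one variable each, hence continuous up to the boundary of the simplex.\<close>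

definition mut_inf :: "real^('x::finite \<times> 'y::finite) \<Rightarrow> real" where
  "mut_inf t = (\<Sum>a\<in>UNIV. xlnx (t $ a)) - (\<Sum>x\<in>UNIV. xlnx (marg1 t x)) - (\<Sum>y\<in>UNIV. xlnx (marg2 t y))"

lemma prob_onD:
  assumes "t \<in> prob_on A"
  shows "0 \<le> t $ a" "a \<notin> A \<Longrightarrow> t $ a = 0" "(\<Sum>a\<in>UNIV. t $ a) = 1"
  using assms by (auto simp: prob_on_def)

lemma prob_on_support: "t \<in> prob_on A \<Longrightarrow> 0 < t $ a \<Longrightarrow> a \<in> A"
  using prob_onD(2) by fastforce

lemma pmf_vec_nth [simp]: "pmf_vec P $ a = pmf P a"
  by (simp add: pmf_vec_def)

lemma sum_pmf_UNIV: "(\<Sum>a\<in>UNIV. pmf (P :: 'a::finite pmf) a) = 1"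
  by (rule sum_pmf_eq_1) auto

lemma pmf_vec_in_prob_on: "pmf_vec P \<in> prob_on (set_pmf P)"
  by (auto simp: prob_on_def sum_pmf_UNIV pmf_eq_0_set_pmf)

lemma prob_on_nonempty: "prob_on (set_pmf P) \<noteq> {}"
  using pmf_vec_in_prob_on by auto

lemma compact_prob_on: "compact (prob_on A)"
proof (rule compact_eq_bounded_closed [THEN iffD2], rule conjI)
  show "bounded (prob_on A)"
  proof (rule boundedI)
    fix t assume t: "t \<in> prob_on A"
    have "norm t \<le> (\<Sum>a\<in>UNIV. \<bar>t $ a\<bar>)" by (rule norm_le_l1_cart)
    also have "\<dots> = 1" using prob_onD [OF t] by simp
    finally show "norm t \<le> 1" .
  qed
  show "closed (prob_on A)"
    unfolding prob_on_def
    by (intro closed_Collect_conj closed_Collect_all closed_Collect_imp closed_Collect_le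
        closed_Collect_eq continuous_intros) auto
qed

lemma convex_prob_on: "convex (prob_on A)"
  by (rule convexI) (auto simp: prob_on_def sum.distrib simp flip: sum_distrib_left)

lemma marg_nonneg:
  assumes "t \<in> prob_on A" shows "0 \<le> marg1 t x" "0 \<le> marg2 t y"
  using prob_onD(1) [OF assms] by (auto simp: marg1_def marg2_def intro!: sum_nonneg)

lemma marg_ge:
  assumes "t \<in> prob_on A" shows "t $ (x, y) \<le> marg1 t x" "t $ (x, y) \<le> marg2 t y"
  using prob_onD(1) [OF assms]
  by (auto simp: marg1_def marg2_def intro!: member_le_sum [of y UNIV "\<lambda>y. t $ (x, y)"]
      member_le_sum [of x UNIV "\<lambda>x. t $ (x, y)"])

lemma marg_pos:
  assumes "t \<in> prob_on A" "0 < t $ a" shows "0 < marg1 t (fst a)" "0 < marg2 t (snd a)"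
  using assms marg_ge [OF assms(1), of "fst a" "snd a"] by auto

lemma sum_UNIV_prod:
  fixes h :: "'x::finite \<times> 'y::finite \<Rightarrow> real"
  shows "(\<Sum>a\<in>UNIV. h a) = (\<Sum>x\<in>UNIV. \<Sum>y\<in>UNIV. h (x, y))"
  unfolding sum.cartesian_product UNIV_Times_UNIV by (simp add: case_prod_beta)

lemma sum_pair_marg1:
  fixes t :: "real^('x::finite \<times> 'y::finite)"
  shows "(\<Sum>a\<in>UNIV. t $ a * h (fst a)) = (\<Sum>x\<in>UNIV. marg1 t x * h x)"
  by (simp add: sum_UNIV_prod marg1_def sum_distrib_right)

lemma sum_pair_marg2:
  fixes t :: "real^('x::finite \<times> 'y::finite)"
  shows "(\<Sum>a\<in>UNIV. t $ a * h (snd a)) = (\<Sum>y\<in>UNIV. marg2 t y * h y)"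
proof -
  have "(\<Sum>a\<in>UNIV. t $ a * h (snd a)) = (\<Sum>x\<in>UNIV. \<Sum>y\<in>UNIV. t $ (x, y) * h y)"
    by (simp add: sum_UNIV_prod)
  also have "\<dots> = (\<Sum>y\<in>UNIV. \<Sum>x\<in>UNIV. t $ (x, y) * h y)" by (rule sum.swap)
  finally show ?thesis by (simp add: marg2_def sum_distrib_right)
qed

lemma sum_marg:
  assumes "t \<in> prob_on A" shows "(\<Sum>x\<in>UNIV. marg1 t x) = 1" "(\<Sum>y\<in>UNIV. marg2 t y) = 1"
  using sum_pair_marg1 [of t "\<lambda>_. 1"] sum_pair_marg2 [of t "\<lambda>_. 1"] prob_onD(3) [OF assms] by auto

lemma mut_inf_altdef:
  "mut_inf t = (\<Sum>a\<in>UNIV. t $ a * (ln (t $ a) - ln (marg1 t (fst a)) - ln (marg2 t (snd a))))"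
  using sum_pair_marg1 [of t "\<lambda>x. ln (marg1 t x)"] sum_pair_marg2 [of t "\<lambda>y. ln (marg2 t y)"]
  by (simp add: mut_inf_def xlnx_def right_diff_distrib sum_subtractf)

lemma rel_ent_altdef: "rel_ent P t = (\<Sum>a\<in>UNIV. t $ a * (ln (t $ a) - ln (pmf P a)))"
  by (simp add: rel_ent_def xlnx_def right_diff_distrib)

lemma continuous_on_marg [continuous_intros]:
  "continuous_on S (\<lambda>t. marg1 t x)" "continuous_on S (\<lambda>t. marg2 t y)"
  unfolding marg1_def marg2_def by (intro continuous_intros)+

lemma continuous_on_rel_ent: "continuous_on (prob_on A) (rel_ent P)"
  unfolding rel_ent_def [abs_def] by (intro continuous_intros) (auto dest: prob_onD)

lemma continuous_on_mut_inf: "continuous_on (prob_on A) mut_inf"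
  unfolding mut_inf_def [abs_def] by (intro continuous_intros) (auto dest: prob_onD marg_nonneg)

section \<open>Convexity of the functionals\<close>

lemma prob_on_mix:
  assumes "s \<in> prob_on A" "t \<in> prob_on A" "0 \<le> \<theta>" "\<theta> \<le> 1"
  shows "(1 - \<theta>) *\<^sub>R s + \<theta> *\<^sub>R t \<in> prob_on A"
  using convex_prob_on [of A] assms by (simp add: convex_alt)

lemma convex_on_prob_onI:
  assumes "\<And>s t \<theta>. s \<in> prob_on A \<Longrightarrow> t \<in> prob_on A \<Longrightarrow> 0 \<le> \<theta> \<Longrightarrow> \<theta> \<le> 1 \<Longrightarrow>
    h ((1 - \<theta>) *\<^sub>R s + \<theta> *\<^sub>R t) \<le> (1 - \<theta>) * h s + \<theta> * h t"
  shows "convex_on (prob_on A) h"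
  by (rule convex_onI) (use assms convex_prob_on in auto)

lemma marg_mix [simp]:
  "marg1 (c *\<^sub>R s + d *\<^sub>R t) x = c * marg1 s x + d * marg1 t x"
  "marg2 (c *\<^sub>R s + d *\<^sub>R t) y = c * marg2 s y + d * marg2 t y"
  by (simp_all add: marg1_def marg2_def sum.distrib sum_distrib_left)

lemma convex_on_rel_ent: "convex_on (prob_on A) (rel_ent P)"
proof (rule convex_on_prob_onI)
  fix s t :: "real^'a" and \<theta> :: real
  assume *: "s \<in> prob_on A" "t \<in> prob_on A" "0 \<le> \<theta>" "\<theta> \<le> 1"
  let ?u = "(1 - \<theta>) *\<^sub>R s + \<theta> *\<^sub>R t"
  have "rel_ent P ?u \<le> (\<Sum>a\<in>UNIV. (1 - \<theta>) * (xlnx (s $ a) - s $ a * ln (pmf P a))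
      + \<theta> * (xlnx (t $ a) - t $ a * ln (pmf P a)))"
    unfolding rel_ent_def
  proof (rule sum_mono)
    fix a
    have "xlnx (?u $ a) \<le> (1 - \<theta>) * xlnx (s $ a) + \<theta> * xlnx (t $ a)"
      using xlnx_convex [of "s $ a" "t $ a" \<theta>] * prob_onD(1) by auto
    then show "xlnx (?u $ a) - ?u $ a * ln (pmf P a)
      \<le> (1 - \<theta>) * (xlnx (s $ a) - s $ a * ln (pmf P a)) + \<theta> * (xlnx (t $ a) - t $ a * ln (pmf P a))"
      by (simp add: algebra_simps)
  qed
  then show "rel_ent P ?u \<le> (1 - \<theta>) * rel_ent P s + \<theta> * rel_ent P t"
    by (simp add: rel_ent_def sum.distrib sum_distrib_left)
qed

lemma convex_on_marginal_terms:
  "convex_on (prob_on A) (\<lambda>t. \<Sum>x\<in>UNIV. xlnx (marg1 t x))"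
  "convex_on (prob_on A) (\<lambda>t. \<Sum>y\<in>UNIV. xlnx (marg2 t y))"
  by (rule convex_on_prob_onI, unfold sum_distrib_left marg_mix sum.distrib [symmetric],
      intro sum_mono xlnx_convex; simp add: marg_nonneg)+

lemma convex_on_linear_term: "convex_on (prob_on A) (\<lambda>t. - (\<Sum>a\<in>UNIV. t $ a * h a))"
  by (rule convex_on_prob_onI) (simp add: algebra_simps sum.distrib sum_distrib_left sum_subtractf)

text \<open>These are the negative conditional entropies of one coordinate given the other. The
  marginals are linear in \<open>t\<close>, so joint convexity of \<open>a ln (a / u)\<close>
  applies term by term.\<close>

lemma convex_on_conditional_terms:
  "convex_on (prob_on A) (\<lambda>t. \<Sum>a\<in>UNIV. t $ a * (ln (t $ a) - ln (marg1 t (fst a))))"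
  "convex_on (prob_on A) (\<lambda>t. \<Sum>a\<in>UNIV. t $ a * (ln (t $ a) - ln (marg2 t (snd a))))"
proof (rule convex_on_prob_onI, unfold sum_distrib_left sum.distrib [symmetric], rule sum_mono)
  fix s t :: "real^('a \<times> 'b)" and \<theta> :: real and a
  assume *: "s \<in> prob_on A" "t \<in> prob_on A" "0 \<le> \<theta>" "\<theta> \<le> 1"
  show "((1 - \<theta>) *\<^sub>R s + \<theta> *\<^sub>R t) $ a * (ln (((1 - \<theta>) *\<^sub>R s + \<theta> *\<^sub>R t) $ a)
      - ln (marg1 ((1 - \<theta>) *\<^sub>R s + \<theta> *\<^sub>R t) (fst a)))
    \<le> (1 - \<theta>) * (s $ a * (ln (s $ a) - ln (marg1 s (fst a))))
      + \<theta> * (t $ a * (ln (t $ a) - ln (marg1 t (fst a))))"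
    using * relative_entropy_term_convex [of "s $ a" "t $ a" "marg1 s (fst a)" "marg1 t (fst a)" \<theta>]
    by (simp add: marg_nonneg marg_pos prob_onD(1))
next
  show "convex_on (prob_on A) (\<lambda>t. \<Sum>a\<in>UNIV. t $ a * (ln (t $ a) - ln (marg2 t (snd a))))"
  proof (rule convex_on_prob_onI, unfold sum_distrib_left sum.distrib [symmetric], rule sum_mono)
    fix s t :: "real^('a \<times> 'b)" and \<theta> :: real and a
    assume *: "s \<in> prob_on A" "t \<in> prob_on A" "0 \<le> \<theta>" "\<theta> \<le> 1"
    show "((1 - \<theta>) *\<^sub>R s + \<theta> *\<^sub>R t) $ a * (ln (((1 - \<theta>) *\<^sub>R s + \<theta> *\<^sub>R t) $ a)
        - ln (marg2 ((1 - \<theta>) *\<^sub>R s + \<theta> *\<^sub>R t) (snd a)))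
      \<le> (1 - \<theta>) * (s $ a * (ln (s $ a) - ln (marg2 s (snd a))))
        + \<theta> * (t $ a * (ln (t $ a) - ln (marg2 t (snd a))))"
      using * relative_entropy_term_convex [of "s $ a" "t $ a" "marg2 s (snd a)" "marg2 t (snd a)" \<theta>]
      by (simp add: marg_nonneg marg_pos prob_onD(1))
  qed
qed

text \<open>The sum contains \<open>t ln t\<close> twice; pairing one copy with each marginal term
  gives the two conditional terms, and only the linear term in \<open>ln P\<close> is left.\<close>

lemma convex_on_rel_ent_plus_mut_inf: "convex_on (prob_on A) (\<lambda>t. rel_ent P t + mut_inf t)"
proof -
  have "(\<lambda>t. rel_ent P t + mut_inf t) =
    (\<lambda>t. ((\<Sum>a\<in>UNIV. t $ a * (ln (t $ a) - ln (marg1 t (fst a))))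
      + (\<Sum>a\<in>UNIV. t $ a * (ln (t $ a) - ln (marg2 t (snd a))))) + - (\<Sum>a\<in>UNIV. t $ a * ln (pmf P a)))"
    by (rule ext) (simp add: rel_ent_altdef mut_inf_altdef right_diff_distrib sum_subtractf)
  then show ?thesis
    by (simp only:) (intro convex_on_add convex_on_conditional_terms convex_on_linear_term)
qed

lemma convex_on_rel_ent_minus_mut_inf: "convex_on (prob_on A) (\<lambda>t. rel_ent P t - mut_inf t)"
proof -
  have "(\<lambda>t. rel_ent P t - mut_inf t) =
    (\<lambda>t. ((\<Sum>x\<in>UNIV. xlnx (marg1 t x)) + (\<Sum>y\<in>UNIV. xlnx (marg2 t y)))
       + - (\<Sum>a\<in>UNIV. t $ a * ln (pmf P a)))"
    by (rule ext) (simp add: rel_ent_def mut_inf_def sum_subtractf)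
  then show ?thesis
    by (simp only:) (intro convex_on_add convex_on_marginal_terms convex_on_linear_term)
qed

section \<open>Nonnegativity of divergences and the product decomposition\<close>

lemma rel_ent_pmf_vec [simp]: "rel_ent P (pmf_vec P) = 0"
  by (simp add: rel_ent_altdef)

lemma prob_on_pmf_pos: "t \<in> prob_on (set_pmf P) \<Longrightarrow> 0 < t $ a \<Longrightarrow> 0 < pmf P a"
  by (intro pmf_positive prob_on_support)

lemma rel_ent_nonneg:
  assumes t: "t \<in> prob_on (set_pmf P)"
  shows "0 \<le> rel_ent P t"
proof -
  have "- ln (\<Sum>a\<in>UNIV. pmf P a) \<le> (\<Sum>a\<in>UNIV. t $ a * (ln (t $ a) - ln (pmf P a)))"
    using t by (intro gibbs_inequality prob_on_pmf_pos) (auto simp: prob_onD)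
  then show ?thesis by (simp add: rel_ent_altdef sum_pmf_UNIV)
qed

text \<open>Each summand of the divergence is at least \<open>t $ a - pmf P a\<close>, and these
  differences sum to zero. A vanishing divergence thus forces equality in
  \<open>ln x \<le> x - 1\<close> at every letter.\<close>

lemma rel_ent_eq_0D:
  assumes t: "t \<in> prob_on (set_pmf P)" and "rel_ent P t = 0"
  shows "t = pmf_vec P"
proof -
  have le: "t $ a - pmf P a \<le> t $ a * (ln (t $ a) - ln (pmf P a))" for a
    using relative_entropy_term_tangent [of "t $ a" "pmf P a" 1 1] prob_onD(1) [OF t]
      prob_on_pmf_pos [OF t] by simp
  have "(\<Sum>a\<in>UNIV. t $ a * (ln (t $ a) - ln (pmf P a)) - (t $ a - pmf P a)) = 0"
    using assms prob_onD(3) [OF t] by (simp add: rel_ent_altdef sum_subtractf sum_pmf_UNIV)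
  then have eq: "t $ a * (ln (t $ a) - ln (pmf P a)) = t $ a - pmf P a" for a
    using le by (subst (asm) sum_nonneg_eq_0_iff) auto
  have "t $ a = pmf P a" for a
  proof (cases "t $ a = 0")
    case True then show ?thesis using eq [of a] by simp
  next
    case False
    then have "0 < t $ a" using prob_onD(1) [OF t, of a] by (simp add: less_le)
    then have pos: "0 < t $ a" "0 < pmf P a"
      using prob_on_pmf_pos [OF t, of a] by simp_all
    then have "ln (pmf P a / t $ a) = pmf P a / t $ a - 1"
      using eq [of a] by (simp add: ln_div field_simps)
    then have "pmf P a / t $ a = 1" using pos by (intro ln_eq_minus_one) auto
    then show ?thesis using pos by simp
  qed
  then show ?thesis by (simp add: vec_eq_iff)
qed

text \<open>The identity \<open>D(t || q x r) = I(t) + D(t_X || q) + D(t_Y || r)\<close>. It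
  identifies the mutual information as the least divergence to a product; with the marginals of a
  fixed distribution as \<open>q\<close> and \<open>r\<close>, it also trades \<open>mut_inf\<close>
  for a divergence with fixed reference, up to terms quadratic in the deviation.\<close>

lemma rel_ent_product_decomposition:
  assumes t: "t \<in> prob_on A"
    and pos: "\<And>a. 0 < t $ a \<Longrightarrow> 0 < q (fst a) \<and> 0 < r (snd a)"
  shows "(\<Sum>a\<in>UNIV. t $ a * (ln (t $ a) - ln (q (fst a) * r (snd a)))) = mut_inf t
    + (\<Sum>x\<in>UNIV. marg1 t x * (ln (marg1 t x) - ln (q x)))
    + (\<Sum>y\<in>UNIV. marg2 t y * (ln (marg2 t y) - ln (r y)))"
proof -
  have "(\<Sum>a\<in>UNIV. t $ a * (ln (t $ a) - ln (q (fst a) * r (snd a))))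
    = (\<Sum>a\<in>UNIV. t $ a * (ln (t $ a) - ln (q (fst a)) - ln (r (snd a))))"
  proof (rule sum.cong [OF refl])
    fix a
    show "t $ a * (ln (t $ a) - ln (q (fst a) * r (snd a)))
      = t $ a * (ln (t $ a) - ln (q (fst a)) - ln (r (snd a)))"
      using pos [of a] prob_onD(1) [OF t, of a] by (cases "t $ a = 0") (auto simp: ln_mult)
  qed
  then show ?thesis
    using sum_pair_marg1 [of t "\<lambda>x. ln (q x)"] sum_pair_marg2 [of t "\<lambda>y. ln (r y)"]
    by (simp add: mut_inf_def xlnx_def right_diff_distrib sum_subtractf)
qed

lemma marg_pos_obtain:
  assumes "t \<in> prob_on A"
  shows "0 < marg1 t x \<Longrightarrow> \<exists>y. 0 < t $ (x, y)" "0 < marg2 t y \<Longrightarrow> \<exists>x. 0 < t $ (x, y)"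
proof -
  assume "0 < marg1 t x"
  then have "(\<Sum>y\<in>UNIV. t $ (x, y)) \<noteq> 0" by (simp add: marg1_def)
  then obtain y where "t $ (x, y) \<noteq> 0" by (meson sum.neutral)
  then show "\<exists>y. 0 < t $ (x, y)" using prob_onD(1) [OF assms, of "(x, y)"] by (auto simp: less_le)
next
  assume "0 < marg2 t y"
  then have "(\<Sum>x\<in>UNIV. t $ (x, y)) \<noteq> 0" by (simp add: marg2_def)
  then obtain x where "t $ (x, y) \<noteq> 0" by (meson sum.neutral)
  then show "\<exists>x. 0 < t $ (x, y)" using prob_onD(1) [OF assms, of "(x, y)"] by (auto simp: less_le)
qed

lemma mut_inf_le_product_divergence:
  assumes t: "t \<in> prob_on A"
    and q: "\<And>x. 0 \<le> q x" "(\<Sum>x\<in>UNIV. q x) = 1" and r: "\<And>y. 0 \<le> r y" "(\<Sum>y\<in>UNIV. r y) = 1"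
    and pos: "\<And>a. 0 < t $ a \<Longrightarrow> 0 < q (fst a) \<and> 0 < r (snd a)"
  shows "mut_inf t \<le> (\<Sum>a\<in>UNIV. t $ a * (ln (t $ a) - ln (q (fst a) * r (snd a))))"
proof -
  have "0 < q x" if "0 < marg1 t x" for x
    using marg_pos_obtain(1) [OF t that] pos by fastforce
  then have "0 \<le> (\<Sum>x\<in>UNIV. marg1 t x * (ln (marg1 t x) - ln (q x)))"
    using gibbs_inequality [of UNIV "marg1 t" q] q marg_nonneg [OF t] sum_marg [OF t] by simp
  moreover have "0 < r y" if "0 < marg2 t y" for y
    using marg_pos_obtain(2) [OF t that] pos by fastforce
  then have "0 \<le> (\<Sum>y\<in>UNIV. marg2 t y * (ln (marg2 t y) - ln (r y)))"
    using gibbs_inequality [of UNIV "marg2 t" r] r marg_nonneg [OF t] sum_marg [OF t] by simp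
  ultimately show ?thesis
    using rel_ent_product_decomposition [of t A q r, OF t pos] by simp
qed

lemma mut_inf_nonneg: assumes t: "t \<in> prob_on A" shows "0 \<le> mut_inf t"
proof -
  have "- ln (\<Sum>a\<in>UNIV. marg1 t (fst a) * marg2 t (snd a))
    \<le> (\<Sum>a\<in>UNIV. t $ a * (ln (t $ a) - ln (marg1 t (fst a) * marg2 t (snd a))))"
    using t by (intro gibbs_inequality) (auto simp: prob_onD marg_nonneg marg_pos)
  moreover have "(\<Sum>a\<in>UNIV. marg1 t (fst a) * marg2 t (snd a)) = 1"
    using sum_marg [OF t]
    by (simp add: sum_UNIV_prod flip: sum_distrib_left)
  moreover have "(\<Sum>a\<in>UNIV. t $ a * (ln (t $ a) - ln (marg1 t (fst a) * marg2 t (snd a)))) = mut_inf t"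
    using rel_ent_product_decomposition [OF t, of "marg1 t" "marg2 t"] t by (simp add: marg_pos)
  ultimately show ?thesis by simp
qed

lemma pmf_of_weights:
  fixes w :: "'a::finite \<Rightarrow> real"
  assumes "\<And>a. 0 \<le> w a" "(\<Sum>a\<in>UNIV. w a) = 1"
  obtains p where "pmf p = w"
proof
  show "pmf (embed_pmf w) = w"
    using assms
    by (intro ext pmf_embed_pmf) (auto simp: nn_integral_count_space_finite sum_ennreal simp flip: ennreal_1)
qed

lemma marg_pmf_vec:
  "marg1 (pmf_vec P) x = pmf (map_pmf fst P) x" "marg2 (pmf_vec P) y = pmf (map_pmf snd P) y"
proof -
  have "pmf (map_pmf fst P) x = measure_pmf.prob P (range (\<lambda>y. (x, y)))"
    by (simp add: pmf_map) (intro arg_cong [of _ _ "measure_pmf.prob P"], auto)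
  then show "marg1 (pmf_vec P) x = pmf (map_pmf fst P) x"
    by (simp add: measure_measure_pmf_finite sum.reindex inj_on_def marg1_def)
  have "pmf (map_pmf snd P) y = measure_pmf.prob P (range (\<lambda>x. (x, y)))"
    by (simp add: pmf_map) (intro arg_cong [of _ _ "measure_pmf.prob P"], auto)
  then show "marg2 (pmf_vec P) y = pmf (map_pmf snd P) y"
    by (simp add: measure_measure_pmf_finite sum.reindex inj_on_def marg2_def)
qed

section \<open>Variational formulas for the Renyi information\<close>

text \<open>On the normalized geometric mixture \<open>P^s Q^(1-s) / S\<close> the combination
  \<open>s ln (t / P) + (1 - s) ln (t / Q)\<close> is the constant \<open>- ln S\<close>. This is
  the equality case of \<open>renyi_gibbs\<close>.\<close>

lemma renyi_tilted_distribution: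
  fixes P :: "'a::finite pmf" and Q :: "'a \<Rightarrow> real" and s :: real
  assumes "\<And>a. 0 \<le> Q a"
  defines "S \<equiv> (\<Sum>a\<in>set_pmf P. pmf P a powr s * Q a powr (1 - s))"
  assumes S: "0 < S"
  obtains t where "t \<in> prob_on (set_pmf P)" "\<And>a. 0 < t $ a \<Longrightarrow> 0 < Q a"
    "s * rel_ent P t + (1 - s) * (\<Sum>a\<in>UNIV. t $ a * (ln (t $ a) - ln (Q a))) = - ln S"
proof
  define t :: "real^'a" where
    "t = (\<chi> a. if a \<in> set_pmf P then pmf P a powr s * Q a powr (1 - s) / S else 0)"
  have nonneg: "0 \<le> t $ a" for a using S by (simp add: t_def)
  have sum: "(\<Sum>a\<in>UNIV. t $ a) = 1"
    using S by (simp add: t_def sum.If_cases S_def flip: sum_divide_distrib)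
  show "t \<in> prob_on (set_pmf P)"
    using nonneg sum by (simp add: prob_on_def t_def)
  show pos: "0 < Q a" if "0 < t $ a" for a
    using that assms(1) [of a] by (auto simp: t_def less_le split: if_splits)
  have "s * (t $ a * (ln (t $ a) - ln (pmf P a))) + (1 - s) * (t $ a * (ln (t $ a) - ln (Q a)))
    = t $ a * (- ln S)" for a
  proof (cases "t $ a = 0")
    case False
    then have ta: "0 < t $ a" using nonneg [of a] by (simp add: less_le)
    then have a: "a \<in> set_pmf P" by (auto simp: t_def split: if_splits)
    have "ln (t $ a) = s * ln (pmf P a) + (1 - s) * ln (Q a) - ln S"
      using a S pos [OF ta] pmf_positive [OF a] by (simp add: t_def ln_div ln_mult ln_powr)
    then have "s * (ln (t $ a) - ln (pmf P a)) + (1 - s) * (ln (t $ a) - ln (Q a)) = - ln S"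
      by (simp add: algebra_simps)
    then have "t $ a * (s * (ln (t $ a) - ln (pmf P a)) + (1 - s) * (ln (t $ a) - ln (Q a)))
      = t $ a * (- ln S)" by simp
    then show ?thesis by (simp add: algebra_simps)
  qed simp
  then have "(\<Sum>a\<in>UNIV. s * (t $ a * (ln (t $ a) - ln (pmf P a)))
      + (1 - s) * (t $ a * (ln (t $ a) - ln (Q a)))) = (\<Sum>a\<in>UNIV. t $ a * (- ln S))"
    by (intro sum.cong) auto
  also have "\<dots> = - ln S" using sum by (simp only: flip: sum_distrib_right)
  finally show "s * rel_ent P t + (1 - s) * (\<Sum>a\<in>UNIV. t $ a * (ln (t $ a) - ln (Q a))) = - ln S"
    by (simp add: rel_ent_altdef sum.distrib sum_distrib_left)
qed

text \<open>The Gibbs inequality with weights \<open>P^s Q^(1-s)\<close>. Together with the tilted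
  distribution it shows that \<open>- ln S\<close>, for \<open>S > 0\<close>, is a minimum over
  \<open>t\<close>, also for \<open>s > 1\<close>, where \<open>D(t || Q)\<close> enters with a
  negative coefficient.\<close>

lemma renyi_gibbs:
  fixes P :: "'a::finite pmf" and Q :: "'a \<Rightarrow> real"
  assumes t: "t \<in> prob_on (set_pmf P)" and "\<And>a. 0 < t $ a \<Longrightarrow> 0 < Q a"
  shows "- ln (\<Sum>a\<in>set_pmf P. pmf P a powr s * Q a powr (1 - s))
    \<le> s * rel_ent P t + (1 - s) * (\<Sum>a\<in>UNIV. t $ a * (ln (t $ a) - ln (Q a)))"
proof -
  let ?w = "\<lambda>a. pmf P a powr s * Q a powr (1 - s)"
  have wpos: "0 < ?w a" if "0 < t $ a" for a
    using assms(2) [OF that] prob_on_pmf_pos [OF t that] by simp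
  have "(\<Sum>a\<in>set_pmf P. t $ a) = (\<Sum>a\<in>UNIV. t $ a)"
    using prob_onD(2) [OF t] by (intro sum.mono_neutral_left) auto
  then have "- ln (sum ?w (set_pmf P)) \<le> (\<Sum>a\<in>set_pmf P. t $ a * (ln (t $ a) - ln (?w a)))"
    using t wpos by (intro gibbs_inequality) (auto simp: prob_onD)
  also have "\<dots> = (\<Sum>a\<in>UNIV. t $ a * (ln (t $ a) - ln (?w a)))"
    using prob_onD(2) [OF t] by (intro sum.mono_neutral_left) auto
  also have "\<dots> = (\<Sum>a\<in>UNIV. s * (t $ a * (ln (t $ a) - ln (pmf P a)))
      + (1 - s) * (t $ a * (ln (t $ a) - ln (Q a))))"
  proof (rule sum.cong [OF refl])
    fix a
    show "t $ a * (ln (t $ a) - ln (?w a)) = s * (t $ a * (ln (t $ a) - ln (pmf P a)))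
      + (1 - s) * (t $ a * (ln (t $ a) - ln (Q a)))"
    proof (cases "t $ a = 0")
      case False
      then have ta: "0 < t $ a" using prob_onD(1) [OF t, of a] by (simp add: less_le)
      then have ln_w: "ln (?w a) = s * ln (pmf P a) + (1 - s) * ln (Q a)"
        using assms(2) [OF ta] prob_on_pmf_pos [OF t ta] by (simp add: ln_mult ln_powr)
      show ?thesis unfolding ln_w by (simp add: algebra_simps)
    qed simp
  qed
  finally show ?thesis by (simp add: rel_ent_altdef sum.distrib sum_distrib_left)
qed

lemma pmf_pair_eta: "pmf (pair_pmf q r) a = pmf q (fst a) * pmf r (snd a)"
  by (cases a) (simp add: pmf_pair)

lemma renyi_div_eq:
  fixes P Q :: "'a::finite pmf"
  defines "S s \<equiv> (\<Sum>a\<in>set_pmf P. pmf P a powr s * pmf Q a powr (1 - s))"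
  assumes "S s \<noteq> 0" "s \<noteq> 1" "s < 1 \<or> (\<forall>a\<in>set_pmf P. pmf Q a \<noteq> 0)"
  shows "renyi_div b s P Q = ereal (1 / (s - 1) * (ln (S s) / ln b))"
  using assms(2-) unfolding renyi_div_def S_def log_def by (auto simp: Let_def)

lemma attains_rel_ent_mut_inf:
  obtains t where "t \<in> prob_on (set_pmf P)"
    "(INF t\<in>prob_on (set_pmf P). rel_ent P t + c * mut_inf t) = rel_ent P t + c * mut_inf t"
    "\<And>s. s \<in> prob_on (set_pmf P) \<Longrightarrow> rel_ent P t + c * mut_inf t \<le> rel_ent P s + c * mut_inf s"
proof -
  have "continuous_on (prob_on (set_pmf P)) (\<lambda>t. rel_ent P t + c * mut_inf t)"
    by (intro continuous_intros continuous_on_rel_ent continuous_on_mut_inf)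
  from continuous_attains_inf [OF compact_prob_on prob_on_nonempty this]
  obtain t where t: "t \<in> prob_on (set_pmf P)" and
    le: "\<And>s. s \<in> prob_on (set_pmf P) \<Longrightarrow> rel_ent P t + c * mut_inf t \<le> rel_ent P s + c * mut_inf s"
    by blast
  moreover have "(INF t\<in>prob_on (set_pmf P). rel_ent P t + c * mut_inf t) = rel_ent P t + c * mut_inf t"
    using t le by (intro cInf_eq_minimum) auto
  ultimately show thesis using that by blast
qed

lemma mut_inf_product_divergence_pmf:
  assumes t: "t \<in> prob_on A" and pos: "\<And>a. 0 < t $ a \<Longrightarrow> 0 < pmf (pair_pmf q r) a"
  shows "mut_inf t \<le> (\<Sum>a\<in>UNIV. t $ a * (ln (t $ a) - ln (pmf (pair_pmf q r) a)))"
proof -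
  have "0 < pmf q (fst a) \<and> 0 < pmf r (snd a)" if "0 < t $ a" for a
    using pos [OF that] by (auto simp: pmf_pair_eta less_le)
  then show ?thesis
    using mut_inf_le_product_divergence [OF t, of "pmf q" "pmf r"]
    by (simp add: pmf_pair_eta sum_pmf_UNIV)
qed

lemma product_of_marginals_pmf:
  assumes t: "t \<in> prob_on A"
  obtains q r where "pmf q = marg1 t" "pmf r = marg2 t"
    "\<And>a. 0 < t $ a \<Longrightarrow> 0 < pmf (pair_pmf q r) a"
    "(\<Sum>a\<in>UNIV. t $ a * (ln (t $ a) - ln (pmf (pair_pmf q r) a))) = mut_inf t"
proof -
  obtain q where q: "pmf q = marg1 t"
    using pmf_of_weights [of "marg1 t"] marg_nonneg [OF t] sum_marg [OF t] by metis
  obtain r where r: "pmf r = marg2 t"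
    using pmf_of_weights [of "marg2 t"] marg_nonneg [OF t] sum_marg [OF t] by metis
  show ?thesis
  proof (rule that [OF q r])
    show "0 < pmf (pair_pmf q r) a" if "0 < t $ a" for a
      using marg_pos [OF t that] by (simp add: pmf_pair_eta q r)
    show "(\<Sum>a\<in>UNIV. t $ a * (ln (t $ a) - ln (pmf (pair_pmf q r) a))) = mut_inf t"
      using rel_ent_product_decomposition [OF t, of "marg1 t" "marg2 t"] marg_pos [OF t]
      by (simp add: pmf_pair_eta q r)
  qed
qed

text \<open>With \<open>c = (1 - s) / s > 0\<close>, the minimum over \<open>t\<close> in the
  variational formula and the infimum over products commute, and the inner infimum of
  \<open>D(t || q x r)\<close> is \<open>mut_inf t\<close>. The product of the marginals of the
  minimizer \<open>t0\<close> gives one inequality; comparing \<open>t0\<close> with the tilted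
  distribution of an arbitrary product gives the other.\<close>

lemma renyi_info_dd_less_1:
  fixes P :: "('x::finite \<times> 'y::finite) pmf"
  assumes b: "b > 1" and c: "0 < c"
  shows "renyi_info_dd b (1 / (1 + c)) P =
    ereal ((INF t\<in>prob_on (set_pmf P). rel_ent P t + c * mut_inf t) / (c * ln b))"
proof -
  define s where "s = 1 / (1 + c)"
  have s: "0 < s" "s < 1" "1 - s = c * s" using c by (auto simp: s_def field_simps)
  have sc: "(1 - s) * x = c * s * x" for x by (simp only: s(3))
  have lnb: "0 < ln b" using b by simp
  have pref: "1 / (s - 1) * (x / ln b) = (- x / s) / (c * ln b)" for x
  proof -
    have eq: "s - 1 = - (c * s)" using s(3) by simp
    show ?thesis unfolding eq using s(1) c lnb by (simp add: field_simps)
  qed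
  obtain t0 where t0: "t0 \<in> prob_on (set_pmf P)"
    and m: "(INF t\<in>prob_on (set_pmf P). rel_ent P t + c * mut_inf t) = rel_ent P t0 + c * mut_inf t0"
    and m_le: "\<And>t. t \<in> prob_on (set_pmf P) \<Longrightarrow> rel_ent P t0 + c * mut_inf t0 \<le> rel_ent P t + c * mut_inf t"
    by (rule attains_rel_ent_mut_inf [of P c]) (rule that)
  let ?S = "\<lambda>Q. \<Sum>a\<in>set_pmf P. pmf P a powr s * pmf Q a powr (1 - s)"
  have "renyi_info_dd b s P = ereal ((rel_ent P t0 + c * mut_inf t0) / (c * ln b))"
    unfolding renyi_info_dd_def
  proof (rule antisym)
    obtain q r where pos: "\<And>a. 0 < t0 $ a \<Longrightarrow> 0 < pmf (pair_pmf q r) a"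
      and D: "(\<Sum>a\<in>UNIV. t0 $ a * (ln (t0 $ a) - ln (pmf (pair_pmf q r) a))) = mut_inf t0"
      by (rule product_of_marginals_pmf [OF t0]) (rule that)
    obtain a where a: "0 < t0 $ a"
      using prob_onD [OF t0] by (metis less_eq_real_def sum.neutral zero_neq_one)
    have S: "0 < ?S (pair_pmf q r)"
      using pos [OF a] a prob_on_pmf_pos [OF t0 a] prob_on_support [OF t0 a]
      by (intro sum_pos2 [of _ a]) auto
    have "- ln (?S (pair_pmf q r)) \<le> s * (rel_ent P t0 + c * mut_inf t0)"
      using renyi_gibbs [of t0 P "pmf (pair_pmf q r)" s, OF t0 pos] unfolding D sc by (simp add: algebra_simps)
    then have "- ln (?S (pair_pmf q r)) / s \<le> rel_ent P t0 + c * mut_inf t0"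
      using s(1) by (simp add: field_simps)
    then have "renyi_div b s P (pair_pmf q r) \<le> ereal ((rel_ent P t0 + c * mut_inf t0) / (c * ln b))"
      using S s(1,2) c lnb by (subst renyi_div_eq) (auto simp only: pref ereal_less_eq intro!: divide_right_mono, auto)
    then show "(INF (q, r). renyi_div b s P (pair_pmf q r))
        \<le> ereal ((rel_ent P t0 + c * mut_inf t0) / (c * ln b))"
      by (intro INF_lower2 [of "(q, r)"]) auto
    show "ereal ((rel_ent P t0 + c * mut_inf t0) / (c * ln b)) \<le> (INF (q, r). renyi_div b s P (pair_pmf q r))"
    proof (rule INF_greatest, clarify)
      fix q :: "'x pmf" and r :: "'y pmf"
      show "ereal ((rel_ent P t0 + c * mut_inf t0) / (c * ln b)) \<le> renyi_div b s P (pair_pmf q r)"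
      proof (cases "?S (pair_pmf q r) = 0")
        case True
        then show ?thesis using s by (simp add: renyi_div_def)
      next
        case False
        then have S: "0 < ?S (pair_pmf q r)" by (simp add: less_le sum_nonneg)
        obtain t where t: "t \<in> prob_on (set_pmf P)" and pos: "\<And>a. 0 < t $ a \<Longrightarrow> 0 < pmf (pair_pmf q r) a"
          and eq: "s * rel_ent P t + (1 - s) * (\<Sum>a\<in>UNIV. t $ a * (ln (t $ a) - ln (pmf (pair_pmf q r) a)))
            = - ln (?S (pair_pmf q r))"
          using renyi_tilted_distribution [of "pmf (pair_pmf q r)", OF _ S] by auto
        have "s * (rel_ent P t0 + c * mut_inf t0) \<le> s * (rel_ent P t + c * mut_inf t)"
          using m_le [OF t] s by (intro mult_left_mono) auto
        also have "\<dots> \<le> s * rel_ent P t + c * s * (\<Sum>a\<in>UNIV. t $ a * (ln (t $ a) - ln (pmf (pair_pmf q r) a)))"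
          using mult_left_mono [OF mut_inf_product_divergence_pmf [OF t pos], of "c * s"] s c
          by (simp add: algebra_simps)
        finally have "rel_ent P t0 + c * mut_inf t0 \<le> - ln (?S (pair_pmf q r)) / s"
          using eq [unfolded sc] s(1) by (simp add: field_simps)
        then show ?thesis
          using S s(1,2) c lnb by (subst renyi_div_eq) (auto simp only: pref ereal_less_eq intro!: divide_right_mono, auto)
      qed
    qed
  qed
  then show ?thesis by (simp only: m s_def)
qed

text \<open>For \<open>c < 1\<close> the objective retains the entropy term
  \<open>(1 - c) t ln t\<close>, whose slope at 0 is minus infinity. Moving mass \<open>e\<close> to
  a missing letter would gain \<open>(1 - c) e ln e\<close> against a cost linear in
  \<open>e\<close>. Full support is needed because a Renyi divergence of order above 1 is infinite
  as soon as the reference misses a letter of \<open>P\<close>.\<close>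

lemma minimizer_full_support:
  fixes P :: "('x::finite \<times> 'y::finite) pmf"
  assumes c: "0 < c" "c < 1" and t: "t \<in> prob_on (set_pmf P)"
    and min: "\<And>s. s \<in> prob_on (set_pmf P) \<Longrightarrow> rel_ent P t - c * mut_inf t \<le> rel_ent P s - c * mut_inf s"
    and a: "a \<in> set_pmf P"
  shows "0 < t $ a"
proof (rule ccontr)
  assume "\<not> 0 < t $ a"
  then have ta: "t $ a = 0" using prob_onD(1) [OF t, of a] by simp
  define E where "E = (\<lambda>s::real^('x \<times> 'y). \<Sum>a\<in>UNIV. xlnx (s $ a))"
  define K where "K = (\<lambda>s::real^('x \<times> 'y). (c * (\<Sum>x\<in>UNIV. xlnx (marg1 s x))
    + c * (\<Sum>y\<in>UNIV. xlnx (marg2 s y))) + - (\<Sum>a\<in>UNIV. s $ a * ln (pmf P a)))"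
  have h: "rel_ent P s - c * mut_inf s = (1 - c) * E s + K s" for s
    by (simp add: rel_ent_def mut_inf_def E_def K_def sum_subtractf algebra_simps)
  have K_convex: "convex_on (prob_on (set_pmf P)) K"
    unfolding K_def using c
    by (intro convex_on_add convex_on_cmul convex_on_marginal_terms convex_on_linear_term) auto
  define d :: "real^('x \<times> 'y)" where "d = axis a 1"
  have d: "d \<in> prob_on (set_pmf P)"
    using a by (auto simp: d_def prob_on_def axis_def)
  have bound: "rel_ent P t - c * mut_inf t \<le> (1 - c) * ln e + K d" if e: "0 < e" "e < 1" for e
  proof -
    let ?u = "(1 - e) *\<^sub>R t + e *\<^sub>R d"
    have "E ?u \<le> (\<Sum>a'\<in>UNIV. (1 - e) * xlnx (t $ a') + (if a' = a then e * ln e else 0))"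
      unfolding E_def
    proof (rule sum_mono)
      fix a'
      have "xlnx ((1 - e) * t $ a') \<le> (1 - e) * xlnx (t $ a')"
        using xlnx_convex [of "t $ a'" 0 e] e prob_onD(1) [OF t] by simp
      then show "xlnx (?u $ a') \<le> (1 - e) * xlnx (t $ a') + (if a' = a then e * ln e else 0)"
        by (auto simp: d_def axis_def ta xlnx_def)
    qed
    also have "\<dots> = (1 - e) * E t + e * ln e"
      by (simp add: E_def sum.distrib sum_distrib_left)
    finally have E: "(1 - c) * E ?u \<le> (1 - c) * ((1 - e) * E t + e * ln e)"
      using c by (intro mult_left_mono) auto
    have K: "K ?u \<le> (1 - e) * K t + e * K d"
      using e by (intro convex_onD [OF K_convex] t d) auto
    have "?u \<in> prob_on (set_pmf P)" using t d e by (intro prob_on_mix) auto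
    then have "(1 - c) * E t + K t \<le> (1 - c) * E ?u + K ?u"
      using min [of ?u] unfolding h by simp
    also have "\<dots> \<le> (1 - c) * ((1 - e) * E t + e * ln e) + ((1 - e) * K t + e * K d)"
      using E K by simp
    finally have "e * ((1 - c) * E t + K t) \<le> e * ((1 - c) * ln e + K d)"
      by (simp add: algebra_simps)
    then show ?thesis using e h by simp
  qed
  \<comment> \<open>The mass \<open>e = exp (- k / (1 - c))\<close> turns
    \<open>(1 - c) * ln e\<close> into \<open>- k\<close>, and \<open>k\<close> exceeds the gap that
    \<open>bound\<close> would have to leave.\<close>
  define k where "k = \<bar>K d - (rel_ent P t - c * mut_inf t)\<bar> + 1"
  have "rel_ent P t - c * mut_inf t \<le> (1 - c) * ln (exp (- k / (1 - c))) + K d"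
    using c by (intro bound) (auto simp: k_def divide_neg_pos)
  also have "\<dots> = - k + K d" using c by simp
  finally show False by (simp add: k_def)
qed

text \<open>Makes divergences quadratic: for \<open>u = (1 - e) v + e s\<close> the right-hand side
  is of order \<open>e^2\<close>, hence negligible in first-order comparisons. Where
  \<open>v\<close> vanishes so does \<open>u\<close>, and the quotient is 0.\<close>

lemma kl_le_chi_square:
  fixes u v :: "'a \<Rightarrow> real"
  assumes "finite A" "\<And>a. a \<in> A \<Longrightarrow> 0 \<le> u a" "\<And>a. a \<in> A \<Longrightarrow> 0 \<le> v a"
    "\<And>a. a \<in> A \<Longrightarrow> 0 < u a \<Longrightarrow> 0 < v a" "sum u A = sum v A"
  shows "(\<Sum>a\<in>A. u a * (ln (u a) - ln (v a))) \<le> (\<Sum>a\<in>A. (u a - v a)\<^sup>2 / v a)"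
proof -
  have "u a * (ln (u a) - ln (v a)) \<le> (u a - v a)\<^sup>2 / v a + (u a - v a)" if "a \<in> A" for a
  proof (cases "u a = 0")
    case True
    show ?thesis using True assms(3) [OF that] by (cases "v a = 0") (auto simp: power2_eq_square)
  next
    case False
    then have pos: "0 < u a" "0 < v a" using assms(2,4) [OF that] by (auto simp: less_le)
    have "ln (u a / v a) \<le> u a / v a - 1" using pos by (intro ln_le_minus_one) auto
    then have "u a * (ln (u a) - ln (v a)) \<le> u a * (u a / v a - 1)"
      using pos by (intro mult_left_mono) (auto simp: ln_div)
    also have "\<dots> = (u a - v a)\<^sup>2 / v a + (u a - v a)"
      using pos by (simp add: field_simps power2_eq_square)
    finally show ?thesis .
  qed
  then have "(\<Sum>a\<in>A. u a * (ln (u a) - ln (v a))) \<le> (\<Sum>a\<in>A. (u a - v a)\<^sup>2 / v a + (u a - v a))"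
    by (rule sum_mono)
  then show ?thesis using assms(5) by (simp add: sum.distrib sum_subtractf)
qed

text \<open>Passing from \<open>mut_inf\<close> to the divergence from the product of the marginals of the minimizer
  changes the objective by a second-order term only, so the minimizer stays a minimizer.\<close>

lemma minimizer_product_divergence:
  fixes P :: "('x::finite \<times> 'y::finite) pmf"
  assumes c: "0 < c" "c < 1" and t: "t \<in> prob_on (set_pmf P)"
    and min: "\<And>s. s \<in> prob_on (set_pmf P) \<Longrightarrow> rel_ent P t - c * mut_inf t \<le> rel_ent P s - c * mut_inf s"
    and s: "s \<in> prob_on (set_pmf P)"
  shows "rel_ent P t - c * mut_inf t \<le> rel_ent P s
    - c * (\<Sum>a\<in>UNIV. s $ a * (ln (s $ a) - ln (marg1 t (fst a) * marg2 t (snd a))))"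
proof -
  define D1 where "D1 = (\<lambda>u::real^('x \<times> 'y). \<Sum>x\<in>UNIV. marg1 u x * (ln (marg1 u x) - ln (marg1 t x)))"
  define D2 where "D2 = (\<lambda>u::real^('x \<times> 'y). \<Sum>y\<in>UNIV. marg2 u y * (ln (marg2 u y) - ln (marg2 t y)))"
  define G where "G = (\<lambda>u::real^('x \<times> 'y). rel_ent P u
    - c * (\<Sum>a\<in>UNIV. u $ a * (ln (u $ a) - ln (marg1 t (fst a) * marg2 t (snd a)))))"
  have tpos: "0 < t $ a" if "a \<in> set_pmf P" for a
    by (rule minimizer_full_support [OF c t min that])
  have mpos: "0 < marg1 t (fst a) \<and> 0 < marg2 t (snd a)" if "a \<in> set_pmf P" for a
    using marg_pos [OF t tpos [OF that]] by simp
  have decomp: "rel_ent P u - c * mut_inf u = G u + c * (D1 u + D2 u)" if "u \<in> prob_on (set_pmf P)" for u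
    using rel_ent_product_decomposition [OF that, of "marg1 t" "marg2 t"] mpos prob_on_support [OF that]
    by (simp add: G_def D1_def D2_def algebra_simps)
  have Gt: "G t = rel_ent P t - c * mut_inf t"
    using decomp [OF t] by (simp add: D1_def D2_def)
  have "convex_on (prob_on (set_pmf P)) G"
  proof (rule convex_on_prob_onI)
    fix u v :: "real^('x \<times> 'y)" and \<theta> :: real
    assume *: "u \<in> prob_on (set_pmf P)" "v \<in> prob_on (set_pmf P)" "0 \<le> \<theta>" "\<theta> \<le> 1"
    \<comment> \<open>With the reference product held fixed, \<open>G\<close> is
      \<open>1 - c\<close> times a sum of \<open>xlnx\<close> terms plus a linear function.\<close>
    have G_alt: "G w = (\<Sum>a\<in>UNIV. (1 - c) * xlnx (w $ a)
        - w $ a * (ln (pmf P a) - c * ln (marg1 t (fst a) * marg2 t (snd a))))" for w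
      unfolding G_def rel_ent_def sum_distrib_left sum_subtractf [symmetric]
      by (intro sum.cong) (auto simp: xlnx_def algebra_simps)
    show "G ((1 - \<theta>) *\<^sub>R u + \<theta> *\<^sub>R v) \<le> (1 - \<theta>) * G u + \<theta> * G v"
      unfolding G_alt sum_distrib_left sum.distrib [symmetric]
    proof (rule sum_mono)
      fix a
      have "(1 - c) * xlnx ((1 - \<theta>) * u $ a + \<theta> * v $ a)
          \<le> (1 - c) * ((1 - \<theta>) * xlnx (u $ a) + \<theta> * xlnx (v $ a))"
        using xlnx_convex [of "u $ a" "v $ a" \<theta>] * prob_onD(1) c by (intro mult_left_mono) auto
      then show "(1 - c) * xlnx (((1 - \<theta>) *\<^sub>R u + \<theta> *\<^sub>R v) $ a)
          - ((1 - \<theta>) *\<^sub>R u + \<theta> *\<^sub>R v) $ a * (ln (pmf P a) - c * ln (marg1 t (fst a) * marg2 t (snd a)))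
        \<le> (1 - \<theta>) * ((1 - c) * xlnx (u $ a) - u $ a * (ln (pmf P a) - c * ln (marg1 t (fst a) * marg2 t (snd a))))
          + \<theta> * ((1 - c) * xlnx (v $ a) - v $ a * (ln (pmf P a) - c * ln (marg1 t (fst a) * marg2 t (snd a))))"
        by (simp add: algebra_simps)
    qed
  qed
  note G_convex = this
  define k where "k = (\<Sum>x\<in>UNIV. (marg1 s x - marg1 t x)\<^sup>2 / marg1 t x)
    + (\<Sum>y\<in>UNIV. (marg2 s y - marg2 t y)\<^sup>2 / marg2 t y)"
  have k: "0 \<le> k" unfolding k_def
    using marg_nonneg [OF t] by (intro add_nonneg_nonneg sum_nonneg) auto
  have "G t \<le> G s + c * e * k" if e: "0 < e" "e < 1" for e
  proof -
    let ?u = "(1 - e) *\<^sub>R t + e *\<^sub>R s"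
    have u: "?u \<in> prob_on (set_pmf P)" using t s e by (intro prob_on_mix) auto
    have m1: "0 < marg1 t x" if "0 < marg1 ?u x" for x
      using marg_pos_obtain(1) [OF u that] prob_on_support [OF u] mpos by fastforce
    have m2: "0 < marg2 t y" if "0 < marg2 ?u y" for y
      using marg_pos_obtain(2) [OF u that] prob_on_support [OF u] mpos by fastforce
    have sq: "((1 - e) * x + e * y - x)\<^sup>2 = e\<^sup>2 * (y - x)\<^sup>2" for x y :: real
    proof -
      have "(1 - e) * x + e * y - x = e * (y - x)" by (simp add: algebra_simps)
      then show ?thesis by (simp only: power_mult_distrib)
    qed
    have "D1 ?u \<le> (\<Sum>x\<in>UNIV. (marg1 ?u x - marg1 t x)\<^sup>2 / marg1 t x)"
      unfolding D1_def using marg_nonneg [OF u] marg_nonneg [OF t] sum_marg [OF u] sum_marg [OF t] m1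
      by (intro kl_le_chi_square) auto
    moreover have "D2 ?u \<le> (\<Sum>y\<in>UNIV. (marg2 ?u y - marg2 t y)\<^sup>2 / marg2 t y)"
      unfolding D2_def using marg_nonneg [OF u] marg_nonneg [OF t] sum_marg [OF u] sum_marg [OF t] m2
      by (intro kl_le_chi_square) auto
    ultimately have D: "D1 ?u + D2 ?u \<le> e\<^sup>2 * k"
      unfolding marg_mix sq by (simp add: k_def distrib_left sum_distrib_left)
    \<comment> \<open>The true objective is \<open>G + c (D1 + D2)\<close>. The correction is of
      order \<open>e^2\<close>, whereas by convexity \<open>G\<close> rises by at most
      \<open>e (G s - G t)\<close>; dividing by \<open>e\<close> and letting \<open>e\<close> tend
      to 0 gives \<open>G t \<le> G s\<close>.\<close>
    have "G t \<le> G ?u + c * (D1 ?u + D2 ?u)"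
      using min [OF u] Gt decomp [OF u] by simp
    also have "\<dots> \<le> ((1 - e) * G t + e * G s) + c * (e\<^sup>2 * k)"
      using e D c by (intro add_mono mult_left_mono convex_onD [OF G_convex] t s) auto
    finally have "e * G t \<le> e * (G s + c * e * k)"
      by (simp add: algebra_simps power2_eq_square)
    then show ?thesis using e by simp
  qed
  note bound = this
  have "G t \<le> G s"
  proof (rule field_le_epsilon)
    fix e :: real assume e: "0 < e"
    define d where "d = min (1/2) (e / (c * k + 1))"
    have ck: "0 \<le> c * k" using c k by simp
    have d: "0 < d" "d < 1" using e ck by (auto simp: d_def intro!: divide_pos_pos add_nonneg_pos)
    have "(c * k) * d \<le> (c * k) * (e / (c * k + 1))"
      using ck by (intro mult_left_mono) (auto simp: d_def)
    also have "\<dots> \<le> e" using ck e by (simp add: field_simps)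
    finally have "c * d * k \<le> e" by (simp add: mult_ac)
    then show "G t \<le> G s + e" using bound [OF d] by simp
  qed
  then show ?thesis unfolding Gt by (simp add: G_def)
qed

text \<open>With \<open>c = (s - 1) / s\<close> the quantity is a minimum over products of a maximum
  over \<open>t\<close>. Inserting \<open>t0\<close> for \<open>t\<close> bounds it below for every
  product; the product of the marginals of \<open>t0\<close> attains the bound, since by
  \<open>minimizer_product_divergence\<close> the inner maximum for this product is attained at
  \<open>t0\<close> itself.\<close>

lemma renyi_info_dd_greater_1:
  fixes P :: "('x::finite \<times> 'y::finite) pmf"
  assumes b: "b > 1" and c: "0 < c" "c < 1"
  shows "renyi_info_dd b (1 / (1 - c)) P =
    ereal (- (INF t\<in>prob_on (set_pmf P). rel_ent P t - c * mut_inf t) / (c * ln b))"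
proof -
  define s where "s = 1 / (1 - c)"
  have s: "1 < s" "1 - s = - (c * s)" using c by (auto simp: s_def field_simps)
  have sc: "(1 - s) * x = - (c * s * x)" for x by (simp only: s(2)) simp
  have lnb: "0 < ln b" using b by simp
  have pref: "1 / (s - 1) * (x / ln b) = (x / s) / (c * ln b)" for x
  proof -
    have eq: "s - 1 = c * s" using s(2) by simp
    show ?thesis unfolding eq using s(1) c lnb by (simp add: field_simps)
  qed
  obtain t0 where t0: "t0 \<in> prob_on (set_pmf P)"
    and m: "(INF t\<in>prob_on (set_pmf P). rel_ent P t - c * mut_inf t) = rel_ent P t0 - c * mut_inf t0"
    and m_le: "\<And>t. t \<in> prob_on (set_pmf P) \<Longrightarrow> rel_ent P t0 - c * mut_inf t0 \<le> rel_ent P t - c * mut_inf t"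
    by (rule attains_rel_ent_mut_inf [of P "- c"]) auto
  let ?S = "\<lambda>Q. \<Sum>a\<in>set_pmf P. pmf P a powr s * pmf Q a powr (1 - s)"
  have S_pos: "0 < ?S Q" if "\<forall>a\<in>set_pmf P. pmf Q a \<noteq> 0" for Q
    using that by (intro sum_pos set_pmf_not_empty mult_pos_pos) (simp_all add: set_pmf_iff)
  have "renyi_info_dd b s P = ereal (- (rel_ent P t0 - c * mut_inf t0) / (c * ln b))"
    unfolding renyi_info_dd_def
  proof (rule antisym)
    obtain q r where q: "pmf q = marg1 t0" and r: "pmf r = marg2 t0"
      and pos: "\<And>a. 0 < t0 $ a \<Longrightarrow> 0 < pmf (pair_pmf q r) a"
      by (rule product_of_marginals_pmf [OF t0]) (rule that)
    have nz: "\<forall>a\<in>set_pmf P. pmf (pair_pmf q r) a \<noteq> 0"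
      using pos minimizer_full_support [OF c t0 m_le] by (metis less_irrefl)
    obtain t where t: "t \<in> prob_on (set_pmf P)"
      and eq: "s * rel_ent P t + (1 - s) * (\<Sum>a\<in>UNIV. t $ a * (ln (t $ a) - ln (pmf (pair_pmf q r) a)))
        = - ln (?S (pair_pmf q r))"
      by (rule renyi_tilted_distribution [of "pmf (pair_pmf q r)" P s, OF _ S_pos [OF nz]]) (simp, rule that)
    have "s * (rel_ent P t0 - c * mut_inf t0) \<le> s * (rel_ent P t - c * (\<Sum>a\<in>UNIV. t $ a * (ln (t $ a) - ln (pmf (pair_pmf q r) a))))"
      using minimizer_product_divergence [OF c t0 m_le t] s
      by (intro mult_left_mono) (auto simp: pmf_pair_eta q r)
    then have "ln (?S (pair_pmf q r)) / s \<le> - (rel_ent P t0 - c * mut_inf t0)"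
      using eq [unfolded sc] s(1) by (simp add: field_simps)
    then have "renyi_div b s P (pair_pmf q r) \<le> ereal (- (rel_ent P t0 - c * mut_inf t0) / (c * ln b))"
      using S_pos [OF nz] s(1) c lnb nz
      by (subst renyi_div_eq) (auto simp only: pref ereal_less_eq intro!: divide_right_mono, auto)
    then show "(INF (q, r). renyi_div b s P (pair_pmf q r))
        \<le> ereal (- (rel_ent P t0 - c * mut_inf t0) / (c * ln b))"
      by (intro INF_lower2 [of "(q, r)"]) auto
    show "ereal (- (rel_ent P t0 - c * mut_inf t0) / (c * ln b)) \<le> (INF (q, r). renyi_div b s P (pair_pmf q r))"
    proof (rule INF_greatest, clarify)
      fix q :: "'x pmf" and r :: "'y pmf"
      show "ereal (- (rel_ent P t0 - c * mut_inf t0) / (c * ln b)) \<le> renyi_div b s P (pair_pmf q r)"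
      proof (cases "\<exists>a\<in>set_pmf P. pmf (pair_pmf q r) a = 0")
        case True
        then show ?thesis using s by (simp add: renyi_div_def)
      next
        case False
        then have nz: "\<forall>a\<in>set_pmf P. pmf (pair_pmf q r) a \<noteq> 0" by blast
        have pos: "0 < pmf (pair_pmf q r) a" if "0 < t0 $ a" for a
          using nz prob_on_support [OF t0 that] by (simp add: less_le)
        have "- ln (?S (pair_pmf q r)) \<le> s * rel_ent P t0
            - c * s * (\<Sum>a\<in>UNIV. t0 $ a * (ln (t0 $ a) - ln (pmf (pair_pmf q r) a)))"
          using renyi_gibbs [of t0 P "pmf (pair_pmf q r)" s, OF t0 pos] unfolding sc by simp
        also have "\<dots> \<le> s * rel_ent P t0 - c * s * mut_inf t0"
          using mult_left_mono [OF mut_inf_product_divergence_pmf [OF t0 pos], of "c * s"] s c by simp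
        finally have "- (rel_ent P t0 - c * mut_inf t0) \<le> ln (?S (pair_pmf q r)) / s"
          using s(1) by (simp add: field_simps)
        then show ?thesis
          using S_pos [OF nz] s(1) c lnb nz
          by (subst renyi_div_eq) (auto simp only: pref ereal_less_eq intro!: divide_right_mono, auto)
      qed
    qed
  qed
  then show ?thesis by (simp only: m s_def)
qed

section \<open>Types\<close>

definition types :: "nat \<Rightarrow> 'a multiset set" where
  "types n = {M. size M = n}"

definition type_card :: "'a multiset \<Rightarrow> real" where
  "type_card M = real (card (permutations_of_multiset M))"

definition type_prob :: "'a::finite pmf \<Rightarrow> 'a multiset \<Rightarrow> real" where
  "type_prob P M = type_card M * (\<Prod>a\<in>UNIV. pmf P a ^ count M a)"

text \<open>The probability of the type class of \<open>M\<close> when the two components are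
  independent and uniform on the type classes of the two projections of \<open>M\<close>.\<close>

definition type_weight :: "('x \<times> 'y) multiset \<Rightarrow> real" where
  "type_weight M = type_card M / (type_card (image_mset fst M) * type_card (image_mset snd M))"

lemma type_card_pos: "0 < type_card M"
  by (simp add: type_card_def card_gt_0_iff)

lemma type_card_nonneg [simp]: "0 \<le> type_card M"
  by (simp add: type_card_def)

lemma type_weight_pos: "0 < type_weight M"
  by (simp add: type_weight_def type_card_pos)

lemma type_weight_nonneg [simp]: "0 \<le> type_weight M"
  using type_weight_pos [of M] by simp

lemma type_prob_nonneg: "0 \<le> type_prob P M"
  using type_card_pos [of M] by (simp add: type_prob_def prod_nonneg)

lemma types_eq_image: "types n = mset ` {as. length as = n}"
proof -
  have "M \<in> mset ` {as. length as = n}" if "size M = n" for M :: "'a multiset"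
  proof -
    obtain as where "mset as = M" by (metis ex_mset)
    then show ?thesis using that by (auto simp flip: size_mset)
  qed
  then show ?thesis by (auto simp: types_def)
qed

lemma finite_lists_length [simp]: "finite {as :: 'a::finite list. length as = n}"
  using finite_lists_length_eq [of "UNIV :: 'a set" n] by simp

lemma finite_types [simp]: "finite (types n :: 'a::finite multiset set)"
  unfolding types_eq_image by (rule finite_imageI) simp

lemma types_nonempty: "(types n :: 'a multiset set) \<noteq> {}"
  by (auto simp: types_def intro!: exI [of _ "replicate_mset n undefined"])

lemma card_types_pos: "0 < card (types n :: 'a::finite multiset set)"
  by (simp add: card_gt_0_iff types_nonempty)

lemma sum_lists_eq_sum_types:
  fixes F :: "'a::finite list \<Rightarrow> real"
  shows "(\<Sum>as | length as = n. F as) = (\<Sum>M\<in>types n. \<Sum>as\<in>permutations_of_multiset M. F as)"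
proof -
  have "(\<Sum>as | length as = n. F as)
    = (\<Sum>M\<in>types n. sum F {as \<in> {as. length as = n}. mset as = M})"
    by (rule sum.group [symmetric]) (simp, simp, auto simp: types_def)
  also have "\<dots> = (\<Sum>M\<in>types n. \<Sum>as\<in>permutations_of_multiset M. F as)"
  proof (rule sum.cong [OF refl])
    fix M :: "'a multiset" assume "M \<in> types n"
    then have "{as \<in> {as. length as = n}. mset as = M} = permutations_of_multiset M"
      by (auto simp: types_def permutations_of_multiset_def simp flip: size_mset)
    then show "sum F {as \<in> {as. length as = n}. mset as = M} = (\<Sum>as\<in>permutations_of_multiset M. F as)"
      by simp
  qed
  finally show ?thesis .
qed

lemma pmf_replicate_pmf_prod_list: "pmf (replicate_pmf (length as) P) as = prod_list (map (pmf P) as)"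
proof (induction as)
  case (Cons a as)
  have "replicate_pmf (Suc (length as)) P
    = map_pmf (\<lambda>(x, xs). x # xs) (pair_pmf P (replicate_pmf (length as) P))"
    by (simp add: pair_pmf_def map_bind_pmf)
  moreover have "inj (\<lambda>(x::'a, xs). x # xs)" by (auto simp: inj_on_def)
  ultimately show ?case
    using pmf_map_inj' [of "\<lambda>(x::'a, xs). x # xs" "pair_pmf P (replicate_pmf (length as) P)" "(a, as)"]
    by (simp add: pmf_pair Cons.IH del: replicate_pmf.simps)
qed simp

lemma prod_list_eq_prod_count:
  fixes h :: "'a::finite \<Rightarrow> real"
  shows "prod_list (map h as) = (\<Prod>a\<in>UNIV. h a ^ count (mset as) a)"
proof (induction as)
  case (Cons x as)
  have "(\<Prod>a\<in>UNIV. h a ^ count (mset (x # as)) a)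
    = (\<Prod>a\<in>UNIV. h a ^ count (mset as) a * (if a = x then h a else 1))"
    by (intro prod.cong) auto
  also have "\<dots> = h x * (\<Prod>a\<in>UNIV. h a ^ count (mset as) a)"
    by (simp add: prod.distrib)
  finally show ?case using Cons.IH by simp
qed simp

lemma pmf_replicate_pmf_type:
  fixes P :: "'a::finite pmf"
  assumes "M \<in> types n" "as \<in> permutations_of_multiset M"
  shows "pmf (replicate_pmf n P) as = (\<Prod>a\<in>UNIV. pmf P a ^ count M a)"
proof -
  have "mset as = M" "length as = n"
    using assms by (auto simp: types_def permutations_of_multiset_def simp flip: size_mset)
  then show ?thesis
    using pmf_replicate_pmf_prod_list [of as P] prod_list_eq_prod_count [of "pmf P" as] by simp
qed

lemma sum_pmf_lists_le_1: "finite S \<Longrightarrow> (\<Sum>as\<in>S. pmf q as) \<le> 1"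
  by (simp add: flip: measure_measure_pmf_finite)

lemma err1_eq_types:
  "err1 P n T = (\<Sum>M\<in>types n. (\<Prod>a\<in>UNIV. pmf P a ^ count M a) * (\<Sum>as\<in>permutations_of_multiset M. 1 - T as))"
  unfolding err1_def sum_lists_eq_sum_types
  by (intro sum.cong refl) (simp add: pmf_replicate_pmf_type sum_distrib_left)

lemma sum_type_prob: "(\<Sum>M\<in>types n. type_prob P M) = 1"
proof -
  have "(\<Sum>M\<in>types n. type_prob P M) = err1 P n (\<lambda>_. 0)"
    unfolding err1_eq_types type_prob_def type_card_def by (intro sum.cong) auto
  also have "\<dots> = (\<Sum>as | length as = n. pmf (replicate_pmf n P) as)" by (simp add: err1_def)
  also have "\<dots> = 1"
    by (rule sum_pmf_eq_1) (auto simp: set_replicate_pmf)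
  finally show ?thesis .
qed

section \<open>Permutation invariant distributions on type classes\<close>

lemma inj_on_permute_list:
  assumes "\<pi> permutes {..<n}"
  shows "inj_on (permute_list \<pi>) {xs. length xs = n}"
proof (rule inj_onI)
  fix xs ys :: "'a list"
  assume *: "xs \<in> {xs. length xs = n}" "ys \<in> {xs. length xs = n}" "permute_list \<pi> xs = permute_list \<pi> ys"
  have "permute_list (inv \<pi>) (permute_list \<pi> zs) = zs" if "length zs = n" for zs :: "'a list"
    using permute_list_compose [of "inv \<pi>" zs \<pi>] assms that permutes_inv [OF assms] permutes_inv_o(1) [OF assms]
    by (simp flip: permute_list_compose)
  then show "xs = ys" using * by (metis mem_Collect_eq)
qed

lemma sym_pmf_permutation_invariant:
  assumes q: "q \<in> sym_pmfs n" and "mset xs = mset ys" "length ys = n"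
  shows "pmf q xs = pmf q ys"
proof -
  obtain \<pi> where \<pi>: "\<pi> permutes {..<length ys}" "permute_list \<pi> ys = xs"
    using mset_eq_permutation [OF assms(2)] by blast
  have sup: "set_pmf q \<subseteq> {xs. length xs = n}" and inv: "map_pmf (permute_list \<pi>) q = q"
    using q \<pi>(1) assms(3) by (auto simp: sym_pmfs_def seq_pmfs_def)
  have inj: "inj_on (permute_list \<pi>) {xs :: 'a list. length xs = n}"
    using inj_on_permute_list \<pi>(1) assms(3) by blast
  have "pmf q (permute_list \<pi> ys) = pmf (map_pmf (permute_list \<pi>) q) (permute_list \<pi> ys)"
    by (simp add: inv)
  \<comment> \<open>The intersection with the support is essential:
    \<open>permute_list \<pi>\<close> is controlled only on lists of length
    \<open>n\<close>.\<close>
  also have "\<dots> = measure_pmf.prob q (permute_list \<pi> -` {permute_list \<pi> ys} \<inter> set_pmf q)"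
    by (simp add: pmf_map measure_Int_set_pmf)
  also have "permute_list \<pi> -` {permute_list \<pi> ys} \<inter> set_pmf q = {ys} \<inter> set_pmf q"
  proof -
    have "zs = ys" if "zs \<in> set_pmf q" "permute_list \<pi> zs = permute_list \<pi> ys" for zs
      by (rule inj_onD [OF inj that(2)]) (use that(1) sup assms(3) in auto)
    then show ?thesis by blast
  qed
  also have "measure_pmf.prob q ({ys} \<inter> set_pmf q) = pmf q ys"
    by (simp add: measure_Int_set_pmf measure_pmf_single)
  finally show ?thesis by (simp only: \<pi>(2))
qed

lemma sym_pmf_le:
  fixes q :: "'a::finite list pmf"
  assumes q: "q \<in> sym_pmfs n" and "length xs = n"
  shows "pmf q xs \<le> 1 / type_card (mset xs)"
proof -
  have "(\<Sum>ys\<in>permutations_of_multiset (mset xs). pmf q ys) = type_card (mset xs) * pmf q xs"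
  proof -
    have "pmf q ys = pmf q xs" if "ys \<in> permutations_of_multiset (mset xs)" for ys
      using that assms(2) by (intro sym_pmf_permutation_invariant [OF q]) (auto simp: permutations_of_multiset_def)
    then have "(\<Sum>ys\<in>permutations_of_multiset (mset xs). pmf q ys)
      = (\<Sum>ys\<in>permutations_of_multiset (mset xs). pmf q xs)" by (intro sum.cong) auto
    then show ?thesis by (simp add: type_card_def)
  qed
  then have "type_card (mset xs) * pmf q xs \<le> 1"
    using sum_pmf_lists_le_1 [of "permutations_of_multiset (mset xs)" q] by simp
  then show ?thesis using type_card_pos [of "mset xs"] by (simp add: field_simps)
qed

text \<open>\<open>zip\<close> truncates to the shorter list; because both supports consist of lists
  of length \<open>n\<close>, only one pair of the support is zipped to \<open>as\<close>.\<close>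

lemma pmf_zip_pmf:
  assumes "q \<in> seq_pmfs n" "r \<in> seq_pmfs n" "length as = n"
  shows "pmf (zip_pmf q r) as = pmf q (map fst as) * pmf r (map snd as)"
proof -
  let ?f = "\<lambda>(xs, ys). zip xs ys"
  have sup: "set_pmf (pair_pmf q r) \<subseteq> {(xs, ys). length xs = n \<and> length ys = n}"
    using assms by (auto simp: seq_pmfs_def)
  have "pmf (zip_pmf q r) as = measure_pmf.prob (pair_pmf q r) (?f -` {as} \<inter> set_pmf (pair_pmf q r))"
    unfolding zip_pmf_def pmf_map by (simp only: measure_Int_set_pmf)
  also have "?f -` {as} \<inter> set_pmf (pair_pmf q r) = {(map fst as, map snd as)} \<inter> set_pmf (pair_pmf q r)"
    using sup by (auto simp: zip_map_fst_snd)
  also have "measure_pmf.prob (pair_pmf q r) \<dots> = pmf (pair_pmf q r) (map fst as, map snd as)"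
    by (simp only: measure_Int_set_pmf measure_pmf_single)
  finally show ?thesis by (simp add: pmf_pair)
qed

lemma map_permutations_of_multiset:
  "map h ` permutations_of_multiset M \<subseteq> permutations_of_multiset (image_mset h M)"
  by (auto simp: permutations_of_multiset_def)

text \<open>A permutation of positions that carries \<open>zs\<close> to \<open>zs'\<close> maps the
  fiber over \<open>zs\<close> injectively into the fiber over \<open>zs'\<close>. By symmetry all
  fibers have the same size.\<close>

lemma card_type_fiber:
  fixes M :: "'a::finite multiset" and h :: "'a \<Rightarrow> 'b"
  assumes zs: "zs \<in> permutations_of_multiset (image_mset h M)"
  shows "real (card {as \<in> permutations_of_multiset M. map h as = zs}) * type_card (image_mset h M) = type_card M"
proof -
  let ?F = "\<lambda>zs. {as \<in> permutations_of_multiset M. map h as = zs}"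
  have le: "card (?F zs) \<le> card (?F zs')"
    if "zs \<in> permutations_of_multiset (image_mset h M)" "zs' \<in> permutations_of_multiset (image_mset h M)"
    for zs zs'
  proof -
    have "mset zs' = mset zs" using that by (simp add: permutations_of_multiset_def)
    then obtain \<pi> where \<pi>: "\<pi> permutes {..<length zs}" "permute_list \<pi> zs = zs'"
      by (rule mset_eq_permutation)
    have len: "length as = length zs" if "as \<in> ?F zs" for as using that by auto
    show ?thesis
    proof (rule card_inj_on_le)
      show "inj_on (permute_list \<pi>) (?F zs)"
        by (rule inj_on_subset [OF inj_on_permute_list [OF \<pi>(1)]]) auto
      show "permute_list \<pi> ` ?F zs \<subseteq> ?F zs'"
      proof (rule image_subsetI)
        fix as assume as: "as \<in> ?F zs"
        then have p: "\<pi> permutes {..<length as}" using \<pi>(1) by auto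
        have "map h (permute_list \<pi> as) = permute_list \<pi> (map h as)"
          by (rule permute_list_map [OF p, symmetric])
        also have "\<dots> = zs'" using as \<pi>(2) by simp
        finally show "permute_list \<pi> as \<in> ?F zs'"
          using as p by (simp add: permutations_of_multiset_def)
      qed
    qed simp
  qed
  have "real (card (permutations_of_multiset M)) = (\<Sum>as\<in>permutations_of_multiset M. 1)" by simp
  also have "\<dots> = (\<Sum>zs'\<in>permutations_of_multiset (image_mset h M). \<Sum>as\<in>?F zs'. 1)"
    by (rule sum.group [OF _ _ map_permutations_of_multiset, symmetric]) simp_all
  also have "\<dots> = (\<Sum>zs'\<in>permutations_of_multiset (image_mset h M). real (card (?F zs)))"
    using le zs by (intro sum.cong refl) (auto intro!: antisym)
  finally show ?thesis by (simp add: type_card_def mult.commute)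
qed

text \<open>Controls a factor \<open>r\<close> without any symmetry: as the fibers have equal size,
  \<open>r\<close> enters only through its total mass on the projected type class.\<close>

lemma sum_type_map_le:
  fixes M :: "'a::finite multiset" and h :: "'a \<Rightarrow> 'b::finite"
  shows "(\<Sum>as\<in>permutations_of_multiset M. pmf r (map h as)) \<le> type_card M / type_card (image_mset h M)"
proof -
  let ?F = "\<lambda>zs. {as \<in> permutations_of_multiset M. map h as = zs}"
  have "(\<Sum>as\<in>permutations_of_multiset M. pmf r (map h as))
    = (\<Sum>zs\<in>permutations_of_multiset (image_mset h M). \<Sum>as\<in>?F zs. pmf r (map h as))"
    by (rule sum.group [OF _ _ map_permutations_of_multiset, symmetric]) simp_all
  also have "\<dots> = (\<Sum>zs\<in>permutations_of_multiset (image_mset h M).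
      type_card M / type_card (image_mset h M) * pmf r zs)"
  proof (rule sum.cong [OF refl])
    fix zs assume "zs \<in> permutations_of_multiset (image_mset h M)"
    from card_type_fiber [OF this]
    have "real (card (?F zs)) = type_card M / type_card (image_mset h M)"
      using type_card_pos [of "image_mset h M"] by (simp add: field_simps)
    then show "(\<Sum>as\<in>?F zs. pmf r (map h as)) = type_card M / type_card (image_mset h M) * pmf r zs"
      by simp
  qed
  also have "\<dots> \<le> type_card M / type_card (image_mset h M) * 1"
    unfolding sum_distrib_left [symmetric]
    by (intro mult_left_mono sum_pmf_lists_le_1) (auto intro!: divide_nonneg_nonneg)
  finally show ?thesis by simp
qed

section \<open>One-shot bounds on the optimal error\<close>

text \<open>What the three alternative hypotheses have in common: the largest probability of a joint type
  under a single alternative is \<open>type_weight\<close>.\<close>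

definition type_bounded :: "nat \<Rightarrow> ('x::finite \<times> 'y::finite) list pmf set \<Rightarrow> bool" where
  "type_bounded n \<Q> \<longleftrightarrow>
    (\<forall>Q\<in>\<Q>. \<forall>M\<in>types n. (\<Sum>as\<in>permutations_of_multiset M. pmf Q as) \<le> type_weight M) \<and>
    (\<forall>M\<in>types n. \<exists>Q\<in>\<Q>. \<forall>as\<in>permutations_of_multiset M.
       pmf Q as = 1 / (type_card (image_mset fst M) * type_card (image_mset snd M)))"

text \<open>One invariant factor is enough: it is bounded pointwise by the reciprocal of the size of
  its type class, and the other factor is then summed by \<open>sum_type_map_le\<close>.\<close>

lemma zip_pmf_type_le:
  fixes q :: "'x::finite list pmf" and r :: "'y::finite list pmf"
  assumes q: "q \<in> seq_pmfs n" and r: "r \<in> seq_pmfs n" and sym: "q \<in> sym_pmfs n \<or> r \<in> sym_pmfs n"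
    and M: "M \<in> types n"
  shows "(\<Sum>as\<in>permutations_of_multiset M. pmf (zip_pmf q r) as) \<le> type_weight M"
proof -
  have as: "length as = n \<and> mset (map fst as) = image_mset fst M \<and> mset (map snd as) = image_mset snd M"
    if "as \<in> permutations_of_multiset M" for as
    using that M by (auto simp: types_def permutations_of_multiset_def simp flip: size_mset)
  have "(\<Sum>as\<in>permutations_of_multiset M. pmf (zip_pmf q r) as)
    = (\<Sum>as\<in>permutations_of_multiset M. pmf q (map fst as) * pmf r (map snd as))"
    using as by (intro sum.cong refl pmf_zip_pmf [OF q r]) auto
  also have "\<dots> \<le> type_weight M"
    using sym
  proof
    assume "q \<in> sym_pmfs n"
    then have "pmf q (map fst as) \<le> 1 / type_card (image_mset fst M)" if "as \<in> permutations_of_multiset M" for as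
      using sym_pmf_le [of q n "map fst as"] as [OF that] by simp
    then have "(\<Sum>as\<in>permutations_of_multiset M. pmf q (map fst as) * pmf r (map snd as))
      \<le> (\<Sum>as\<in>permutations_of_multiset M. 1 / type_card (image_mset fst M) * pmf r (map snd as))"
      by (intro sum_mono mult_right_mono) auto
    also have "\<dots> \<le> 1 / type_card (image_mset fst M) * (type_card M / type_card (image_mset snd M))"
      unfolding sum_distrib_left [symmetric]
      by (intro mult_left_mono sum_type_map_le) auto
    finally show ?thesis by (simp add: type_weight_def)
  next
    assume "r \<in> sym_pmfs n"
    then have "pmf r (map snd as) \<le> 1 / type_card (image_mset snd M)" if "as \<in> permutations_of_multiset M" for as
      using sym_pmf_le [of r n "map snd as"] as [OF that] by simp
    then have "(\<Sum>as\<in>permutations_of_multiset M. pmf q (map fst as) * pmf r (map snd as))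
      \<le> (\<Sum>as\<in>permutations_of_multiset M. pmf q (map fst as) * (1 / type_card (image_mset snd M)))"
      by (intro sum_mono mult_left_mono) auto
    also have "\<dots> \<le> (type_card M / type_card (image_mset fst M)) * (1 / type_card (image_mset snd M))"
      unfolding sum_distrib_right [symmetric]
      by (intro mult_right_mono sum_type_map_le) auto
    finally show ?thesis by (simp add: type_weight_def)
  qed
  finally show ?thesis .
qed

lemma uniform_type_sym_pmf:
  fixes M :: "'a::finite multiset"
  assumes "M \<in> types n"
  shows "pmf_of_set (permutations_of_multiset M) \<in> sym_pmfs n"
  unfolding sym_pmfs_def seq_pmfs_def
proof (intro CollectI conjI allI impI)
  have len: "length as = n" if "as \<in> permutations_of_multiset M" for as
    using that assms by (auto simp: types_def permutations_of_multiset_def simp flip: size_mset)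
  then show "set_pmf (pmf_of_set (permutations_of_multiset M)) \<subseteq> {xs. length xs = n}" by auto
  fix \<pi> :: "nat \<Rightarrow> nat" assume \<pi>: "\<pi> permutes {..<n}"
  have inj: "inj_on (permute_list \<pi>) (permutations_of_multiset M)"
    using len by (intro inj_on_subset [OF inj_on_permute_list [OF \<pi>]]) auto
  moreover have "permute_list \<pi> ` permutations_of_multiset M \<subseteq> permutations_of_multiset M"
    using len \<pi> by (auto simp: permutations_of_multiset_def)
  ultimately have "bij_betw (permute_list \<pi>) (permutations_of_multiset M) (permutations_of_multiset M)"
    by (simp add: bij_betw_def endo_inj_surj)
  then show "map_pmf (permute_list \<pi>) (pmf_of_set (permutations_of_multiset M))
    = pmf_of_set (permutations_of_multiset M)"
    by (rule map_pmf_of_set_bij_betw) auto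
qed

lemma sym_pmfs_subset: "sym_pmfs n \<subseteq> seq_pmfs n"
  by (auto simp: sym_pmfs_def)

text \<open>For attainment, both factors are taken uniform on the projected type classes. Such a
  product has two invariant factors and so belongs to all three hypotheses.\<close>

lemma type_bounded_alternatives:
  fixes \<Q> :: "nat \<Rightarrow> ('x::finite \<times> 'y::finite) list pmf set"
  assumes "\<Q> = alt_sym \<or> \<Q> = alt_sym_left \<or> \<Q> = alt_sym_right"
  shows "type_bounded n (\<Q> n)"
  unfolding type_bounded_def
proof (intro conjI ballI)
  fix Q and M :: "('x \<times> 'y) multiset" assume Q: "Q \<in> \<Q> n" and M: "M \<in> types n"
  have "\<exists>q r. Q = zip_pmf q r \<and> q \<in> seq_pmfs n \<and> r \<in> seq_pmfs n \<and> (q \<in> sym_pmfs n \<or> r \<in> sym_pmfs n)"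
    using assms
  proof (elim disjE)
    assume "\<Q> = alt_sym"
    then show ?thesis using Q by (auto simp: alt_sym_def dest: subsetD [OF sym_pmfs_subset])
  next
    assume "\<Q> = alt_sym_left"
    then show ?thesis using Q by (auto simp: alt_sym_left_def dest: subsetD [OF sym_pmfs_subset])
  next
    assume "\<Q> = alt_sym_right"
    then show ?thesis using Q by (auto simp: alt_sym_right_def dest: subsetD [OF sym_pmfs_subset])
  qed
  then show "(\<Sum>as\<in>permutations_of_multiset M. pmf Q as) \<le> type_weight M"
    using zip_pmf_type_le M by blast
next
  fix M :: "('x \<times> 'y) multiset" assume M: "M \<in> types n"
  define q where "q = pmf_of_set (permutations_of_multiset (image_mset fst M))"
  define r where "r = pmf_of_set (permutations_of_multiset (image_mset snd M))"
  have sym: "q \<in> sym_pmfs n" "r \<in> sym_pmfs n"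
    unfolding q_def r_def using M by (auto intro!: uniform_type_sym_pmf simp: types_def)
  then have seq: "q \<in> seq_pmfs n" "r \<in> seq_pmfs n" by (auto dest: subsetD [OF sym_pmfs_subset])
  have "zip_pmf q r \<in> \<Q> n"
    using assms sym seq unfolding alt_sym_def alt_sym_left_def alt_sym_right_def by blast
  moreover have "pmf (zip_pmf q r) as = 1 / (type_card (image_mset fst M) * type_card (image_mset snd M))"
    if "as \<in> permutations_of_multiset M" for as
  proof -
    have "length as = n" "map fst as \<in> permutations_of_multiset (image_mset fst M)"
      "map snd as \<in> permutations_of_multiset (image_mset snd M)"
      using that M by (auto simp: types_def permutations_of_multiset_def simp flip: size_mset)
    moreover from this have "pmf q (map fst as) = 1 / type_card (image_mset fst M)"
      "pmf r (map snd as) = 1 / type_card (image_mset snd M)"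
      by (simp_all add: q_def r_def type_card_def)
    ultimately show ?thesis by (simp add: pmf_zip_pmf [OF seq])
  qed
  ultimately show "\<exists>Q\<in>\<Q> n. \<forall>as\<in>permutations_of_multiset M.
      pmf Q as = 1 / (type_card (image_mset fst M) * type_card (image_mset snd M))" by blast
qed

lemma type_boundedD:
  assumes "type_bounded n \<Q>" "M \<in> types n"
  shows "Q \<in> \<Q> \<Longrightarrow> (\<Sum>as\<in>permutations_of_multiset M. pmf Q as) \<le> type_weight M"
    and "\<exists>Q\<in>\<Q>. \<forall>as\<in>permutations_of_multiset M.
       pmf Q as = 1 / (type_card (image_mset fst M) * type_card (image_mset snd M))"
  using assms by (auto simp: type_bounded_def)

lemma type_bounded_nonempty: "type_bounded n \<Q> \<Longrightarrow> \<Q> \<noteq> {}"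
  using types_nonempty type_boundedD(2) by fastforce

section \<open>Tests and the optimal error\<close>

lemma err1_nonneg: "T \<in> tests n \<Longrightarrow> 0 \<le> err1 P n T"
  unfolding err1_def by (intro sum_nonneg) (auto simp: tests_def)

lemma err2_upper:
  assumes T: "T \<in> tests n" and Q: "Q \<in> \<Q> n"
  shows "(\<Sum>as | length as = n. pmf Q as * T as) \<le> err2 \<Q> n T"
proof -
  have "(\<Sum>as | length as = n. pmf Q as * T as) \<le> 1" for Q
  proof -
    have "(\<Sum>as | length as = n. pmf Q as * T as) \<le> (\<Sum>as | length as = n. pmf Q as)"
      using T by (intro sum_mono) (auto simp: tests_def mult_left_le)
    then show ?thesis using sum_pmf_lists_le_1 [of "{as. length as = n}" Q] by simp
  qed
  then have "bdd_above ((\<lambda>Q. \<Sum>as | length as = n. pmf Q as * T as) ` \<Q> n)"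
    by (intro bdd_aboveI2)
  then show ?thesis unfolding err2_def by (rule cSUP_upper [OF Q])
qed

lemma zero_test:
  assumes "type_bounded n (\<Q> n)" "0 \<le> \<mu>"
  shows "(\<lambda>_. 0) \<in> {T \<in> tests n. err2 \<Q> n T \<le> \<mu>}"
  using assms type_bounded_nonempty [OF assms(1)] by (simp add: tests_def err2_def)

lemma opt_err_le: "T \<in> {T \<in> tests n. err2 \<Q> n T \<le> \<mu>} \<Longrightarrow> opt_err P \<Q> n \<mu> \<le> err1 P n T"
  unfolding opt_err_def by (intro cINF_lower bdd_belowI2 [of _ 0]) (auto intro: err1_nonneg)

lemma opt_err_nonneg:
  assumes "type_bounded n (\<Q> n)" "0 \<le> \<mu>"
  shows "0 \<le> opt_err P \<Q> n \<mu>"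
  unfolding opt_err_def using zero_test [of n \<Q> \<mu>, OF assms]
  by (intro cINF_greatest) (auto intro: err1_nonneg)

text \<open>The alternative that is constant on the type class of \<open>M\<close> already caps the
  fraction of this class that a feasible test accepts at \<mu> divided by
  \<open>type_weight M\<close>.\<close>

lemma opt_err_lower_bound:
  fixes P :: "('x::finite \<times> 'y::finite) pmf"
  assumes tb: "type_bounded n (\<Q> n)" and \<mu>: "0 \<le> \<mu>"
  shows "(\<Sum>M\<in>types n. type_prob P M * (1 - min 1 (\<mu> / type_weight M))) \<le> opt_err P \<Q> n \<mu>"
  unfolding opt_err_def
proof (rule cINF_greatest)
  show "{T \<in> tests n. err2 \<Q> n T \<le> \<mu>} \<noteq> {}" using zero_test [of n \<Q> \<mu>, OF assms] by blast
  fix T assume T: "T \<in> {T \<in> tests n. err2 \<Q> n T \<le> \<mu>}"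
  show "(\<Sum>M\<in>types n. type_prob P M * (1 - min 1 (\<mu> / type_weight M))) \<le> err1 P n T"
    unfolding err1_eq_types
  proof (rule sum_mono)
    fix M :: "('x \<times> 'y) multiset" assume M: "M \<in> types n"
    define Z where "Z = type_card (image_mset fst M) * type_card (image_mset snd M)"
    define \<tau> where "\<tau> = (\<Sum>as\<in>permutations_of_multiset M. T as)"
    have Z: "0 < Z" by (simp add: Z_def type_card_pos)
    have as: "length as = n" if "as \<in> permutations_of_multiset M" for as
      using that M by (auto simp: types_def permutations_of_multiset_def simp flip: size_mset)
    have T01: "0 \<le> T as" "T as \<le> 1" if "length as = n" for as using that T by (auto simp: tests_def)
    obtain Q where Q: "Q \<in> \<Q> n" "\<And>as. as \<in> permutations_of_multiset M \<Longrightarrow> pmf Q as = 1 / Z"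
      using type_boundedD(2) [OF tb M] unfolding Z_def by blast
    have "\<tau> / Z = (\<Sum>as\<in>permutations_of_multiset M. pmf Q as * T as)"
      using Q(2) by (simp add: \<tau>_def sum_divide_distrib)
    also have "\<dots> \<le> (\<Sum>as | length as = n. pmf Q as * T as)"
      using as T01 by (intro sum_mono2) auto
    also have "\<dots> \<le> \<mu>" using err2_upper [of T n Q \<Q>] T Q(1) by auto
    finally have "\<tau> \<le> \<mu> * Z" using Z by (simp add: field_simps)
    moreover have "\<mu> * Z = type_card M * (\<mu> / type_weight M)"
      using Z type_card_pos [of M] by (simp add: type_weight_def Z_def)
    moreover have "\<tau> \<le> type_card M"
      unfolding \<tau>_def type_card_def using sum_bounded_above [of "permutations_of_multiset M" T 1] T01 as by auto
    ultimately have "\<tau> \<le> type_card M * min 1 (\<mu> / type_weight M)"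
      by (simp add: min_def)
    then have "type_card M * (1 - min 1 (\<mu> / type_weight M)) \<le> (\<Sum>as\<in>permutations_of_multiset M. 1 - T as)"
      by (simp add: \<tau>_def type_card_def sum_subtractf algebra_simps)
    then have "(\<Prod>a\<in>UNIV. pmf P a ^ count M a) * (type_card M * (1 - min 1 (\<mu> / type_weight M)))
      \<le> (\<Prod>a\<in>UNIV. pmf P a ^ count M a) * (\<Sum>as\<in>permutations_of_multiset M. 1 - T as)"
      by (intro mult_left_mono prod_nonneg) auto
    then show "type_prob P M * (1 - min 1 (\<mu> / type_weight M))
      \<le> (\<Prod>a\<in>UNIV. pmf P a ^ count M a) * (\<Sum>as\<in>permutations_of_multiset M. 1 - T as)"
      by (simp only: type_prob_def mult_ac)
  qed
qed

text \<open>A test depending only on the type, which lets each type contribute at most \<mu> divided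
  by \<open>N\<close> to the second error under every alternative. As there are \<open>N\<close>
  types, the constraint holds uniformly over the alternatives.\<close>

lemma opt_err_upper_bound:
  fixes P :: "('x::finite \<times> 'y::finite) pmf"
  assumes tb: "type_bounded n (\<Q> n)" and \<mu>: "0 \<le> \<mu>"
  defines "N \<equiv> real (card (types n :: ('x \<times> 'y) multiset set))"
  shows "opt_err P \<Q> n \<mu> \<le> (\<Sum>M\<in>types n. type_prob P M * (1 - min 1 (\<mu> / (N * type_weight M))))"
proof -
  have N: "0 < N" using card_types_pos [where ?'a = "'x \<times> 'y"] by (simp add: N_def)
  define \<tau> where "\<tau> = (\<lambda>M :: ('x \<times> 'y) multiset. min 1 (\<mu> / (N * type_weight M)))"
  define T where "T = (\<lambda>as :: ('x \<times> 'y) list. \<tau> (mset as))"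
  have \<tau>: "0 \<le> \<tau> M" "\<tau> M * type_weight M \<le> \<mu> / N" for M
  proof -
    show "0 \<le> \<tau> M" using \<mu> N type_weight_pos [of M] by (simp add: \<tau>_def less_imp_le)
    have "\<tau> M * type_weight M \<le> \<mu> / (N * type_weight M) * type_weight M"
      using type_weight_pos [of M] by (intro mult_right_mono) (auto simp: \<tau>_def)
    then show "\<tau> M * type_weight M \<le> \<mu> / N" using type_weight_pos [of M] by simp
  qed
  have T: "T \<in> tests n" using \<tau> by (auto simp: tests_def T_def \<tau>_def)
  have T_type: "T as = \<tau> M" if "as \<in> permutations_of_multiset M" for as M
    using that by (simp add: T_def permutations_of_multiset_def)
  have "err2 \<Q> n T \<le> \<mu>" unfolding err2_def
  proof (rule cSUP_least [OF type_bounded_nonempty [OF tb]])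
    fix Q assume Q: "Q \<in> \<Q> n"
    have "(\<Sum>as | length as = n. pmf Q as * T as)
      = (\<Sum>M\<in>types n. \<tau> M * (\<Sum>as\<in>permutations_of_multiset M. pmf Q as))"
      unfolding sum_lists_eq_sum_types by (intro sum.cong refl) (simp add: T_type sum_distrib_left mult.commute)
    also have "\<dots> \<le> (\<Sum>M\<in>types n. \<tau> M * type_weight M)"
      using \<tau> type_boundedD(1) [OF tb _ Q] by (intro sum_mono mult_left_mono) auto
    also have "\<dots> \<le> (\<Sum>M\<in>(types n :: ('x \<times> 'y) multiset set). \<mu> / N)" using \<tau> by (intro sum_mono)
    also have "\<dots> = \<mu>" using N by (simp add: N_def types_nonempty)
    finally show "(\<Sum>as | length as = n. pmf Q as * T as) \<le> \<mu>" .
  qed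
  then have "opt_err P \<Q> n \<mu> \<le> err1 P n T" using T by (intro opt_err_le) auto
  also have "\<dots> = (\<Sum>M\<in>types n. type_prob P M * (1 - \<tau> M))"
    unfolding err1_eq_types type_prob_def type_card_def
    by (intro sum.cong refl) (simp add: T_type mult_ac)
  finally show ?thesis by (simp add: \<tau>_def)
qed

lemma one_minus_opt_err_bounds:
  fixes P :: "('x::finite \<times> 'y::finite) pmf"
  assumes tb: "type_bounded n (\<Q> n)" and \<mu>: "0 \<le> \<mu>"
  shows "1 - opt_err P \<Q> n \<mu> \<le> (\<Sum>M\<in>types n. type_prob P M * min 1 (\<mu> / type_weight M))"
    "(\<Sum>M\<in>types n. type_prob P M *
        min 1 (\<mu> / (real (card (types n :: ('x \<times> 'y) multiset set)) * type_weight M))) \<le> 1 - opt_err P \<Q> n \<mu>"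
  using opt_err_lower_bound [where n = n and \<Q> = \<Q> and \<mu> = \<mu> and P = P, OF assms] opt_err_upper_bound [where n = n and \<Q> = \<Q> and \<mu> = \<mu> and P = P, OF assms] sum_type_prob [of P n]
  by (simp_all add: right_diff_distrib sum_subtractf)

section \<open>Exponential estimates for types\<close>

lemma ln_fact_bounds:
  "xlnx (real m) - real m \<le> ln (fact m)"
  "ln (fact m) \<le> xlnx (real m) - real m + ln (real m + 1) + 1"
proof -
  \<comment> \<open>The induction runs with \<open>ln m\<close> for positive \<open>m\<close>; the
    step needs \<open>x (ln (x + 1) - ln x) \<le> 1 \<le> (x + 1) (ln (x + 1) - ln x)\<close>. The
    final form with \<open>ln (m + 1)\<close> covers \<open>m = 0\<close> as well.\<close>
  have "xlnx (real m) - real m \<le> ln (fact m) \<and> (0 < m \<longrightarrow> ln (fact m) \<le> xlnx (real m) - real m + ln (real m) + 1)"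
  proof (induction m)
    case (Suc m)
    have fact: "ln (fact (Suc m) :: real) = ln (real (Suc m)) + ln (fact m)"
      by (simp only: fact_Suc) (simp add: ln_mult del: of_nat_Suc)
    show ?case
    proof (cases "m = 0")
      case True then show ?thesis by (simp add: xlnx_def)
    next
      case False
      define x where "x = real m"
      have x: "0 < x" "real (Suc m) = x + 1" using False by (auto simp: x_def)
      have "ln ((x + 1) / x) \<le> (x + 1) / x - 1" using x by (intro ln_le_minus_one) auto
      then have "ln (x + 1) - ln x \<le> 1 / x" using x by (simp add: ln_div field_simps)
      then have up: "x * (ln (x + 1) - ln x) \<le> 1" using x by (simp add: field_simps)
      have "ln (x / (x + 1)) \<le> x / (x + 1) - 1" using x by (intro ln_le_minus_one) auto
      then have "ln x - ln (x + 1) \<le> - (1 / (x + 1))" using x by (simp add: ln_div field_simps)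
      then have "(x + 1) * (1 / (x + 1)) \<le> (x + 1) * (ln (x + 1) - ln x)"
        using x by (intro mult_left_mono) auto
      then have low: "1 \<le> (x + 1) * (ln (x + 1) - ln x)" using x by simp
      have "x * ln x - x \<le> ln (fact m)" "ln (fact m) \<le> x * ln x - x + ln x + 1"
        using Suc.IH False by (auto simp: x_def xlnx_def)
      then show ?thesis
        unfolding fact x(2) xlnx_def using up low by (simp add: algebra_simps)
    qed
  qed simp
  moreover have "ln (real m) \<le> ln (real m + 1)" by (cases "m = 0") auto
  ultimately show "xlnx (real m) - real m \<le> ln (fact m)"
    "ln (fact m) \<le> xlnx (real m) - real m + ln (real m + 1) + 1"
    by (auto simp: xlnx_def)
qed

definition freq :: "nat \<Rightarrow> 'a::finite multiset \<Rightarrow> real^'a" where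
  "freq n M = (\<chi> a. real (count M a) / real n)"

text \<open>All polynomial factors are absorbed, on the logarithmic scale, into multiples of one
  function, so that errors are combined by adding coefficients.\<close>

definition slack :: "real \<Rightarrow> nat \<Rightarrow> real" where
  "slack k n = k * (ln (real n + 1) + 1)"

lemma slack_nonneg: "0 \<le> k \<Longrightarrow> 0 \<le> slack k n"
  by (simp add: slack_def)

lemma slack_mono: "k \<le> l \<Longrightarrow> slack k n \<le> slack l n"
  by (simp add: slack_def mult_right_mono)

lemma slack_over_n: "(\<lambda>n. slack k n / real n) \<longlonglongrightarrow> 0"
  unfolding slack_def by real_asymp

lemma sum_count: "(\<Sum>a\<in>UNIV. count M a) = size (M :: 'a::finite multiset)"
proof -
  have "(\<Sum>a\<in>UNIV. count M a) = (\<Sum>a\<in>set_mset M. count M a)"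
    by (rule sum.mono_neutral_right) (auto simp: not_in_iff)
  then show ?thesis by (simp add: size_multiset_overloaded_eq)
qed

lemma count_le_types: "M \<in> types n \<Longrightarrow> count M a \<le> n" for M :: "'a::finite multiset"
  using member_le_sum [of a UNIV "count M"] sum_count [of M] by (simp add: types_def)

lemma card_types_le: "real (card (types n :: 'a::finite multiset set)) \<le> (real n + 1) ^ CARD('a)"
proof -
  have "card (types n :: 'a multiset set) \<le> card ((UNIV :: 'a set) \<rightarrow>\<^sub>E {..n})"
  proof (rule card_inj_on_le)
    show "inj_on count (types n :: 'a multiset set)" by (auto simp: inj_on_def count_inject)
    show "count ` types n \<subseteq> (UNIV :: 'a set) \<rightarrow>\<^sub>E {..n}"
      using count_le_types by auto
    show "finite ((UNIV :: 'a set) \<rightarrow>\<^sub>E {..n})" by (intro finite_PiE) auto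
  qed
  also have "\<dots> = (n + 1) ^ CARD('a)" by (simp add: card_PiE)
  finally have "real (card (types n :: 'a multiset set)) \<le> real ((n + 1) ^ CARD('a))"
    by (simp only: of_nat_le_iff)
  then show ?thesis by (simp add: add.commute)
qed

lemma ln_card_types_le: "ln (real (card (types n :: 'a::finite multiset set))) \<le> slack (real CARD('a)) n"
proof -
  have "ln (real (card (types n :: 'a multiset set))) \<le> ln ((real n + 1) ^ CARD('a))"
    using card_types_pos [where ?'a = 'a] card_types_le [where ?'a = 'a] by (intro ln_mono) auto
  also have "\<dots> = real CARD('a) * ln (real n + 1)" by (simp add: ln_realpow)
  finally show ?thesis by (simp add: slack_def algebra_simps)
qed

lemma ln_type_card:
  fixes M :: "'a::finite multiset"
  shows "ln (type_card M) = ln (fact (size M)) - (\<Sum>a\<in>UNIV. ln (fact (count M a)))"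
proof -
  have "(\<Prod>a\<in>set_mset M. fact (count M a) :: nat) = (\<Prod>a\<in>UNIV. fact (count M a))"
    by (rule prod.mono_neutral_left) (auto simp: not_in_iff)
  then have "card (permutations_of_multiset M) * (\<Prod>a\<in>UNIV. fact (count M a)) = fact (size M)"
    using card_permutations_of_multiset_aux [of M] by simp
  then have "real (card (permutations_of_multiset M) * (\<Prod>a\<in>UNIV. fact (count M a))) = real (fact (size M))"
    by (simp only:)
  then have "ln (type_card M * (\<Prod>a\<in>UNIV. fact (count M a))) = ln (fact (size M))"
    by (simp add: type_card_def)
  moreover have "ln (type_card M * (\<Prod>a\<in>UNIV. fact (count M a)))
    = ln (type_card M) + (\<Sum>a\<in>UNIV. ln (fact (count M a)))"
    using type_card_pos [of M] by (subst ln_mult) (auto simp: ln_prod prod_pos)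
  ultimately show ?thesis by simp
qed

lemma sum_xlnx_freq:
  fixes M :: "'a::finite multiset"
  assumes "M \<in> types n" "0 < n"
  shows "real n * (\<Sum>a\<in>UNIV. xlnx (freq n M $ a)) = (\<Sum>a\<in>UNIV. xlnx (real (count M a))) - xlnx (real n)"
proof -
  have "real n * xlnx (freq n M $ a) = xlnx (real (count M a)) - real (count M a) * ln (real n)" for a
    using assms(2) by (cases "count M a = 0") (auto simp: freq_def xlnx_def ln_div algebra_simps)
  then have "real n * (\<Sum>a\<in>UNIV. xlnx (freq n M $ a))
    = (\<Sum>a\<in>UNIV. xlnx (real (count M a))) - real (\<Sum>a\<in>UNIV. count M a) * ln (real n)"
    by (simp add: sum_distrib_left sum_subtractf sum_distrib_right)
  then show ?thesis using assms(1) by (simp add: sum_count types_def xlnx_def)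
qed

text \<open>A multinomial coefficient is \<open>exp (n H)\<close> up to a polynomial factor: the
  linear terms of the factorial bounds cancel because the counts sum to \<open>n\<close>, and each
  letter contributes one error \<open>ln (n + 1) + 1\<close>.\<close>

lemma ln_type_card_estimate:
  fixes M :: "'a::finite multiset"
  assumes M: "M \<in> types n" and n: "0 < n"
  shows "\<bar>ln (type_card M) + real n * (\<Sum>a\<in>UNIV. xlnx (freq n M $ a))\<bar> \<le> slack (real CARD('a)) n"
proof -
  have size: "size M = n" using M by (simp add: types_def)
  have sum: "(\<Sum>a\<in>UNIV. real (count M a)) = real n"
    using sum_count [of M] size by (simp flip: of_nat_sum)
  have "(\<Sum>a\<in>UNIV. xlnx (real (count M a)) - real (count M a)) \<le> (\<Sum>a\<in>UNIV. ln (fact (count M a)))"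
    by (intro sum_mono ln_fact_bounds)
  then have low: "(\<Sum>a\<in>UNIV. xlnx (real (count M a))) - real n \<le> (\<Sum>a\<in>UNIV. ln (fact (count M a)))"
    by (simp add: sum_subtractf sum)
  have "(\<Sum>a\<in>UNIV. ln (fact (count M a)))
    \<le> (\<Sum>a\<in>UNIV. xlnx (real (count M a)) - real (count M a) + (ln (real n + 1) + 1))"
  proof (rule sum_mono)
    fix a
    have "ln (real (count M a) + 1) \<le> ln (real n + 1)"
      using count_le_types [OF M, of a] by simp
    then show "ln (fact (count M a)) \<le> xlnx (real (count M a)) - real (count M a) + (ln (real n + 1) + 1)"
      using ln_fact_bounds(2) [of "count M a"] by linarith
  qed
  then have up: "(\<Sum>a\<in>UNIV. ln (fact (count M a)))
      \<le> (\<Sum>a\<in>UNIV. xlnx (real (count M a))) - real n + slack (real CARD('a)) n"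
    by (simp add: sum.distrib sum_subtractf sum slack_def)
  have "1 \<le> real CARD('a)" by (simp add: Suc_le_eq)
  then have "ln (real n + 1) + 1 \<le> slack (real CARD('a)) n"
    using mult_right_mono [of 1 "real CARD('a)" "ln (real n + 1) + 1"] by (simp add: slack_def)
  then show ?thesis
    using low up ln_fact_bounds [of n] unfolding ln_type_card sum_xlnx_freq [OF M n] size by linarith
qed

lemma freq_in_prob_on:
  assumes "M \<in> types n" "0 < n" "set_mset M \<subseteq> A"
  shows "freq n M \<in> prob_on A"
proof -
  have "(\<Sum>a\<in>UNIV. real (count M a)) = real n"
    using sum_count [of M] assms by (simp add: types_def flip: of_nat_sum)
  then have "(\<Sum>a\<in>UNIV. freq n M $ a) = 1"
    using assms(2) by (simp add: freq_def flip: sum_divide_distrib)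
  moreover have "freq n M $ a = 0" if "a \<notin> A" for a
    using that assms(3) by (auto simp: freq_def not_in_iff [symmetric])
  ultimately show ?thesis by (simp add: prob_on_def) (simp add: freq_def)
qed

lemma type_prob_pos:
  assumes "set_mset M \<subseteq> set_pmf P" shows "0 < type_prob P M"
  unfolding type_prob_def
proof (intro mult_pos_pos type_card_pos prod_pos ballI)
  fix a show "0 < pmf P a ^ count M a"
    using assms by (cases "a \<in># M") (auto simp: not_in_iff intro!: zero_less_power pmf_positive)
qed

lemma type_prob_eq_0:
  assumes "\<not> set_mset M \<subseteq> set_pmf P" shows "type_prob P M = 0"
proof -
  obtain a where "a \<in># M" "a \<notin> set_pmf P" using assms by auto
  then have "pmf P a ^ count M a = 0" by (simp add: pmf_eq_0_set_pmf)
  then show ?thesis by (auto simp: type_prob_def intro!: prod_zero)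
qed

lemma ln_type_prob_estimate:
  fixes M :: "'a::finite multiset"
  assumes M: "M \<in> types n" and n: "0 < n" and sub: "set_mset M \<subseteq> set_pmf P"
  shows "\<bar>ln (type_prob P M) + real n * rel_ent P (freq n M)\<bar> \<le> slack (real CARD('a)) n"
proof -
  have pos: "0 < pmf P a ^ count M a" for a
    using sub by (cases "a \<in># M") (auto simp: not_in_iff intro!: zero_less_power pmf_positive)
  have "ln (pmf P a ^ count M a) = real (count M a) * ln (pmf P a)" for a
    using sub by (cases "a \<in># M") (auto simp: not_in_iff intro!: ln_realpow pmf_positive)
  then have "ln (\<Prod>a\<in>UNIV. pmf P a ^ count M a) = (\<Sum>a\<in>UNIV. real (count M a) * ln (pmf P a))"
    using ln_prod [OF finite less_imp_neq [OF pos, symmetric], where I = UNIV] by simp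
  moreover have "ln (type_prob P M) = ln (type_card M) + ln (\<Prod>a\<in>UNIV. pmf P a ^ count M a)"
    unfolding type_prob_def using type_card_pos [of M] pos by (intro ln_mult_pos prod_pos) auto
  moreover have "real n * rel_ent P (freq n M) = real n * (\<Sum>a\<in>UNIV. xlnx (freq n M $ a))
      - (\<Sum>a\<in>UNIV. real (count M a) * ln (pmf P a))"
  proof -
    have "real n * (freq n M $ a * ln (pmf P a)) = real (count M a) * ln (pmf P a)" for a
      using n by (simp add: freq_def)
    then have "real n * (\<Sum>a\<in>UNIV. freq n M $ a * ln (pmf P a)) = (\<Sum>a\<in>UNIV. real (count M a) * ln (pmf P a))"
      unfolding sum_distrib_left by (intro sum.cong refl)
    then show ?thesis
      by (simp add: rel_ent_def sum_subtractf right_diff_distrib)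
  qed
  ultimately show ?thesis using ln_type_card_estimate [OF M n] by simp
qed

lemma count_image_fst:
  fixes M :: "('x::finite \<times> 'y::finite) multiset"
  shows "count (image_mset fst M) x = (\<Sum>y\<in>UNIV. count M (x, y))"
proof (induction M)
  case (add a M)
  have "(\<Sum>y\<in>UNIV. count (add_mset a M) (x, y))
    = (\<Sum>y\<in>UNIV. count M (x, y) + (if fst a = x then if y = snd a then 1 else 0 else 0))"
    by (intro sum.cong) (auto simp: prod_eq_iff)
  also have "\<dots> = (\<Sum>y\<in>UNIV. count M (x, y)) + (if fst a = x then 1 else 0)"
    by (simp add: sum.distrib)
  finally show ?case using add by simp
qed simp

lemma count_image_snd:
  fixes M :: "('x::finite \<times> 'y::finite) multiset"
  shows "count (image_mset snd M) y = (\<Sum>x\<in>UNIV. count M (x, y))"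
proof (induction M)
  case (add a M)
  have "(\<Sum>x\<in>UNIV. count (add_mset a M) (x, y))
    = (\<Sum>x\<in>UNIV. count M (x, y) + (if snd a = y then if x = fst a then 1 else 0 else 0))"
    by (intro sum.cong) (auto simp: prod_eq_iff)
  also have "\<dots> = (\<Sum>x\<in>UNIV. count M (x, y)) + (if snd a = y then 1 else 0)"
    by (simp add: sum.distrib)
  finally show ?case using add by simp
qed simp

lemma freq_image:
  fixes M :: "('x::finite \<times> 'y::finite) multiset"
  shows "freq n (image_mset fst M) $ x = marg1 (freq n M) x"
    "freq n (image_mset snd M) $ y = marg2 (freq n M) y"
  by (simp_all add: freq_def marg1_def marg2_def count_image_fst count_image_snd sum_divide_distrib)

text \<open>The coefficient 3 collects the entropy estimates for the joint type and for its two
  projections, whose alphabets are no larger than the product alphabet.\<close>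

lemma ln_type_weight_estimate:
  fixes M :: "('x::finite \<times> 'y::finite) multiset"
  assumes M: "M \<in> types n" and n: "0 < n"
  shows "\<bar>ln (type_weight M) + real n * mut_inf (freq n M)\<bar> \<le> slack (3 * real CARD('x \<times> 'y)) n"
proof -
  have M1: "image_mset fst M \<in> types n" and M2: "image_mset snd M \<in> types n"
    using M by (auto simp: types_def)
  have "1 \<le> CARD('x)" "1 \<le> CARD('y)" by (auto simp: Suc_le_eq)
  then have "CARD('x) \<le> CARD('x \<times> 'y)" "CARD('y) \<le> CARD('x \<times> 'y)" by auto
  then have "slack (real CARD('x)) n \<le> slack (real CARD('x \<times> 'y)) n"
    "slack (real CARD('y)) n \<le> slack (real CARD('x \<times> 'y)) n"
    by (auto intro!: slack_mono simp del: card_prod)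
  moreover have "ln (type_weight M) = ln (type_card M) - ln (type_card (image_mset fst M)) - ln (type_card (image_mset snd M))"
    unfolding type_weight_def by (simp add: ln_div ln_mult type_card_pos less_imp_neq [OF type_card_pos, symmetric])
  moreover have "slack (3 * real CARD('x \<times> 'y)) n = 3 * slack (real CARD('x \<times> 'y)) n"
    by (simp add: slack_def)
  ultimately show ?thesis
    using ln_type_card_estimate [OF M n] ln_type_card_estimate [OF M1 n] ln_type_card_estimate [OF M2 n]
    unfolding mut_inf_def freq_image right_diff_distrib by linarith
qed

text \<open>Counts are rounded down at every letter except \<open>a0\<close>, which absorbs the
  remainder. The letter \<open>a0\<close> has positive probability, so the remainder does not leave
  \<open>A\<close>.\<close>

lemma types_approximation:
  fixes t :: "real^'a::finite"
  assumes t: "t \<in> prob_on A"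
  obtains M where "\<And>n. M n \<in> types n" "\<And>n. set_mset (M n) \<subseteq> A" "(\<lambda>n. freq n (M n)) \<longlonglongrightarrow> t"
proof -
  obtain a0 where a0: "0 < t $ a0"
    using prob_onD [OF t] by (metis less_eq_real_def sum.neutral zero_neq_one)
  define c where "c = (\<lambda>n a. nat \<lfloor>real n * t $ a\<rfloor>)"
  have c: "real (c n a) \<le> real n * t $ a" "real n * t $ a \<le> real (c n a) + 1" for n a
    using prob_onD(1) [OF t, of a] unfolding c_def by (auto simp: of_nat_nat intro: less_imp_le)
  define r where "r = (\<lambda>n. n - (\<Sum>a\<in>UNIV - {a0}. c n a))"
  define d where "d = (\<lambda>n a. if a = a0 then r n else c n a)"
  define M where "M = (\<lambda>n. \<Sum>a\<in>UNIV. replicate_mset (d n a) a)"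
  have count: "count (M n) a = d n a" for n a
    by (simp add: M_def count_sum if_distrib cong: if_cong)
  have t_a0: "t $ a0 = 1 - (\<Sum>a\<in>UNIV - {a0}. t $ a)"
    using prob_onD(3) [OF t] by (simp add: sum.remove [of UNIV a0])
  have c_sum: "real (\<Sum>a\<in>UNIV - {a0}. c n a) \<le> real n * (\<Sum>a\<in>UNIV - {a0}. t $ a)"
    "real n * (\<Sum>a\<in>UNIV - {a0}. t $ a) \<le> real (\<Sum>a\<in>UNIV - {a0}. c n a) + real CARD('a)" for n
  proof -
    show "real (\<Sum>a\<in>UNIV - {a0}. c n a) \<le> real n * (\<Sum>a\<in>UNIV - {a0}. t $ a)"
      unfolding of_nat_sum sum_distrib_left by (intro sum_mono c)
    have "real n * (\<Sum>a\<in>UNIV - {a0}. t $ a) \<le> (\<Sum>a\<in>UNIV - {a0}. real (c n a) + 1)"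
      unfolding sum_distrib_left by (intro sum_mono c)
    also have "\<dots> \<le> real (\<Sum>a\<in>UNIV - {a0}. c n a) + real CARD('a)"
      by (simp add: sum.distrib card_mono)
    finally show "real n * (\<Sum>a\<in>UNIV - {a0}. t $ a) \<le> real (\<Sum>a\<in>UNIV - {a0}. c n a) + real CARD('a)" .
  qed
  have le_n: "(\<Sum>a\<in>UNIV - {a0}. c n a) \<le> n" for n
  proof -
    have "real (\<Sum>a\<in>UNIV - {a0}. c n a) \<le> real n * 1"
      using c_sum(1) [of n] a0 t_a0
      by (elim order_trans) (intro mult_left_mono, auto)
    then show ?thesis by (simp only: mult_1_right of_nat_le_iff)
  qed
  have r: "real (r n) = real n - real (\<Sum>a\<in>UNIV - {a0}. c n a)" for n
    using le_n [of n] by (simp add: r_def of_nat_diff)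
  have close: "\<bar>real (d n a) - real n * t $ a\<bar> \<le> real CARD('a)" for n a
  proof (cases "a = a0")
    case True
    have "real n * t $ a0 = real n - real n * (\<Sum>a\<in>UNIV - {a0}. t $ a)"
      by (simp add: t_a0 algebra_simps)
    then show ?thesis using c_sum [of n] True by (simp add: d_def r)
  next
    case False
    have "1 \<le> real CARD('a)" by (simp add: Suc_le_eq)
    moreover have "d n a = c n a" using False by (simp add: d_def)
    ultimately show ?thesis using c [of n a] by linarith
  qed
  show ?thesis
  proof (rule that)
    show "M n \<in> types n" for n
    proof -
      have "size (M n) = (\<Sum>a\<in>UNIV. d n a)" by (simp add: count flip: sum_count)
      also have "\<dots> = d n a0 + (\<Sum>a\<in>UNIV - {a0}. d n a)" by (simp add: sum.remove)
      also have "\<dots> = r n + (\<Sum>a\<in>UNIV - {a0}. c n a)" by (simp add: d_def)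
      also have "\<dots> = n" using le_n [of n] by (simp add: r_def)
      finally show ?thesis by (simp add: types_def)
    qed
    show "set_mset (M n) \<subseteq> A" for n
    proof
      fix a assume "a \<in># M n"
      then have "0 < d n a" by (simp add: count flip: count_greater_zero_iff)
      then have "a = a0 \<or> 0 < real (c n a)" by (auto simp: d_def split: if_splits)
      then have "0 < t $ a"
      proof
        assume "0 < real (c n a)"
        then have "0 < real n * t $ a" using c(1) [of n a] by linarith
        then show ?thesis by (simp add: zero_less_mult_iff)
      qed (simp add: a0)
      then show "a \<in> A" by (rule prob_on_support [OF t])
    qed
    show "(\<lambda>n. freq n (M n)) \<longlonglongrightarrow> t"
    proof (rule vec_tendstoI)
      fix a
      have "(\<lambda>n. freq n (M n) $ a - t $ a) \<longlonglongrightarrow> 0"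
      proof (rule tendsto_rabs_zero_cancel, rule tendsto_sandwich)
        show "\<forall>\<^sub>F n in sequentially. 0 \<le> \<bar>freq n (M n) $ a - t $ a\<bar>" by simp
        show "\<forall>\<^sub>F n in sequentially. \<bar>freq n (M n) $ a - t $ a\<bar> \<le> real CARD('a) / real n"
          using eventually_gt_at_top [of 0]
        proof eventually_elim
          case (elim n)
          then have "freq n (M n) $ a - t $ a = (real (d n a) - real n * t $ a) / real n"
            by (simp add: freq_def count field_simps)
          then show ?case using close [of n a] elim by (simp add: divide_right_mono)
        qed
        show "(\<lambda>n. real CARD('a) / real n) \<longlonglongrightarrow> 0" by real_asymp
      qed simp
      then show "(\<lambda>n. freq n (M n) $ a) \<longlonglongrightarrow> t $ a" by (simp add: LIM_zero_iff)
    qed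
  qed
qed

lemma freq_functionals_tendsto:
  fixes P :: "('x::finite \<times> 'y::finite) pmf"
  assumes M: "\<And>n. M n \<in> types n" "\<And>n. set_mset (M n) \<subseteq> set_pmf P" and lim: "(\<lambda>n. freq n (M n)) \<longlonglongrightarrow> t"
    and t: "t \<in> prob_on (set_pmf P)"
  shows "(\<lambda>n. rel_ent P (freq n (M n))) \<longlonglongrightarrow> rel_ent P t" "(\<lambda>n. mut_inf (freq n (M n))) \<longlonglongrightarrow> mut_inf t"
proof -
  have ev: "\<forall>\<^sub>F n in sequentially. freq n (M n) \<in> prob_on (set_pmf P)"
    using eventually_gt_at_top [of 0] by eventually_elim (rule freq_in_prob_on [OF M(1) _ M(2)])
  show "(\<lambda>n. rel_ent P (freq n (M n))) \<longlonglongrightarrow> rel_ent P t"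
    by (rule continuous_on_tendsto_compose [OF continuous_on_rel_ent lim t ev])
  show "(\<lambda>n. mut_inf (freq n (M n))) \<longlonglongrightarrow> mut_inf t"
    by (rule continuous_on_tendsto_compose [OF continuous_on_mut_inf lim t ev])
qed

section \<open>Exponents of the optimal error\<close>

lemma liminf_exponent_ge:
  fixes x :: "nat \<Rightarrow> real"
  assumes b: "1 < b" and nonneg: "\<And>n. 0 \<le> x n"
    and bound: "\<And>n. 0 < n \<Longrightarrow> x n \<le> exp (- (real n * v) + slack k n)"
  shows "ereal (v / ln b) \<le> liminf (\<lambda>n. ereal (1 / real n) * neg_log b (x n))"
proof -
  have lnb: "0 < ln b" using b by simp
  have "(\<lambda>n. (v - slack k n / real n) / ln b) \<longlonglongrightarrow> (v - 0) / ln b"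
    using lnb by (intro tendsto_intros slack_over_n) simp
  then have "liminf (\<lambda>n. ereal ((v - slack k n / real n) / ln b)) = ereal (v / ln b)"
    by (intro lim_imp_Liminf) (simp_all add: tendsto_ereal)
  moreover have "liminf (\<lambda>n. ereal ((v - slack k n / real n) / ln b))
    \<le> liminf (\<lambda>n. ereal (1 / real n) * neg_log b (x n))"
  proof (rule Liminf_mono, use eventually_gt_at_top [of 0] in eventually_elim)
    fix n :: nat assume n: "0 < n"
    show "ereal ((v - slack k n / real n) / ln b) \<le> ereal (1 / real n) * neg_log b (x n)"
    proof (cases "x n = 0")
      case True
      then show ?thesis using n by (simp add: neg_log_def)
    next
      case False
      then have "0 < x n" using nonneg [of n] by (simp add: less_le)
      then have "ln (x n) \<le> - (real n * v) + slack k n"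
        using bound [OF n] by (metis exp_gt_zero ln_exp ln_le_cancel_iff)
      then have "(real n * v - slack k n) / real n \<le> - ln (x n) / real n"
        by (intro divide_right_mono) auto
      then have "v - slack k n / real n \<le> - ln (x n) / real n"
        using n by (simp add: diff_divide_distrib)
      then have "(v - slack k n / real n) / ln b \<le> - ln (x n) / real n / ln b"
        using lnb by (intro divide_right_mono) auto
      then show ?thesis using False by (simp add: neg_log_def log_def mult.commute)
    qed
  qed
  ultimately show ?thesis by simp
qed

lemma limsup_exponent_le:
  fixes x w :: "nat \<Rightarrow> real"
  assumes b: "1 < b" and bound: "\<forall>\<^sub>F n in sequentially. exp (- (real n * w n)) \<le> x n"
    and lim: "w \<longlonglongrightarrow> v"
  shows "limsup (\<lambda>n. ereal (1 / real n) * neg_log b (x n)) \<le> ereal (v / ln b)"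
proof -
  have lnb: "0 < ln b" using b by simp
  have "(\<lambda>n. w n / ln b) \<longlonglongrightarrow> v / ln b"
    using lnb lim by (intro tendsto_intros) auto
  then have "limsup (\<lambda>n. ereal (w n / ln b)) = ereal (v / ln b)"
    by (intro lim_imp_Limsup) (simp_all add: tendsto_ereal)
  moreover have "limsup (\<lambda>n. ereal (1 / real n) * neg_log b (x n)) \<le> limsup (\<lambda>n. ereal (w n / ln b))"
  proof (rule Limsup_mono, use eventually_gt_at_top [of 0] bound in eventually_elim)
    fix n :: nat assume n: "0 < n" and le: "exp (- (real n * w n)) \<le> x n"
    have pos: "0 < x n" using le exp_gt_zero [of "- (real n * w n)"] by linarith
    then have "- (real n * w n) \<le> ln (x n)" using le by (simp add: ln_ge_iff)
    then have "- ln (x n) / real n \<le> w n" using n by (simp add: field_simps)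
    then have "- ln (x n) / real n / ln b \<le> w n / ln b"
      using lnb by (intro divide_right_mono) auto
    then show "ereal (1 / real n) * neg_log b (x n) \<le> ereal (w n / ln b)"
      using pos by (simp add: neg_log_def log_def mult.commute)
  qed
  ultimately show ?thesis by simp
qed

section \<open>Nonasymptotic exponential bounds\<close>

lemma type_prob_le_exp:
  fixes P :: "('x::finite \<times> 'y::finite) pmf"
  assumes "M \<in> types n" "0 < n" "set_mset M \<subseteq> set_pmf P"
  shows "type_prob P M \<le> exp (- (real n * rel_ent P (freq n M)) + slack (real CARD('x \<times> 'y)) n)"
    and "exp (- (real n * rel_ent P (freq n M)) - slack (real CARD('x \<times> 'y)) n) \<le> type_prob P M"
proof -
  have "type_prob P M = exp (ln (type_prob P M))" using type_prob_pos [OF assms(3)] by simp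
  moreover have "exp (ln (type_prob P M)) \<le> exp (- (real n * rel_ent P (freq n M)) + slack (real CARD('x \<times> 'y)) n)"
    "exp (- (real n * rel_ent P (freq n M)) - slack (real CARD('x \<times> 'y)) n) \<le> exp (ln (type_prob P M))"
    using ln_type_prob_estimate [OF assms] unfolding exp_le_cancel_iff by linarith+
  ultimately show "type_prob P M \<le> exp (- (real n * rel_ent P (freq n M)) + slack (real CARD('x \<times> 'y)) n)"
    and "exp (- (real n * rel_ent P (freq n M)) - slack (real CARD('x \<times> 'y)) n) \<le> type_prob P M" by simp_all
qed

lemma slack_add: "slack k n + slack l n = slack (k + l) n"
  by (simp add: slack_def algebra_simps)

lemma sum_types_le_exp:
  fixes F :: "('a::finite) multiset \<Rightarrow> real"
  assumes "\<And>M. M \<in> types n \<Longrightarrow> F M \<le> exp (u + slack k n)"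
  shows "(\<Sum>M\<in>types n. F M) \<le> exp (u + slack (k + real CARD('a)) n)"
proof -
  let ?N = "real (card (types n :: 'a multiset set))"
  have "(\<Sum>M\<in>types n. F M) \<le> ?N * exp (u + slack k n)"
    using sum_bounded_above [of "types n" F] assms by simp
  also have "\<dots> = exp (ln ?N) * exp (u + slack k n)"
    using card_types_pos [where ?'a = 'a] by simp
  also have "\<dots> = exp (ln ?N + (u + slack k n))" by (simp only: exp_add)
  also have "\<dots> \<le> exp (u + slack (k + real CARD('a)) n)"
    unfolding exp_le_cancel_iff using ln_card_types_le [where ?'a = 'a, of n] slack_add [of k n "real CARD('a)"] by linarith
  finally show ?thesis .
qed

text \<open>A type contributes only if its mutual information is at most \<open>r\<close> up to
  slack. For such a type the penalty is itself within the slack, so the penalized objective, unlike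
  the hard constraint, tolerates the approximation. The coefficient 6 is 1 for the type probability,
  4 for the bound on the penalty and 1 for the number of types.\<close>

lemma opt_err_le_exp:
  fixes P :: "('x::finite \<times> 'y::finite) pmf"
  assumes tb: "type_bounded n (\<Q> n)" and n: "0 < n"
    and v: "\<And>t. t \<in> prob_on (set_pmf P) \<Longrightarrow> v \<le> rel_ent P t + max 0 (mut_inf t - r)"
  shows "opt_err P \<Q> n (exp (- (real n * r))) \<le> exp (- (real n * v) + slack (6 * real CARD('x \<times> 'y)) n)"
proof -
  define K where "K = real CARD('x \<times> 'y)"
  let ?N = "real (card (types n :: ('x \<times> 'y) multiset set))"
  let ?\<mu> = "exp (- (real n * r))"
  have N: "0 < ?N" using card_types_pos [where ?'a = "'x \<times> 'y"] by simp
  have K: "0 \<le> K" by (simp add: K_def)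
  have "opt_err P \<Q> n ?\<mu> \<le> (\<Sum>M\<in>types n. type_prob P M * (1 - min 1 (?\<mu> / (?N * type_weight M))))"
    by (rule opt_err_upper_bound [where n = n and \<Q> = \<Q>, OF tb]) simp
  also have "\<dots> \<le> exp (- (real n * v) + slack (5 * K + K) n)"
    unfolding K_def
  proof (rule sum_types_le_exp, fold K_def)
    fix M :: "('x \<times> 'y) multiset" assume M: "M \<in> types n"
    let ?m = "min 1 (?\<mu> / (?N * type_weight M))"
    have m: "0 \<le> ?m" using N type_weight_pos [of M] by simp
    show "type_prob P M * (1 - ?m) \<le> exp (- (real n * v) + slack (5 * K) n)"
    proof (cases "set_mset M \<subseteq> set_pmf P \<and> ?\<mu> < ?N * type_weight M")
      case True
      define t where "t = freq n M"
      have t: "t \<in> prob_on (set_pmf P)" using freq_in_prob_on [OF M n] True by (simp add: t_def)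
      have "- (real n * r) = ln ?\<mu>" by simp
      also have "\<dots> < ln (?N * type_weight M)"
        using True N type_weight_pos [of M] by (subst ln_less_cancel_iff) auto
      also have "\<dots> = ln ?N + ln (type_weight M)"
        using type_weight_pos [of M] by (intro ln_mult_pos N)
      finally have "real n * mut_inf t - real n * r \<le> slack K n + slack (3 * K) n"
        using ln_card_types_le [where ?'a = "'x \<times> 'y", of n] ln_type_weight_estimate [OF M n]
        unfolding t_def K_def by linarith
      then have "real n * (mut_inf t - r) \<le> slack (4 * K) n"
        by (simp add: slack_add right_diff_distrib)
      then have "real n * max 0 (mut_inf t - r) \<le> slack (4 * K) n"
        using K slack_nonneg [of "4 * K" n] by (simp add: max_def)
      moreover have "real n * v \<le> real n * (rel_ent P t + max 0 (mut_inf t - r))"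
        using v [OF t] by (intro mult_left_mono) auto
      ultimately have "- (real n * rel_ent P t) + slack K n \<le> - (real n * v) + slack (5 * K) n"
        using slack_add [of K n "4 * K"] by (simp add: distrib_left)
      moreover have "type_prob P M \<le> exp (- (real n * rel_ent P t) + slack K n)"
        using type_prob_le_exp(1) [OF M n] True by (simp add: t_def K_def)
      moreover have "type_prob P M * (1 - ?m) \<le> type_prob P M"
        using m by (intro mult_left_le type_prob_nonneg) auto
      ultimately show ?thesis by (meson exp_le_cancel_iff order_trans)
    next
      case False
      then have "type_prob P M * (1 - ?m) = 0"
      proof (cases "set_mset M \<subseteq> set_pmf P")
        case True
        then have "1 \<le> ?\<mu> / (?N * type_weight M)"
          using False N type_weight_pos [of M] by simp
        then show ?thesis by simp
      qed (simp add: type_prob_eq_0)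
      then show ?thesis by (simp only: exp_ge_zero)
    qed
  qed
  finally show ?thesis by (simp add: K_def)
qed

text \<open>Here the penalty is exact: a type is accepted with probability about the minimum of 1
  and \<open>exp (- n (r - I(t)))\<close>, which is
  \<open>exp (- n max 0 (r - I(t)))\<close>.\<close>

lemma one_minus_opt_err_le_exp:
  fixes P :: "('x::finite \<times> 'y::finite) pmf"
  assumes tb: "type_bounded n (\<Q> n)" and n: "0 < n"
    and v: "\<And>t. t \<in> prob_on (set_pmf P) \<Longrightarrow> v \<le> rel_ent P t + max 0 (r - mut_inf t)"
  shows "1 - opt_err P \<Q> n (exp (- (real n * r))) \<le> exp (- (real n * v) + slack (5 * real CARD('x \<times> 'y)) n)"
proof -
  define K where "K = real CARD('x \<times> 'y)"
  let ?\<mu> = "exp (- (real n * r))"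
  have K: "0 \<le> K" by (simp add: K_def)
  have "1 - opt_err P \<Q> n ?\<mu> \<le> (\<Sum>M\<in>types n. type_prob P M * min 1 (?\<mu> / type_weight M))"
    by (rule one_minus_opt_err_bounds [where n = n and \<Q> = \<Q>, OF tb]) simp
  also have "\<dots> \<le> exp (- (real n * v) + slack (4 * K + K) n)"
    unfolding K_def
  proof (rule sum_types_le_exp, fold K_def)
    fix M :: "('x \<times> 'y) multiset" assume M: "M \<in> types n"
    show "type_prob P M * min 1 (?\<mu> / type_weight M) \<le> exp (- (real n * v) + slack (4 * K) n)"
    proof (cases "set_mset M \<subseteq> set_pmf P")
      case True
      define t where "t = freq n M"
      have t: "t \<in> prob_on (set_pmf P)" using freq_in_prob_on [OF M n] True by (simp add: t_def)
      have "?\<mu> / type_weight M = exp (- (real n * r) - ln (type_weight M))"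
        using type_weight_pos [of M] by (simp add: exp_diff)
      also have "\<dots> \<le> exp (- (real n * (r - mut_inf t)) + slack (3 * K) n)"
        unfolding exp_le_cancel_iff right_diff_distrib
        using ln_type_weight_estimate [OF M n] unfolding t_def K_def by linarith
      finally have w: "?\<mu> / type_weight M \<le> exp (- (real n * (r - mut_inf t)) + slack (3 * K) n)" .
      have "min 1 (?\<mu> / type_weight M) \<le> exp (- (real n * max 0 (r - mut_inf t)) + slack (3 * K) n)"
      proof (cases "0 \<le> r - mut_inf t")
        case True
        then show ?thesis using w by (simp add: min_le_iff_disj)
      next
        case False
        have "1 \<le> exp (slack (3 * K) n)" using slack_nonneg [of "3 * K" n] K by simp
        then show ?thesis using False by (simp add: min_le_iff_disj max_def)
      qed
      then have "type_prob P M * min 1 (?\<mu> / type_weight M)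
        \<le> exp (- (real n * rel_ent P t) + slack K n) * exp (- (real n * max 0 (r - mut_inf t)) + slack (3 * K) n)"
        using type_prob_le_exp(1) [OF M n True] type_weight_pos [of M]
        unfolding t_def K_def by (intro mult_mono) auto
      also have "\<dots> = exp (- (real n * (rel_ent P t + max 0 (r - mut_inf t))) + slack (4 * K) n)"
        using slack_add [of K n "3 * K"] by (simp add: distrib_left flip: exp_add)
      also have "\<dots> \<le> exp (- (real n * v) + slack (4 * K) n)"
        using v [OF t] by (simp add: mult_left_mono)
      finally show ?thesis .
    qed (simp add: type_prob_eq_0)
  qed
  finally show ?thesis by (simp add: K_def)
qed

text \<open>Along types converging to \<open>t\<close>, the strict inequality leaves a margin that
  outgrows the slack. The accepted fraction of the type class then tends to 0, and the class
  contributes almost its full probability.\<close>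

lemma opt_err_ge_exp:
  fixes P :: "('x::finite \<times> 'y::finite) pmf"
  assumes tb: "\<And>n. type_bounded n (\<Q> n)"
    and t: "t \<in> prob_on (set_pmf P)" "mut_inf t < r"
  obtains w where "\<forall>\<^sub>F n in sequentially. exp (- (real n * w n)) \<le> opt_err P \<Q> n (exp (- (real n * r)))"
    "w \<longlonglongrightarrow> rel_ent P t"
proof -
  define K where "K = real CARD('x \<times> 'y)"
  obtain M where M: "\<And>n. M n \<in> types n" "\<And>n. set_mset (M n) \<subseteq> set_pmf P" "(\<lambda>n. freq n (M n)) \<longlonglongrightarrow> t"
    using types_approximation [OF t(1)] by blast
  define f where "f = (\<lambda>n. rel_ent P (freq n (M n)))"
  define g where "g = (\<lambda>n. mut_inf (freq n (M n)))"
  have f: "f \<longlonglongrightarrow> rel_ent P t" and g: "g \<longlonglongrightarrow> mut_inf t"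
    using freq_functionals_tendsto [OF M t(1)] by (auto simp: f_def g_def)
  have "(\<lambda>n. g n - r + slack (3 * K) n / real n) \<longlonglongrightarrow> mut_inf t - r + 0"
    by (intro tendsto_intros g slack_over_n)
  then have "LIM n sequentially. (g n - r + slack (3 * K) n / real n) * real n :> at_bot"
    using t(2) by (intro filterlim_tendsto_neg_mult_at_bot [of _ "mut_inf t - r + 0"] filterlim_real_sequentially) auto
  \<comment> \<open>The bound \<open>- ln 2\<close> means that at least half of the type class is
    rejected; the factor \<open>1/2\<close> costs \<open>ln 2 / n\<close> in the exponent.\<close>
  then have ev: "\<forall>\<^sub>F n in sequentially. (g n - r + slack (3 * K) n / real n) * real n \<le> - ln 2"
    by (simp add: filterlim_at_bot)
  show ?thesis
  proof (rule that)
    show "(\<lambda>n. f n + slack K n / real n + ln 2 / real n) \<longlonglongrightarrow> rel_ent P t"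
    proof -
      have "(\<lambda>n. ln 2 / real n) \<longlonglongrightarrow> 0" by real_asymp
      then have "(\<lambda>n. f n + slack K n / real n + ln 2 / real n) \<longlonglongrightarrow> rel_ent P t + 0 + 0"
        by (intro tendsto_add f slack_over_n)
      then show ?thesis by simp
    qed
    show "\<forall>\<^sub>F n in sequentially. exp (- (real n * (f n + slack K n / real n + ln 2 / real n)))
      \<le> opt_err P \<Q> n (exp (- (real n * r)))"
      using ev eventually_gt_at_top [of 0]
    proof eventually_elim
      fix n :: nat
      assume small: "(g n - r + slack (3 * K) n / real n) * real n \<le> - ln 2" and n: "0 < n"
      let ?\<mu> = "exp (- (real n * r))"
      have "?\<mu> / type_weight (M n) = exp (- (real n * r) - ln (type_weight (M n)))"
        using type_weight_pos [of "M n"] by (simp add: exp_diff)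
      also have "\<dots> \<le> exp (- ln 2)"
        unfolding exp_le_cancel_iff using small n ln_type_weight_estimate [OF M(1) n]
        by (simp add: g_def K_def algebra_simps)
      also have "\<dots> = 1 / 2" by (simp add: exp_minus)
      finally have half: "1 / 2 \<le> 1 - min 1 (?\<mu> / type_weight (M n))"
        using min.cobounded2 [of 1 "?\<mu> / type_weight (M n)"] by linarith
      have "exp (- (real n * (f n + slack K n / real n + ln 2 / real n)))
        = exp (- (real n * f n) - slack K n + - ln 2)"
        using n by (simp add: algebra_simps)
      also have "\<dots> = exp (- (real n * f n) - slack K n) * (1 / 2)"
        by (simp only: exp_add) (simp add: exp_minus)
      also have "\<dots> \<le> type_prob P (M n) * (1 - min 1 (?\<mu> / type_weight (M n)))"
        using type_prob_le_exp(2) [OF M(1) n M(2)] half type_prob_nonneg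
        unfolding f_def K_def by (intro mult_mono) auto
      also have "\<dots> \<le> (\<Sum>M\<in>types n. type_prob P M * (1 - min 1 (?\<mu> / type_weight M)))"
        using M(1) by (intro member_le_sum [of "M n" "types n"] mult_nonneg_nonneg type_prob_nonneg) auto
      also have "\<dots> \<le> opt_err P \<Q> n ?\<mu>"
        by (rule opt_err_lower_bound [where n = n and \<Q> = \<Q>, OF tb]) simp
      finally show "exp (- (real n * (f n + slack K n / real n + ln 2 / real n))) \<le> opt_err P \<Q> n ?\<mu>" .
    qed
  qed
qed

lemma one_minus_opt_err_ge_exp:
  fixes P :: "('x::finite \<times> 'y::finite) pmf"
  assumes tb: "\<And>n. type_bounded n (\<Q> n)"
    and t: "t \<in> prob_on (set_pmf P)"
  obtains w where "\<forall>\<^sub>F n in sequentially. exp (- (real n * w n)) \<le> 1 - opt_err P \<Q> n (exp (- (real n * r)))"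
    "w \<longlonglongrightarrow> rel_ent P t + max 0 (r - mut_inf t)"
proof -
  define K where "K = real CARD('x \<times> 'y)"
  have K: "0 \<le> K" by (simp add: K_def)
  obtain M where M: "\<And>n. M n \<in> types n" "\<And>n. set_mset (M n) \<subseteq> set_pmf P" "(\<lambda>n. freq n (M n)) \<longlonglongrightarrow> t"
    using types_approximation [OF t(1)] by blast
  define f where "f = (\<lambda>n. rel_ent P (freq n (M n)))"
  define g where "g = (\<lambda>n. mut_inf (freq n (M n)))"
  have f: "f \<longlonglongrightarrow> rel_ent P t" and g: "g \<longlonglongrightarrow> mut_inf t"
    using freq_functionals_tendsto [OF M t(1)] by (auto simp: f_def g_def)
  show ?thesis
  proof (rule that)
    have "(\<lambda>n. f n + max 0 (r - g n) + slack (5 * K) n / real n) \<longlonglongrightarrow> rel_ent P t + max 0 (r - mut_inf t) + 0"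
      by (intro tendsto_intros f g slack_over_n)
    then show "(\<lambda>n. f n + max 0 (r - g n) + slack (5 * K) n / real n) \<longlonglongrightarrow> rel_ent P t + max 0 (r - mut_inf t)"
      by simp
    show "\<forall>\<^sub>F n in sequentially. exp (- (real n * (f n + max 0 (r - g n) + slack (5 * K) n / real n)))
      \<le> 1 - opt_err P \<Q> n (exp (- (real n * r)))"
      using eventually_gt_at_top [of 0]
    proof eventually_elim
      fix n :: nat assume n: "0 < n"
      let ?\<mu> = "exp (- (real n * r))"
      let ?N = "real (card (types n :: ('x \<times> 'y) multiset set))"
      have N: "0 < ?N" using card_types_pos [where ?'a = "'x \<times> 'y"] by simp
      have "?\<mu> / (?N * type_weight (M n)) = exp (- (real n * r) - (ln ?N + ln (type_weight (M n))))"
        using type_weight_pos [of "M n"] N by (simp add: exp_diff exp_add)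
      moreover have "exp (- (real n * (r - g n)) - slack (4 * K) n) \<le> exp (- (real n * r) - (ln ?N + ln (type_weight (M n))))"
        unfolding exp_le_cancel_iff using ln_type_weight_estimate [OF M(1) n] slack_add [of K n "3 * K"]
          ln_card_types_le [where ?'a = "'x \<times> 'y", of n]
        by (simp add: g_def K_def algebra_simps)
      ultimately have w: "exp (- (real n * (r - g n)) - slack (4 * K) n) \<le> ?\<mu> / (?N * type_weight (M n))"
        by simp
      have min: "exp (- (real n * max 0 (r - g n)) - slack (4 * K) n) \<le> min 1 (?\<mu> / (?N * type_weight (M n)))"
      proof (rule min.boundedI)
        show "exp (- (real n * max 0 (r - g n)) - slack (4 * K) n) \<le> 1"
        proof -
          have "0 \<le> real n * max 0 (r - g n)" "0 \<le> slack (4 * K) n"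
            using slack_nonneg [of "4 * K" n] K by simp_all
          then show ?thesis unfolding exp_le_one_iff by linarith
        qed
        have "exp (- (real n * max 0 (r - g n)) - slack (4 * K) n) \<le> exp (- (real n * (r - g n)) - slack (4 * K) n)"
          using n by (simp add: mult_left_mono)
        with w show "exp (- (real n * max 0 (r - g n)) - slack (4 * K) n) \<le> ?\<mu> / (?N * type_weight (M n))"
          by linarith
      qed
      have "real n * (f n + max 0 (r - g n) + slack (5 * K) n / real n)
        = real n * f n + real n * max 0 (r - g n) + slack (5 * K) n"
        using n by (simp add: distrib_left)
      then have "exp (- (real n * (f n + max 0 (r - g n) + slack (5 * K) n / real n)))
        = exp (- (real n * f n) - slack K n) * exp (- (real n * max 0 (r - g n)) - slack (4 * K) n)"
        using slack_add [of K n "4 * K"] by (simp flip: exp_add)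
      also have "\<dots> \<le> type_prob P (M n) * min 1 (?\<mu> / (?N * type_weight (M n)))"
        using type_prob_le_exp(2) [OF M(1) n M(2)] min type_prob_nonneg
        unfolding f_def K_def by (intro mult_mono) auto
      also have "\<dots> \<le> (\<Sum>M\<in>types n. type_prob P M * min 1 (?\<mu> / (?N * type_weight M)))"
        using M(1)
        by (intro member_le_sum [of "M n" "types n"] mult_nonneg_nonneg type_prob_nonneg) auto
      also have "\<dots> \<le> 1 - opt_err P \<Q> n ?\<mu>"
        by (rule one_minus_opt_err_bounds [where n = n and \<Q> = \<Q>, OF tb]) simp
      finally show "exp (- (real n * (f n + max 0 (r - g n) + slack (5 * K) n / real n))) \<le> 1 - opt_err P \<Q> n ?\<mu>" .
    qed
  qed
qed

lemma opt_err_le_1: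
  fixes P :: "('x::finite \<times> 'y::finite) pmf"
  assumes "type_bounded n (\<Q> n)" "0 \<le> \<mu>"
  shows "opt_err P \<Q> n \<mu> \<le> 1"
proof -
  have "0 \<le> (\<Sum>M\<in>types n. type_prob P M *
      min 1 (\<mu> / (real (card (types n :: ('x \<times> 'y) multiset set)) * type_weight M)))"
    using assms(2) by (intro sum_nonneg mult_nonneg_nonneg type_prob_nonneg) auto
  then show ?thesis using one_minus_opt_err_bounds(2) [where n = n and \<Q> = \<Q>, OF assms, of P] by simp
qed

lemma powr_rate: "1 < b \<Longrightarrow> b powr (- (real n * R)) = exp (- (real n * (R * ln b)))"
  by (simp add: powr_def mult_ac)

lemma error_exponent_ge:
  fixes P :: "('x::finite \<times> 'y::finite) pmf"
  assumes b: "1 < b" and tb: "\<And>n. type_bounded n (\<Q> n)"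
    and v: "\<And>t. t \<in> prob_on (set_pmf P) \<Longrightarrow> v \<le> rel_ent P t + max 0 (mut_inf t - R * ln b)"
  shows "ereal (v / ln b) \<le> error_exponent b P \<Q> R"
  unfolding error_exponent_def powr_rate [OF b]
  by (rule liminf_exponent_ge [OF b, where k = "6 * real CARD('x \<times> 'y)"])
    (rule opt_err_nonneg [where \<Q> = \<Q>, OF tb], simp, rule opt_err_le_exp [where \<Q> = \<Q>, OF tb _ v])

lemma error_exponent_le:
  fixes P :: "('x::finite \<times> 'y::finite) pmf"
  assumes b: "1 < b" and tb: "\<And>n. type_bounded n (\<Q> n)"
    and t: "t \<in> prob_on (set_pmf P)" "mut_inf t < R * ln b"
  shows "error_exponent b P \<Q> R \<le> ereal (rel_ent P t / ln b)"
proof -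
  obtain w where "\<forall>\<^sub>F n in sequentially. exp (- (real n * w n)) \<le> opt_err P \<Q> n (exp (- (real n * (R * ln b))))"
    "w \<longlonglongrightarrow> rel_ent P t"
    using opt_err_ge_exp [where \<Q> = \<Q>, OF tb t] by blast
  from limsup_exponent_le [OF b this] show ?thesis
    unfolding error_exponent_def powr_rate [OF b] by (meson Liminf_le_Limsup order_trans sequentially_bot)
qed

lemma strong_converse_exponent_eq:
  fixes P :: "('x::finite \<times> 'y::finite) pmf"
  assumes b: "1 < b" and tb: "\<And>n. type_bounded n (\<Q> n)"
    and t: "t \<in> prob_on (set_pmf P)"
    and min: "\<And>s. s \<in> prob_on (set_pmf P) \<Longrightarrow>
      rel_ent P t + max 0 (R * ln b - mut_inf t) \<le> rel_ent P s + max 0 (R * ln b - mut_inf s)"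
  shows "strong_converse_exponent b P \<Q> R = ereal ((rel_ent P t + max 0 (R * ln b - mut_inf t)) / ln b)"
  unfolding strong_converse_exponent_def powr_rate [OF b]
proof (rule antisym)
  obtain w where "\<forall>\<^sub>F n in sequentially. exp (- (real n * w n)) \<le> 1 - opt_err P \<Q> n (exp (- (real n * (R * ln b))))"
    "w \<longlonglongrightarrow> rel_ent P t + max 0 (R * ln b - mut_inf t)"
    using one_minus_opt_err_ge_exp [where \<Q> = \<Q>, OF tb t] by blast
  then show "limsup (\<lambda>n. ereal (1 / real n) * neg_log b (1 - opt_err P \<Q> n (exp (- (real n * (R * ln b))))))
    \<le> ereal ((rel_ent P t + max 0 (R * ln b - mut_inf t)) / ln b)"
    by (rule limsup_exponent_le [OF b])
  have "ereal ((rel_ent P t + max 0 (R * ln b - mut_inf t)) / ln b)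
    \<le> liminf (\<lambda>n. ereal (1 / real n) * neg_log b (1 - opt_err P \<Q> n (exp (- (real n * (R * ln b))))))"
    using opt_err_le_1 [where \<Q> = \<Q>, OF tb]
    by (intro liminf_exponent_ge [OF b, where k = "5 * real CARD('x \<times> 'y)"]
        one_minus_opt_err_le_exp [where \<Q> = \<Q>, OF tb] min) auto
  then show "ereal ((rel_ent P t + max 0 (R * ln b - mut_inf t)) / ln b)
    \<le> limsup (\<lambda>n. ereal (1 / real n) * neg_log b (1 - opt_err P \<Q> n (exp (- (real n * (R * ln b))))))"
    by (meson Liminf_le_Limsup order_trans sequentially_bot)
qed

section \<open>The threshold\<close>

lemma attains_penalized:
  fixes P :: "('x::finite \<times> 'y::finite) pmf"
  assumes "continuous_on (prob_on (set_pmf P)) k"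
  obtains t where "t \<in> prob_on (set_pmf P)"
    "\<And>s. s \<in> prob_on (set_pmf P) \<Longrightarrow> rel_ent P t + max 0 (k t) \<le> rel_ent P s + max 0 (k s)"
proof -
  have "continuous_on (prob_on (set_pmf P)) (\<lambda>t. rel_ent P t + max 0 (k t))"
    using assms by (intro continuous_intros continuous_on_rel_ent)
  from continuous_attains_inf [OF compact_prob_on prob_on_nonempty this] show ?thesis
    using that by blast
qed

text \<open>A minimum of 0 would need zero divergence, hence \<open>t = P\<close>, but there the
  penalty is positive. This yields exponential decay on both sides of the threshold.\<close>

lemma penalized_lower_bound:
  fixes P :: "('x::finite \<times> 'y::finite) pmf"
  assumes "continuous_on (prob_on (set_pmf P)) k" "0 < k (pmf_vec P)"
  obtains v where "0 < v" "\<And>t. t \<in> prob_on (set_pmf P) \<Longrightarrow> v \<le> rel_ent P t + max 0 (k t)"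
proof -
  obtain t where t: "t \<in> prob_on (set_pmf P)"
    and min: "\<And>s. s \<in> prob_on (set_pmf P) \<Longrightarrow> rel_ent P t + max 0 (k t) \<le> rel_ent P s + max 0 (k s)"
    using attains_penalized [OF assms(1)] by blast
  have "0 < rel_ent P t + max 0 (k t)"
  proof (cases "rel_ent P t = 0")
    case True
    then have "t = pmf_vec P" by (rule rel_ent_eq_0D [OF t])
    then show ?thesis using assms(2) True by simp
  next
    case False
    then show ?thesis using rel_ent_nonneg [OF t] by linarith
  qed
  then show ?thesis using min that by blast
qed

lemma exp_neg_linear_slack: "0 < v \<Longrightarrow> (\<lambda>n. exp (- (real n * v) + slack k n)) \<longlonglongrightarrow> 0"
  unfolding slack_def by real_asymp

lemma opt_err_tendsto_0:
  fixes P :: "('x::finite \<times> 'y::finite) pmf"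
  assumes tb: "\<And>n. type_bounded n (\<Q> n)" and r: "r < mut_inf (pmf_vec P)"
  shows "(\<lambda>n. opt_err P \<Q> n (exp (- (real n * r)))) \<longlonglongrightarrow> 0"
proof -
  have "continuous_on (prob_on (set_pmf P)) (\<lambda>t. mut_inf t - r)"
    by (intro continuous_intros continuous_on_mut_inf)
  then obtain v where v: "0 < v" "\<And>t. t \<in> prob_on (set_pmf P) \<Longrightarrow> v \<le> rel_ent P t + max 0 (mut_inf t - r)"
    using penalized_lower_bound r by (metis (no_types, lifting) diff_gt_0_iff_gt)
  show ?thesis
  proof (rule tendsto_sandwich [OF _ _ tendsto_const exp_neg_linear_slack [OF v(1)]])
    show "\<forall>\<^sub>F n in sequentially. 0 \<le> opt_err P \<Q> n (exp (- (real n * r)))"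
      by (intro always_eventually allI opt_err_nonneg [where \<Q> = \<Q>, OF tb]) simp
    show "\<forall>\<^sub>F n in sequentially. opt_err P \<Q> n (exp (- (real n * r)))
        \<le> exp (- (real n * v) + slack (6 * real CARD('x \<times> 'y)) n)"
      using eventually_gt_at_top [of 0] by eventually_elim (rule opt_err_le_exp [where \<Q> = \<Q>, OF tb _ v(2)])
  qed
qed

lemma opt_err_tendsto_1:
  fixes P :: "('x::finite \<times> 'y::finite) pmf"
  assumes tb: "\<And>n. type_bounded n (\<Q> n)" and r: "mut_inf (pmf_vec P) < r"
  shows "(\<lambda>n. opt_err P \<Q> n (exp (- (real n * r)))) \<longlonglongrightarrow> 1"
proof -
  have "continuous_on (prob_on (set_pmf P)) (\<lambda>t. r - mut_inf t)"
    by (intro continuous_intros continuous_on_mut_inf)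
  then obtain v where v: "0 < v" "\<And>t. t \<in> prob_on (set_pmf P) \<Longrightarrow> v \<le> rel_ent P t + max 0 (r - mut_inf t)"
    using penalized_lower_bound r by (metis (no_types, lifting) diff_gt_0_iff_gt)
  have "(\<lambda>n. 1 - opt_err P \<Q> n (exp (- (real n * r)))) \<longlonglongrightarrow> 0"
  proof (rule tendsto_sandwich [OF _ _ tendsto_const exp_neg_linear_slack [OF v(1)]])
    show "\<forall>\<^sub>F n in sequentially. 0 \<le> 1 - opt_err P \<Q> n (exp (- (real n * r)))"
      using opt_err_le_1 [where \<Q> = \<Q>, OF tb] by (intro always_eventually allI) simp
    show "\<forall>\<^sub>F n in sequentially. 1 - opt_err P \<Q> n (exp (- (real n * r)))
        \<le> exp (- (real n * v) + slack (5 * real CARD('x \<times> 'y)) n)"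
      using eventually_gt_at_top [of 0] by eventually_elim (rule one_minus_opt_err_le_exp [where \<Q> = \<Q>, OF tb _ v(2)])
  qed
  then have "(\<lambda>n. 1 - (1 - opt_err P \<Q> n (exp (- (real n * r))))) \<longlonglongrightarrow> 1 - 0"
    by (intro tendsto_intros)
  then show ?thesis by simp
qed

lemma mutual_info_eq:
  assumes "1 < b"
  shows "mutual_info b P = ereal (mut_inf (pmf_vec P) / ln b)"
proof -
  let ?Q = "pair_pmf (map_pmf fst P) (map_pmf snd P)"
  have pos: "0 < pmf ?Q a" if "a \<in> set_pmf P" for a
    using that by (intro pmf_positive) (auto simp: mem_Times_iff)
  then have nz: "\<not> (\<exists>a\<in>set_pmf P. pmf ?Q a = 0)" by (metis less_irrefl)
  then have "mutual_info b P = ereal (\<Sum>a\<in>set_pmf P. pmf P a * (log b (pmf P a) - log b (pmf ?Q a)))"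
    unfolding mutual_info_def renyi_div_def by (simp only: nz) simp
  also have "(\<Sum>a\<in>set_pmf P. pmf P a * (log b (pmf P a) - log b (pmf ?Q a)))
    = (\<Sum>a\<in>UNIV. pmf P a * (ln (pmf P a) - ln (pmf ?Q a)) / ln b)"
    by (intro sum.mono_neutral_cong_left) (auto simp: pmf_eq_0_set_pmf log_def simp flip: diff_divide_distrib)
  also have "\<dots> = mut_inf (pmf_vec P) / ln b"
  proof -
    have "0 < marg1 (pmf_vec P) (fst a) \<and> 0 < marg2 (pmf_vec P) (snd a)" if "0 < pmf_vec P $ a" for a
      using marg_pos [OF pmf_vec_in_prob_on that] by simp
    then have "(\<Sum>a\<in>UNIV. pmf P a * (ln (pmf P a) - ln (pmf ?Q a))) = mut_inf (pmf_vec P)"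
      using rel_ent_product_decomposition [OF pmf_vec_in_prob_on, of P "marg1 (pmf_vec P)" "marg2 (pmf_vec P)"]
      by (simp add: pmf_pair_eta marg_pmf_vec)
    then show ?thesis by (simp flip: sum_divide_distrib)
  qed
  finally show ?thesis .
qed

text \<open>The optimal error tends to 0 below the mutual information and to 1 above it; the
  supremum is insensitive to what happens at the mutual information itself.\<close>

lemma threshold_rate_eq:
  fixes P :: "('x::finite \<times> 'y::finite) pmf"
  assumes b: "1 < b" and tb: "\<And>n. type_bounded n (\<Q> n)"
  shows "threshold_rate b P \<Q> = ereal (mut_inf (pmf_vec P) / ln b)"
proof -
  define I where "I = mut_inf (pmf_vec P) / ln b"
  have lnb: "0 < ln b" using b by simp
  define A where "A = {R. limsup (\<lambda>n. ereal (opt_err P \<Q> n (exp (- (real n * (R * ln b)))))) = 0}"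
  have below: "R \<in> A" if "R < I" for R
  proof -
    have "R * ln b < mut_inf (pmf_vec P)" using that lnb by (simp add: I_def field_simps)
    from opt_err_tendsto_0 [where \<Q> = \<Q>, OF tb this] show ?thesis
      unfolding A_def by (auto intro!: lim_imp_Limsup simp: zero_ereal_def)
  qed
  have above: "R \<notin> A" if "I < R" for R
  proof
    assume "R \<in> A"
    have "mut_inf (pmf_vec P) < R * ln b" using that lnb by (simp add: I_def field_simps)
    from opt_err_tendsto_1 [where \<Q> = \<Q>, OF tb this]
    have "limsup (\<lambda>n. ereal (opt_err P \<Q> n (exp (- (real n * (R * ln b)))))) = ereal 1"
      by (intro lim_imp_Limsup) auto
    then show False using \<open>R \<in> A\<close> by (simp add: A_def)
  qed
  have "Sup (ereal ` A) = ereal I"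
  proof (rule antisym)
    show "Sup (ereal ` A) \<le> ereal I"
      using above by (intro SUP_least) (auto simp: not_less [symmetric])
    show "ereal I \<le> Sup (ereal ` A)"
    proof (rule ereal_le_epsilon2)
      fix e :: real assume "0 < e"
      then have "ereal (I - e) \<le> Sup (ereal ` A)" using below by (intro SUP_upper) auto
      then show "ereal I \<le> Sup (ereal ` A) + ereal e"
        by (cases "Sup (ereal ` A)") auto
    qed
  qed
  then show ?thesis unfolding threshold_rate_def powr_rate [OF b] A_def I_def by simp
qed

section \<open>The Renyi expressions for the exponents\<close>

text \<open>The inverse \<open>(1 - s) / s\<close> is the prefactor in the error exponent. The
  excluded order \<open>1/2\<close> corresponds to \<open>c = 1\<close>, where the convexity of
  \<open>D + c I\<close> is used as an endpoint.\<close>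

lemma bij_betw_order_less_1: "bij_betw (\<lambda>c::real. 1 / (1 + c)) {0<..<1} {1/2<..<1}"
  by (rule bij_betw_byWitness [where f' = "\<lambda>s. (1 - s) / s"]) (auto simp: field_simps)

lemma bij_betw_order_greater_1: "bij_betw (\<lambda>c::real. 1 / (1 - c)) {0<..<1} {1<..}"
  by (rule bij_betw_byWitness [where f' = "\<lambda>s. (s - 1) / s"]) (auto simp: field_simps)

lemma INF_rel_ent_affine:
  "(INF t\<in>prob_on (set_pmf P). rel_ent P t + c * (mut_inf t - r))
    = (INF t\<in>prob_on (set_pmf P). rel_ent P t + c * mut_inf t) - c * r"
proof -
  obtain t where t: "t \<in> prob_on (set_pmf P)"
    and eq: "(INF t\<in>prob_on (set_pmf P). rel_ent P t + c * mut_inf t) = rel_ent P t + c * mut_inf t"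
    and le: "\<And>s. s \<in> prob_on (set_pmf P) \<Longrightarrow> rel_ent P t + c * mut_inf t \<le> rel_ent P s + c * mut_inf s"
    by (rule attains_rel_ent_mut_inf [of P c]) (rule that)
  have "(INF t\<in>prob_on (set_pmf P). rel_ent P t + c * (mut_inf t - r)) = rel_ent P t + c * (mut_inf t - r)"
    using t le by (intro cInf_eq_minimum) (auto simp: right_diff_distrib)
  then show ?thesis by (simp add: eq right_diff_distrib)
qed

lemma SUP_ereal_scale:
  fixes h :: "'a \<Rightarrow> real"
  assumes "I \<noteq> {}" "0 < L" "(SUP i\<in>I. ereal (h i)) = ereal v"
  shows "(SUP i\<in>I. ereal (h i / L)) = ereal (v / L)"
proof -
  have "(SUP i\<in>I. ereal (h i / L)) = (SUP i\<in>I. ereal (1 / L) * ereal (h i))" by simp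
  also have "\<dots> = ereal (1 / L) * (SUP i\<in>I. ereal (h i))"
    using assms by (intro Sup_ereal_mult_left' [symmetric]) auto
  finally show ?thesis by (simp add: assms(3))
qed

lemma renyi_error_exponent:
  fixes P :: "('x::finite \<times> 'y::finite) pmf"
  assumes b: "1 < b"
  shows "(SUP s\<in>{1/2<..<1}. ereal ((1 - s) / s) * (renyi_info_dd b s P - ereal R))
    = ereal ((INF t\<in>prob_on (set_pmf P). rel_ent P t + max 0 (mut_inf t - R * ln b)) / ln b)"
proof -
  let ?\<phi> = "\<lambda>c. INF t\<in>prob_on (set_pmf P). rel_ent P t + c * (mut_inf t - R * ln b)"
  have lnb: "0 < ln b" using b by simp
  have "ereal ((1 - s) / s) * (renyi_info_dd b s P - ereal R) = ereal (?\<phi> c / ln b)"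
    if "c \<in> {0<..<1}" and s: "s = 1 / (1 + c)" for c s
  proof -
    have c: "0 < c" using that by simp
    have cs: "(1 - s) / s = c" using c by (simp add: s field_simps)
    show ?thesis
      unfolding cs unfolding s renyi_info_dd_less_1 [OF b c] INF_rel_ent_affine
      using c lnb by (simp add: field_simps)
  qed
  then have "(SUP s\<in>{1/2<..<1}. ereal ((1 - s) / s) * (renyi_info_dd b s P - ereal R))
    = (SUP c\<in>{0<..<1}. ereal (?\<phi> c / ln b))"
    unfolding bij_betw_imp_surj_on [OF bij_betw_order_less_1, symmetric] image_image
    by (intro SUP_cong) auto
  also have "\<dots> = ereal ((INF t\<in>prob_on (set_pmf P). rel_ent P t + max 0 (mut_inf t - R * ln b)) / ln b)"
  proof (rule SUP_ereal_scale [OF _ lnb])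
    have "convex_on (prob_on (set_pmf P)) (\<lambda>t. (rel_ent P t + mut_inf t) + - (R * ln b))"
      by (intro convex_on_add convex_on_rel_ent_plus_mut_inf) (simp add: convex_on_const convex_prob_on)
    then have "convex_on (prob_on (set_pmf P)) (\<lambda>t. rel_ent P t + (mut_inf t - R * ln b))"
      by (simp add: algebra_simps)
    then show "(SUP c\<in>{0<..<1}. ereal (?\<phi> c))
      = ereal (INF t\<in>prob_on (set_pmf P). rel_ent P t + max 0 (mut_inf t - R * ln b))"
      by (intro minimax_positive_part compact_prob_on prob_on_nonempty continuous_on_rel_ent
          convex_on_rel_ent continuous_intros continuous_on_mut_inf)
  qed simp
  finally show ?thesis .
qed

lemma renyi_strong_converse_exponent:
  fixes P :: "('x::finite \<times> 'y::finite) pmf"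
  assumes b: "1 < b"
  shows "(SUP s\<in>{1<..}. ereal ((s - 1) / s) * (ereal R - renyi_info_dd b s P))
    = ereal ((INF t\<in>prob_on (set_pmf P). rel_ent P t + max 0 (R * ln b - mut_inf t)) / ln b)"
proof -
  let ?\<phi> = "\<lambda>c. INF t\<in>prob_on (set_pmf P). rel_ent P t + c * (R * ln b - mut_inf t)"
  have lnb: "0 < ln b" using b by simp
  have \<phi>: "?\<phi> c = (INF t\<in>prob_on (set_pmf P). rel_ent P t - c * mut_inf t) + c * (R * ln b)" for c
    using INF_rel_ent_affine [of P "- c" "R * ln b"] by (simp add: algebra_simps)
  have "ereal ((s - 1) / s) * (ereal R - renyi_info_dd b s P) = ereal (?\<phi> c / ln b)"
    if "c \<in> {0<..<1}" and s: "s = 1 / (1 - c)" for c s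
  proof -
    have c: "0 < c" "c < 1" using that by simp_all
    have cs: "(s - 1) / s = c" using c by (simp add: s field_simps)
    show ?thesis
      unfolding cs unfolding s renyi_info_dd_greater_1 [OF b c] \<phi>
      using c lnb by (simp add: field_simps)
  qed
  then have "(SUP s\<in>{1<..}. ereal ((s - 1) / s) * (ereal R - renyi_info_dd b s P))
    = (SUP c\<in>{0<..<1}. ereal (?\<phi> c / ln b))"
    unfolding bij_betw_imp_surj_on [OF bij_betw_order_greater_1, symmetric] image_image
    by (intro SUP_cong) auto
  also have "\<dots> = ereal ((INF t\<in>prob_on (set_pmf P). rel_ent P t + max 0 (R * ln b - mut_inf t)) / ln b)"
  proof (rule SUP_ereal_scale [OF _ lnb])
    have "convex_on (prob_on (set_pmf P)) (\<lambda>t. (rel_ent P t - mut_inf t) + R * ln b)"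
      by (intro convex_on_add convex_on_rel_ent_minus_mut_inf) (simp add: convex_on_const convex_prob_on)
    then have "convex_on (prob_on (set_pmf P)) (\<lambda>t. rel_ent P t + (R * ln b - mut_inf t))"
      by (simp add: algebra_simps)
    then show "(SUP c\<in>{0<..<1}. ereal (?\<phi> c))
      = ereal (INF t\<in>prob_on (set_pmf P). rel_ent P t + max 0 (R * ln b - mut_inf t))"
      by (intro minimax_positive_part compact_prob_on prob_on_nonempty continuous_on_rel_ent
          convex_on_rel_ent continuous_intros continuous_on_mut_inf)
  qed simp
  finally show ?thesis .
qed

text \<open>No restriction on \<open>R\<close> appears: the bounds for the acceptance probability
  already involve the penalized objective on both sides.\<close>

lemma strong_converse_exponent_eq_renyi:
  fixes P :: "('x::finite \<times> 'y::finite) pmf"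
  assumes b: "1 < b" and tb: "\<And>n. type_bounded n (\<Q> n)"
  shows "strong_converse_exponent b P \<Q> R
    = (SUP s\<in>{1<..}. ereal ((s - 1) / s) * (ereal R - renyi_info_dd b s P))"
proof -
  have "continuous_on (prob_on (set_pmf P)) (\<lambda>t. R * ln b - mut_inf t)"
    by (intro continuous_intros continuous_on_mut_inf)
  then obtain t where t: "t \<in> prob_on (set_pmf P)"
    and min: "\<And>s. s \<in> prob_on (set_pmf P) \<Longrightarrow>
      rel_ent P t + max 0 (R * ln b - mut_inf t) \<le> rel_ent P s + max 0 (R * ln b - mut_inf s)"
    by (rule attains_penalized) (rule that)
  have "(INF t\<in>prob_on (set_pmf P). rel_ent P t + max 0 (R * ln b - mut_inf t))
    = rel_ent P t + max 0 (R * ln b - mut_inf t)"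
    using t min by (intro cInf_eq_minimum) auto
  then show ?thesis
    using strong_converse_exponent_eq [where \<Q> = \<Q>, OF b tb t min]
    by (simp only: renyi_strong_converse_exponent [OF b])
qed

section \<open>The error exponent near the threshold\<close>

text \<open>Divided by \<open>ln b\<close>, at \<open>r = R * ln b\<close>, this is the Renyi
  expression. It bounds the error exponent from below for every \<open>R\<close>; the remaining task
  is to approach it by feasible distributions.\<close>

definition penalized_min :: "('x::finite \<times> 'y::finite) pmf \<Rightarrow> real \<Rightarrow> real" where
  "penalized_min P r = (INF t\<in>prob_on (set_pmf P). rel_ent P t + max 0 (mut_inf t - r))"

lemma penalized_min_attained:
  obtains t where "t \<in> prob_on (set_pmf P)" "penalized_min P r = rel_ent P t + max 0 (mut_inf t - r)"
    "\<And>s. s \<in> prob_on (set_pmf P) \<Longrightarrow> penalized_min P r \<le> rel_ent P s + max 0 (mut_inf s - r)"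
proof -
  have "continuous_on (prob_on (set_pmf P)) (\<lambda>t. mut_inf t - r)"
    by (intro continuous_intros continuous_on_mut_inf)
  then obtain t where t: "t \<in> prob_on (set_pmf P)"
    and min: "\<And>s. s \<in> prob_on (set_pmf P) \<Longrightarrow> rel_ent P t + max 0 (mut_inf t - r) \<le> rel_ent P s + max 0 (mut_inf s - r)"
    by (rule attains_penalized) (rule that)
  have "penalized_min P r = rel_ent P t + max 0 (mut_inf t - r)"
    unfolding penalized_min_def using t min by (intro cInf_eq_minimum) auto
  then show ?thesis using t min that by simp
qed

lemma penalized_min_le:
  "s \<in> prob_on (set_pmf P) \<Longrightarrow> penalized_min P r \<le> rel_ent P s + max 0 (mut_inf s - r)"
  by (rule penalized_min_attained [of P r]) blast

lemma penalized_min_nonneg: "0 \<le> penalized_min P r"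
proof -
  obtain t where "t \<in> prob_on (set_pmf P)" "penalized_min P r = rel_ent P t + max 0 (mut_inf t - r)"
    by (rule penalized_min_attained [of P r]) (rule that)
  then show ?thesis using rel_ent_nonneg [of t P] by simp
qed

lemma penalized_min_lipschitz:
  assumes "0 \<le> \<eta>" shows "penalized_min P (r - \<eta>) \<le> penalized_min P r + \<eta>"
proof -
  obtain t where "t \<in> prob_on (set_pmf P)" "penalized_min P r = rel_ent P t + max 0 (mut_inf t - r)"
    by (rule penalized_min_attained [of P r]) (rule that)
  then show ?thesis using penalized_min_le [of t P "r - \<eta>"] assms by (simp add: max_def split: if_splits)
qed

lemma error_exponent_eq_penalized_min:
  fixes P :: "('x::finite \<times> 'y::finite) pmf"
  assumes b: "1 < b" and tb: "\<And>n. type_bounded n (\<Q> n)"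
    and approx: "\<And>\<delta>. 0 < \<delta> \<Longrightarrow> \<exists>t\<in>prob_on (set_pmf P). mut_inf t < R * ln b \<and> rel_ent P t \<le> penalized_min P (R * ln b) + \<delta>"
  shows "error_exponent b P \<Q> R = ereal (penalized_min P (R * ln b) / ln b)"
proof (rule antisym)
  have lnb: "0 < ln b" using b by simp
  show "error_exponent b P \<Q> R \<le> ereal (penalized_min P (R * ln b) / ln b)"
  proof (rule ereal_le_epsilon2)
    fix e :: real assume "0 < e"
    then obtain t where t: "t \<in> prob_on (set_pmf P)" "mut_inf t < R * ln b"
      "rel_ent P t \<le> penalized_min P (R * ln b) + e * ln b"
      using approx [of "e * ln b"] lnb by auto
    have "error_exponent b P \<Q> R \<le> ereal (rel_ent P t / ln b)"
      by (rule error_exponent_le [where \<Q> = \<Q>, OF b tb t(1,2)])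
    also have "\<dots> \<le> ereal (penalized_min P (R * ln b) / ln b) + ereal e"
      using t(3) lnb by (simp add: field_simps)
    finally show "error_exponent b P \<Q> R \<le> ereal (penalized_min P (R * ln b) / ln b) + ereal e" .
  qed
  show "ereal (penalized_min P (R * ln b) / ln b) \<le> error_exponent b P \<Q> R"
    by (rule error_exponent_ge [where \<Q> = \<Q>, OF b tb penalized_min_le])
qed

text \<open>Feasibility is invoked at a slightly smaller level, which makes the constraint strict;
  lowering the level by \<eta> raises the penalized minimum by at most \<eta>.\<close>

lemma strict_feasibility:
  assumes "l < r"
    and feas: "\<And>r'. l < r' \<Longrightarrow> r' < r \<Longrightarrow>
      \<exists>t\<in>prob_on (set_pmf P). mut_inf t \<le> r' \<and> rel_ent P t \<le> penalized_min P r'"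
    and "0 < \<delta>"
  shows "\<exists>t\<in>prob_on (set_pmf P). mut_inf t < r \<and> rel_ent P t \<le> penalized_min P r + \<delta>"
proof -
  define \<eta> where "\<eta> = min \<delta> ((r - l) / 2)"
  have \<eta>: "0 < \<eta>" "\<eta> \<le> \<delta>" "\<eta> < r - l" using assms(1,3) by (auto simp: \<eta>_def min_def)
  obtain t where "t \<in> prob_on (set_pmf P)" "mut_inf t \<le> r - \<eta>" "rel_ent P t \<le> penalized_min P (r - \<eta>)"
    using feas [of "r - \<eta>"] \<eta> by auto
  then show ?thesis using \<eta> penalized_min_lipschitz [of \<eta> P r] by (intro bexI [of _ t]) auto
qed

lemma feasible_if_not_minimizer:
  fixes P :: "('x::finite \<times> 'y::finite) pmf"
  assumes t1: "t1 \<in> prob_on (set_pmf P)" "rel_ent P t1 + mut_inf t1 < r"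
  shows "\<exists>t\<in>prob_on (set_pmf P). mut_inf t \<le> r \<and> rel_ent P t \<le> penalized_min P r"
proof -
  obtain t where t: "t \<in> prob_on (set_pmf P)" and eq: "penalized_min P r = rel_ent P t + max 0 (mut_inf t - r)"
    and min: "\<And>s. s \<in> prob_on (set_pmf P) \<Longrightarrow> penalized_min P r \<le> rel_ent P s + max 0 (mut_inf s - r)"
    by (rule penalized_min_attained [of P r]) (rule that)
  have "mut_inf t \<le> r"
  proof (rule ccontr)
    assume "\<not> mut_inf t \<le> r"
    then have gt: "r < mut_inf t" by simp
    \<comment> \<open>A short move from \<open>t\<close> towards \<open>t1\<close> still violates
      the constraint, so the penalty stays active there and the objective is
      \<open>D + I - r\<close>.\<close>
    let ?u = "\<lambda>n. (1 - 1 / real (Suc n)) *\<^sub>R t + (1 / real (Suc n)) *\<^sub>R t1"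
    have u: "?u n \<in> prob_on (set_pmf P)" for n
      using t t1(1) by (intro prob_on_mix) auto
    have "(\<lambda>n. 1 / real (Suc n)) \<longlonglongrightarrow> 0" by real_asymp
    then have "?u \<longlonglongrightarrow> (1 - 0) *\<^sub>R t + 0 *\<^sub>R t1" by (intro tendsto_intros)
    then have "?u \<longlonglongrightarrow> t" by simp
    then have "(\<lambda>n. mut_inf (?u n)) \<longlonglongrightarrow> mut_inf t"
      using u by (intro continuous_on_tendsto_compose [OF continuous_on_mut_inf _ t] always_eventually) auto
    then have "\<forall>\<^sub>F n in sequentially. r < mut_inf (?u n)" using gt by (rule order_tendstoD)
    then obtain n where n: "r < mut_inf (?u n)" by (auto simp: eventually_sequentially)
    define e where "e = 1 / real (Suc n)"
    have e: "0 < e" "e \<le> 1" by (auto simp: e_def)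
    have "rel_ent P t + mut_inf t \<le> rel_ent P (?u n) + mut_inf (?u n)"
      using min [OF u, of n] eq n gt by simp
    also have "\<dots> \<le> (1 - e) * (rel_ent P t + mut_inf t) + e * (rel_ent P t1 + mut_inf t1)"
      unfolding e_def [symmetric] using e by (intro convex_onD [OF convex_on_rel_ent_plus_mut_inf [of "set_pmf P"]] t t1) auto
    finally have "e * (rel_ent P t + mut_inf t) \<le> e * (rel_ent P t1 + mut_inf t1)"
      by (simp add: algebra_simps)
    then have "rel_ent P t + mut_inf t \<le> rel_ent P t1 + mut_inf t1" using e by simp
    \<comment> \<open>The value of \<open>D + I\<close> at \<open>t\<close> is at least
      \<open>I(t) > r\<close>, while at \<open>t1\<close> it is below \<open>r\<close>.\<close>
    then show False using gt t1(2) rel_ent_nonneg [OF t] by linarith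
  qed
  then show ?thesis using t eq by (intro bexI [of _ t]) auto
qed

section \<open>Information density and first-order optimality\<close>

definition info_density :: "('x::finite \<times> 'y::finite) pmf \<Rightarrow> 'x \<times> 'y \<Rightarrow> real" where
  "info_density P a = ln (pmf P a) - ln (marg1 (pmf_vec P) (fst a) * marg2 (pmf_vec P) (snd a))"

lemma marg_pmf_vec_pos:
  assumes "a \<in> set_pmf P"
  shows "0 < marg1 (pmf_vec P) (fst a)" "0 < marg2 (pmf_vec P) (snd a)"
  using marg_pos [OF pmf_vec_in_prob_on, of P a] pmf_positive [OF assms] by auto

text \<open>Both sides equal the divergence of \<open>t\<close> from the product of the marginals of
  \<open>P\<close>: on the left by changing the reference from \<open>P\<close>, on the right by the
  product decomposition.\<close>

lemma rel_ent_plus_info_density: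
  fixes P :: "('x::finite \<times> 'y::finite) pmf"
  assumes t: "t \<in> prob_on (set_pmf P)"
  shows "rel_ent P t + (\<Sum>a\<in>UNIV. t $ a * info_density P a) = mut_inf t
    + (\<Sum>x\<in>UNIV. marg1 t x * (ln (marg1 t x) - ln (marg1 (pmf_vec P) x)))
    + (\<Sum>y\<in>UNIV. marg2 t y * (ln (marg2 t y) - ln (marg2 (pmf_vec P) y)))"
proof -
  have "rel_ent P t + (\<Sum>a\<in>UNIV. t $ a * info_density P a)
    = (\<Sum>a\<in>UNIV. t $ a * (ln (t $ a) - ln (marg1 (pmf_vec P) (fst a) * marg2 (pmf_vec P) (snd a))))"
    unfolding rel_ent_altdef sum.distrib [symmetric]
    by (intro sum.cong refl) (simp add: info_density_def algebra_simps)
  moreover have "0 < marg1 (pmf_vec P) (fst a) \<and> 0 < marg2 (pmf_vec P) (snd a)" if "0 < t $ a" for a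
    using marg_pmf_vec_pos [OF prob_on_support [OF t that]] by simp
  ultimately show ?thesis
    using rel_ent_product_decomposition [OF t, of "marg1 (pmf_vec P)" "marg2 (pmf_vec P)"] by simp
qed

lemma sum_info_density: "(\<Sum>a\<in>UNIV. pmf P a * info_density P a) = mut_inf (pmf_vec P)"
  using rel_ent_plus_info_density [OF pmf_vec_in_prob_on, of P] by simp

lemma marginal_divergence_nonneg:
  assumes t: "t \<in> prob_on (set_pmf P)"
  shows "0 \<le> (\<Sum>x\<in>UNIV. marg1 t x * (ln (marg1 t x) - ln (marg1 (pmf_vec P) x)))"
    and "0 \<le> (\<Sum>y\<in>UNIV. marg2 t y * (ln (marg2 t y) - ln (marg2 (pmf_vec P) y)))"
proof -
  have "0 < marg1 (pmf_vec P) x" if "0 < marg1 t x" for x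
    using marg_pos_obtain(1) [OF t that] prob_on_support [OF t] marg_pmf_vec_pos(1) by fastforce
  then have "- ln (\<Sum>x\<in>UNIV. marg1 (pmf_vec P) x)
      \<le> (\<Sum>x\<in>UNIV. marg1 t x * (ln (marg1 t x) - ln (marg1 (pmf_vec P) x)))"
    using marg_nonneg [OF t] marg_nonneg [OF pmf_vec_in_prob_on, of P] sum_marg [OF t]
    by (intro gibbs_inequality) auto
  then show "0 \<le> (\<Sum>x\<in>UNIV. marg1 t x * (ln (marg1 t x) - ln (marg1 (pmf_vec P) x)))"
    using sum_marg [OF pmf_vec_in_prob_on, of P] by simp
  have "0 < marg2 (pmf_vec P) y" if "0 < marg2 t y" for y
    using marg_pos_obtain(2) [OF t that] prob_on_support [OF t] marg_pmf_vec_pos(2) by fastforce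
  then have "- ln (\<Sum>y\<in>UNIV. marg2 (pmf_vec P) y)
      \<le> (\<Sum>y\<in>UNIV. marg2 t y * (ln (marg2 t y) - ln (marg2 (pmf_vec P) y)))"
    using marg_nonneg [OF t] marg_nonneg [OF pmf_vec_in_prob_on, of P] sum_marg [OF t]
    by (intro gibbs_inequality) auto
  then show "0 \<le> (\<Sum>y\<in>UNIV. marg2 t y * (ln (marg2 t y) - ln (marg2 (pmf_vec P) y)))"
    using sum_marg [OF pmf_vec_in_prob_on, of P] by simp
qed

text \<open>First-order optimality of \<open>P\<close>: in direction \<open>t\<close> the derivative of \<open>rel_ent P + mut_inf\<close>
  is the excess of the mean information density under \<open>t\<close> over the mutual information.\<close>

lemma minimizer_info_density:
  fixes P :: "('x::finite \<times> 'y::finite) pmf"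
  assumes min: "\<And>t. t \<in> prob_on (set_pmf P) \<Longrightarrow> mut_inf (pmf_vec P) \<le> rel_ent P t + mut_inf t"
    and a: "a \<in> set_pmf P"
  shows "info_density P a = mut_inf (pmf_vec P)"
proof -
  define i where "i = mut_inf (pmf_vec P)"
  have ge: "i \<le> (\<Sum>a\<in>UNIV. t $ a * info_density P a)" if t: "t \<in> prob_on (set_pmf P)" for t
  proof -
    define J where "J = (\<Sum>a\<in>UNIV. t $ a * info_density P a)"
    define k where "k = (\<Sum>a\<in>UNIV. (t $ a - pmf P a)\<^sup>2 / pmf P a)"
    have k: "0 \<le> k" by (simp add: k_def sum_nonneg)
    have bound: "i \<le> J + 2 * e * k" if e: "0 < e" "e < 1" for e
    proof -
      let ?u = "(1 - e) *\<^sub>R pmf_vec P + e *\<^sub>R t"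
      have u: "?u \<in> prob_on (set_pmf P)" using t e by (intro prob_on_mix pmf_vec_in_prob_on) auto
      have sq: "(?u $ a - pmf P a)\<^sup>2 = e\<^sup>2 * (t $ a - pmf P a)\<^sup>2" for a
      proof -
        have "?u $ a - pmf P a = e * (t $ a - pmf P a)" by (simp add: algebra_simps)
        then show ?thesis by (simp only: power_mult_distrib)
      qed
      have "rel_ent P ?u \<le> (\<Sum>a\<in>UNIV. (?u $ a - pmf P a)\<^sup>2 / pmf P a)"
        unfolding rel_ent_altdef
        using prob_onD(3) [OF u] by (intro kl_le_chi_square prob_onD(1) [OF u] prob_on_pmf_pos [OF u])
          (simp_all only: finite pmf_nonneg sum_pmf_UNIV)
      also have "\<dots> = e\<^sup>2 * k" unfolding sq by (simp add: k_def sum_distrib_left)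
      finally have f: "rel_ent P ?u \<le> e\<^sup>2 * k" .
      have "(\<Sum>a\<in>UNIV. ?u $ a * info_density P a) = (1 - e) * (\<Sum>a\<in>UNIV. pmf P a * info_density P a) + e * J"
        by (simp add: J_def distrib_right sum.distrib sum_distrib_left mult.assoc)
      then have "(\<Sum>a\<in>UNIV. ?u $ a * info_density P a) = (1 - e) * i + e * J"
        by (simp add: sum_info_density i_def)
      \<comment> \<open>Dropping the two nonnegative marginal divergences bounds \<open>I(u)\<close>
        by \<open>D(u || P)\<close> plus the mean information density, which is affine in
        \<open>e\<close>. The doubled divergence is only of order \<open>e^2\<close>.\<close>
      then have "rel_ent P ?u + mut_inf ?u \<le> 2 * rel_ent P ?u + ((1 - e) * i + e * J)"
        using rel_ent_plus_info_density [OF u] marginal_divergence_nonneg [OF u] by linarith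
      then have "i \<le> 2 * (e\<^sup>2 * k) + ((1 - e) * i + e * J)" using min [OF u] f i_def by linarith
      then have "e * i \<le> e * (J + 2 * e * k)" by (simp add: algebra_simps power2_eq_square)
      then show ?thesis using e by simp
    qed
    show ?thesis unfolding J_def [symmetric]
    proof (rule field_le_epsilon)
      fix e :: real assume e: "0 < e"
      define d where "d = min (1/2) (e / (2 * k + 1))"
      have d: "0 < d" "d < 1" using e k by (auto simp: d_def intro!: divide_pos_pos add_nonneg_pos)
      have "(2 * k) * d \<le> (2 * k) * (e / (2 * k + 1))"
        using k by (intro mult_left_mono) (auto simp: d_def)
      also have "\<dots> \<le> e" using k e by (simp add: field_simps)
      finally have "2 * d * k \<le> e" by (simp add: mult_ac)
      then show "i \<le> J + e" using bound [OF d] by simp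
    qed
  qed
  have i_le: "i \<le> info_density P a" if "a \<in> set_pmf P" for a
  proof -
    have "axis a 1 \<in> prob_on (set_pmf P)" using that by (auto simp: prob_on_def axis_def)
    from ge [OF this] have "i \<le> (\<Sum>a'\<in>UNIV. axis a 1 $ a' * info_density P a')" .
    also have "\<dots> = (\<Sum>a'\<in>UNIV. if a' = a then info_density P a' else 0)"
      by (intro sum.cong) (auto simp: axis_def)
    finally show ?thesis by simp
  qed
  \<comment> \<open>The density is at least \<open>i\<close> at every point of the support, by
    testing with point masses, and its mean under \<open>P\<close> is \<open>i\<close>; hence it is
    constant.\<close>
  have nonneg: "0 \<le> pmf P a * (info_density P a - i)" for a
    using i_le [of a] by (cases "a \<in> set_pmf P") (auto simp: set_pmf_iff)
  have "(\<Sum>a\<in>UNIV. pmf P a * (info_density P a - i)) = 0"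
    unfolding right_diff_distrib sum_subtractf sum_info_density sum_distrib_right [symmetric] sum_pmf_UNIV
    by (simp add: i_def)
  then have "\<forall>a\<in>UNIV. pmf P a * (info_density P a - i) = 0"
    by (subst (asm) sum_nonneg_eq_0_iff) (simp only: finite, rule nonneg)
  then have "pmf P a * (info_density P a - i) = 0" by blast
  then show ?thesis using pmf_positive [OF a] by (simp add: i_def)
qed

lemma const_info_densityI:
  fixes P :: "('x::finite \<times> 'y::finite) pmf"
  assumes "\<And>a. a \<in> set_pmf P \<Longrightarrow> info_density P a = i"
  shows "const_info_density P"
  unfolding const_info_density_def
proof (intro exI [of _ "exp i"] ballI, clarify)
  fix x y assume a: "(x, y) \<in> set_pmf P"
  have m: "0 < marg1 (pmf_vec P) x" "0 < marg2 (pmf_vec P) y" using marg_pmf_vec_pos [OF a] by auto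
  have "exp i = exp (ln (pmf P (x, y)) - ln (marg1 (pmf_vec P) x * marg2 (pmf_vec P) y))"
    using assms [OF a] by (simp add: info_density_def)
  also have "\<dots> = pmf P (x, y) / (marg1 (pmf_vec P) x * marg2 (pmf_vec P) y)"
    using m pmf_positive [OF a] by (simp add: exp_diff)
  finally show "pmf P (x, y) = exp i * pmf (map_pmf fst P) x * pmf (map_pmf snd P) y"
    using m by (simp add: marg_pmf_vec)
qed

lemma mut_inf_const_info_density:
  fixes P :: "('x::finite \<times> 'y::finite) pmf"
  assumes const: "\<And>a. a \<in> set_pmf P \<Longrightarrow> info_density P a = i" and t: "t \<in> prob_on (set_pmf P)"
  shows "mut_inf t = i + rel_ent P t
    - (\<Sum>x\<in>UNIV. marg1 t x * (ln (marg1 t x) - ln (marg1 (pmf_vec P) x)))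
    - (\<Sum>y\<in>UNIV. marg2 t y * (ln (marg2 t y) - ln (marg2 (pmf_vec P) y)))"
proof -
  have "(\<Sum>a\<in>UNIV. t $ a * info_density P a) = (\<Sum>a\<in>UNIV. t $ a * i)"
  proof (intro sum.cong refl)
    fix a show "t $ a * info_density P a = t $ a * i"
      using const [of a] prob_onD(2) [OF t, of a] by (cases "a \<in> set_pmf P") auto
  qed
  then show ?thesis
    using rel_ent_plus_info_density [OF t] prob_onD(3) [OF t] by (simp flip: sum_distrib_right)
qed

section \<open>Tilting by a function of the first coordinate\<close>

text \<open>A weight depending on \<open>X\<close> alone preserves the conditional law of
  \<open>Y\<close> given \<open>X\<close>, so the divergence from \<open>P\<close> is that of the
  \<open>X\<close>-marginals.\<close>

definition tilt :: "('x::finite \<times> 'y::finite) pmf \<Rightarrow> ('x \<Rightarrow> real) \<Rightarrow> real^('x \<times> 'y)" where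
  "tilt P w = (\<chi> a. pmf P a * w (fst a))"

lemma tilt_nth [simp]: "tilt P w $ a = pmf P a * w (fst a)"
  by (simp add: tilt_def)

lemma marg1_tilt: "marg1 (tilt P w) x = marg1 (pmf_vec P) x * w x"
  by (simp add: marg1_def sum_distrib_right)

lemma tilt_in_prob_on:
  assumes "\<And>x. 0 \<le> w x" "(\<Sum>x\<in>UNIV. marg1 (pmf_vec P) x * w x) = 1"
  shows "tilt P w \<in> prob_on (set_pmf P)"
proof -
  have "(\<Sum>a\<in>UNIV. tilt P w $ a) = 1"
    using sum_pair_marg1 [of "pmf_vec P" w] assms(2) by simp
  then show ?thesis using assms(1) by (auto simp: prob_on_def set_pmf_iff)
qed

lemma tilt_mix:
  "(1 - \<theta>) *\<^sub>R pmf_vec P + \<theta> *\<^sub>R tilt P w = tilt P (\<lambda>x. (1 - \<theta>) + \<theta> * w x)"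
  by (simp add: vec_eq_iff algebra_simps)

lemma log_ratio_product:
  fixes p w :: real
  assumes "0 \<le> p" "0 \<le> w"
  shows "p * w * (ln (p * w) - ln p) = p * w * ln w"
  using assms by (cases "p = 0 \<or> w = 0") (auto simp: ln_mult)

lemma rel_ent_tilt:
  assumes "\<And>x. 0 \<le> w x"
  shows "rel_ent P (tilt P w) = (\<Sum>a\<in>UNIV. tilt P w $ a * ln (w (fst a)))"
  using assms by (simp add: rel_ent_altdef log_ratio_product)

lemma rel_ent_tilt_marg1:
  assumes "\<And>x. 0 \<le> w x"
  shows "rel_ent P (tilt P w)
    = (\<Sum>x\<in>UNIV. marg1 (tilt P w) x * (ln (marg1 (tilt P w) x) - ln (marg1 (pmf_vec P) x)))"
  unfolding rel_ent_tilt [OF assms] sum_pair_marg1 [of "tilt P w" "\<lambda>x. ln (w x)"]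
  using assms marg_nonneg(1) [OF pmf_vec_in_prob_on, of P] by (simp add: marg1_tilt log_ratio_product)

text \<open>If the weight is almost surely a function of \<open>Y\<close> too, the roles of the
  coordinates can be exchanged, and the divergence is also that of the
  \<open>Y\<close>-marginals.\<close>

lemma rel_ent_tilt_marg2:
  assumes "\<And>x. 0 \<le> w x" "\<And>y. 0 \<le> w' y"
    and eq: "\<And>x y. (x, y) \<in> set_pmf P \<Longrightarrow> w x = w' y"
  shows "rel_ent P (tilt P w)
    = (\<Sum>y\<in>UNIV. marg2 (tilt P w) y * (ln (marg2 (tilt P w) y) - ln (marg2 (pmf_vec P) y)))"
proof -
  have P_eq: "pmf P a * w (fst a) = pmf P a * w' (snd a)" for a
    using eq [of "fst a" "snd a"] by (cases "a \<in> set_pmf P") (auto simp: set_pmf_iff)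
  have marg2: "marg2 (tilt P w) y = marg2 (pmf_vec P) y * w' y" for y
    unfolding marg2_def tilt_nth P_eq by (simp add: sum_distrib_right)
  have "tilt P w $ a * ln (w (fst a)) = tilt P w $ a * ln (w' (snd a))" for a
    using eq [of "fst a" "snd a"] by (cases "a \<in> set_pmf P") (auto simp: set_pmf_iff)
  then have "rel_ent P (tilt P w) = (\<Sum>a\<in>UNIV. tilt P w $ a * ln (w' (snd a)))"
    unfolding rel_ent_tilt [OF assms(1)] by (intro sum.cong refl)
  also have "\<dots> = (\<Sum>y\<in>UNIV. marg2 (tilt P w) y * ln (w' y))" by (rule sum_pair_marg2)
  finally show ?thesis
    using assms(2) marg_nonneg(2) [OF pmf_vec_in_prob_on, of P] by (simp add: marg2 log_ratio_product)
qed

text \<open>When the weight is a function of the common part, both marginal divergences equal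
  \<open>D(t || P)\<close>, and the constant density gives \<open>I(t) = i - D(t || P)\<close>.
  Along the segment from \<open>P\<close> to \<open>P\<close> conditioned on the common event, the
  divergence takes all small values by continuity.\<close>

lemma feasible_common_part:
  fixes P :: "('x::finite \<times> 'y::finite) pmf"
  assumes const: "\<And>a. a \<in> set_pmf P \<Longrightarrow> info_density P a = i"
    and common: "has_common_part P"
  obtains \<epsilon> where "0 < \<epsilon>"
    "\<And>r. i - \<epsilon> < r \<Longrightarrow> r < i \<Longrightarrow> \<exists>t\<in>prob_on (set_pmf P). mut_inf t = r \<and> rel_ent P t = i - r"
proof -
  obtain A B where AB_all: "\<forall>(x, y)\<in>set_pmf P. x \<in> A \<longleftrightarrow> y \<in> B"
    and A01: "0 < measure_pmf.prob (map_pmf fst P) A" "measure_pmf.prob (map_pmf fst P) A < 1"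
    using common unfolding has_common_part_def by (elim exE conjE)
  have AB: "x \<in> A \<longleftrightarrow> y \<in> B" if "(x, y) \<in> set_pmf P" for x y
    using bspec [OF AB_all that] by simp
  define p where "p = measure_pmf.prob (map_pmf fst P) A"
  have p: "0 < p" "p < 1" using A01 by (simp_all add: p_def)
  have p_sum: "(\<Sum>x\<in>A. marg1 (pmf_vec P) x) = p"
    unfolding p_def marg_pmf_vec by (rule measure_measure_pmf_finite [symmetric]) simp
  define w :: "real \<Rightarrow> 'x \<Rightarrow> real" where "w = (\<lambda>\<theta> x. (1 - \<theta>) + \<theta> * (indicator A x / p))"
  define w' :: "real \<Rightarrow> 'y \<Rightarrow> real" where "w' = (\<lambda>\<theta> y. (1 - \<theta>) + \<theta> * (indicator B y / p))"
  have w_nonneg: "0 \<le> w \<theta> x" "0 \<le> w' \<theta> y" if "0 \<le> \<theta>" "\<theta> \<le> 1" for \<theta> x y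
    using that p by (auto simp: w_def w'_def)
  have w_eq: "w \<theta> x = w' \<theta> y" if "(x, y) \<in> set_pmf P" for \<theta> x y
    using AB [OF that] by (simp add: w_def w'_def indicator_def)
  \<comment> \<open>This is \<open>P\<close> conditioned on the event that \<open>X\<close> lies in
    \<open>A\<close>.\<close>
  let ?s = "tilt P (\<lambda>x. indicator A x / p)"
  have s: "?s \<in> prob_on (set_pmf P)"
  proof (rule tilt_in_prob_on)
    show "(\<Sum>x\<in>UNIV. marg1 (pmf_vec P) x * (indicator A x / p)) = 1"
      using p p_sum by (simp add: indicator_def if_distrib sum.If_cases flip: sum_divide_distrib cong: if_cong)
  qed (use p in auto)
  define T where "T = (\<lambda>\<theta>. (1 - \<theta>) *\<^sub>R pmf_vec P + \<theta> *\<^sub>R ?s)"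
  have T_eq: "T \<theta> = tilt P (w \<theta>)" for \<theta> by (simp add: T_def tilt_mix w_def)
  have T: "T \<theta> \<in> prob_on (set_pmf P)" if "0 \<le> \<theta>" "\<theta> \<le> 1" for \<theta>
    unfolding T_def using that s by (intro prob_on_mix pmf_vec_in_prob_on)
  have mi: "mut_inf (T \<theta>) = i - rel_ent P (T \<theta>)" if "0 \<le> \<theta>" "\<theta> \<le> 1" for \<theta>
  proof -
    have "rel_ent P (T \<theta>)
      = (\<Sum>x\<in>UNIV. marg1 (T \<theta>) x * (ln (marg1 (T \<theta>) x) - ln (marg1 (pmf_vec P) x)))"
      unfolding T_eq by (rule rel_ent_tilt_marg1 [OF w_nonneg(1) [OF that]])
    moreover have "rel_ent P (T \<theta>)
      = (\<Sum>y\<in>UNIV. marg2 (T \<theta>) y * (ln (marg2 (T \<theta>) y) - ln (marg2 (pmf_vec P) y)))"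
      unfolding T_eq by (rule rel_ent_tilt_marg2 [of "w \<theta>" "w' \<theta>", OF w_nonneg [OF that] w_eq])
    ultimately show ?thesis
      using mut_inf_const_info_density [OF const T [OF that]] by linarith
  qed
  have "continuous_on {0..1} (\<lambda>\<theta>. rel_ent P (T \<theta>))"
    by (rule continuous_on_compose2 [OF continuous_on_rel_ent [of "set_pmf P" P]])
      (use T in \<open>auto simp: T_def intro!: continuous_intros\<close>)
  moreover have "rel_ent P (T 0) = 0" by (simp add: T_def)
  moreover have pos: "0 < rel_ent P (T 1)"
  proof -
    have "T 1 \<noteq> pmf_vec P"
    proof
      assume eq: "T 1 = pmf_vec P"
      obtain x where x: "x \<in> A" "x \<in> fst ` set_pmf P"
      proof -
        have "A \<inter> set_pmf (map_pmf fst P) \<noteq> {}"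
          using A01(1) by (metis measure_Int_set_pmf measure_empty less_irrefl)
        then show ?thesis using that by auto
      qed
      then obtain y where xy: "(x, y) \<in> set_pmf P" by auto
      have "pmf P (x, y) * p < pmf P (x, y) * 1"
        using p pmf_positive [OF xy] by (intro mult_strict_left_mono)
      then have "pmf P (x, y) < pmf P (x, y) / p" using p by (simp add: pos_less_divide_eq)
      moreover have "pmf P (x, y) / p = pmf P (x, y)"
        using arg_cong [OF eq, of "\<lambda>v. v $ (x, y)"] x by (simp add: T_def)
      ultimately show False by linarith
    qed
    then show ?thesis using rel_ent_eq_0D [OF T [of 1]] rel_ent_nonneg [OF T [of 1]] by fastforce
  qed
  ultimately have ivt: "\<exists>\<theta>\<ge>0. \<theta> \<le> 1 \<and> rel_ent P (T \<theta>) = v" if "0 \<le> v" "v \<le> rel_ent P (T 1)" for v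
    using IVT' [of "\<lambda>\<theta>. rel_ent P (T \<theta>)" 0 v 1] that by auto
  show ?thesis
  proof (rule that [OF pos])
    fix r assume "i - rel_ent P (T 1) < r" "r < i"
    then obtain \<theta> where "0 \<le> \<theta>" "\<theta> \<le> 1" "rel_ent P (T \<theta>) = i - r"
      using ivt [of "i - r"] by auto
    then show "\<exists>t\<in>prob_on (set_pmf P). mut_inf t = r \<and> rel_ent P t = i - r"
      using T [of \<theta>] mi [of \<theta>] by (intro bexI [of _ "T \<theta>"]) auto
  qed
qed

text \<open>Needed at the threshold itself, also for degenerate \<open>P\<close>. Tilting
  \<open>P\<close> slightly towards \<open>X = x0\<close> gives
  \<open>I(t) = i - D(t_Y || P_Y)\<close>, so it suffices that the \<open>Y\<close>-marginal moves.
  If it did not, the information density at \<open>(x0, y0)\<close> would be 0 and not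
  \<open>i > 0\<close>.\<close>

lemma strict_feasibility_const_info_density:
  fixes P :: "('x::finite \<times> 'y::finite) pmf"
  assumes const: "\<And>a. a \<in> set_pmf P \<Longrightarrow> info_density P a = i" and i: "0 < i" and \<delta>: "0 < \<delta>"
  shows "\<exists>t\<in>prob_on (set_pmf P). mut_inf t < i \<and> rel_ent P t \<le> \<delta>"
proof -
  obtain x0 y0 where a: "(x0, y0) \<in> set_pmf P" using set_pmf_not_empty [of P] by (metis ex_in_conv surj_pair)
  define q where "q = marg1 (pmf_vec P) x0"
  have q: "0 < q" using marg_pmf_vec_pos(1) [OF a] by (simp add: q_def)
  define w :: "'x \<Rightarrow> real" where "w = (\<lambda>x. if x = x0 then 1 / q else 0)"
  let ?s = "tilt P w"
  have s: "?s \<in> prob_on (set_pmf P)"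
    using q by (intro tilt_in_prob_on) (auto simp: w_def q_def if_distrib cong: if_cong)
  define \<theta> where "\<theta> = min (1/2) (\<delta> / (rel_ent P ?s + 1))"
  have f: "0 \<le> rel_ent P ?s" by (rule rel_ent_nonneg [OF s])
  have \<theta>: "0 < \<theta>" "\<theta> < 1" using f \<delta> by (auto simp: \<theta>_def intro!: divide_pos_pos add_nonneg_pos)
  have "\<theta> * rel_ent P ?s \<le> \<delta> / (rel_ent P ?s + 1) * rel_ent P ?s"
    using f by (intro mult_right_mono) (auto simp: \<theta>_def)
  also have "\<dots> \<le> \<delta>" using f \<delta> by (simp add: field_simps)
  finally have \<theta>\<delta>: "\<theta> * rel_ent P ?s \<le> \<delta>" .
  define t where "t = (1 - \<theta>) *\<^sub>R pmf_vec P + \<theta> *\<^sub>R ?s"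
  have t: "t \<in> prob_on (set_pmf P)" unfolding t_def using \<theta> s by (intro prob_on_mix pmf_vec_in_prob_on) auto
  have "rel_ent P t \<le> (1 - \<theta>) * rel_ent P (pmf_vec P) + \<theta> * rel_ent P ?s"
    unfolding t_def using \<theta> by (intro convex_onD [OF convex_on_rel_ent [of "set_pmf P"]] pmf_vec_in_prob_on s) auto
  then have small: "rel_ent P t \<le> \<delta>" using \<theta>\<delta> by simp
  have t_tilt: "t = tilt P (\<lambda>x. (1 - \<theta>) + \<theta> * w x)" by (simp add: t_def tilt_mix)
  have "rel_ent P t = (\<Sum>x\<in>UNIV. marg1 t x * (ln (marg1 t x) - ln (marg1 (pmf_vec P) x)))"
    unfolding t_tilt using \<theta> q by (intro rel_ent_tilt_marg1) (auto simp: w_def)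
  then have mi: "mut_inf t = i - (\<Sum>y\<in>UNIV. marg2 t y * (ln (marg2 t y) - ln (marg2 (pmf_vec P) y)))"
    using mut_inf_const_info_density [OF const t] by simp
  define tY :: "real^'y" where "tY = (\<chi> y. marg2 t y)"
  have D: "rel_ent (map_pmf snd P) tY = (\<Sum>y\<in>UNIV. marg2 t y * (ln (marg2 t y) - ln (marg2 (pmf_vec P) y)))"
    by (simp add: rel_ent_altdef tY_def marg_pmf_vec)
  have tY: "tY \<in> prob_on (set_pmf (map_pmf snd P))"
  proof -
    have "marg2 t y = 0" if "y \<notin> snd ` set_pmf P" for y
    proof -
      have "(x, y) \<notin> set_pmf P" for x using that by force
      then show ?thesis using prob_onD(2) [OF t] by (simp add: marg2_def)
    qed
    then show ?thesis using marg_nonneg(2) [OF t] sum_marg(2) [OF t] by (auto simp: prob_on_def tY_def)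
  qed
  have "tY \<noteq> pmf_vec (map_pmf snd P)"
  proof
    assume "tY = pmf_vec (map_pmf snd P)"
    then have "marg2 t y0 = marg2 (pmf_vec P) y0"
      by (metis (no_types, lifting) marg_pmf_vec(2) pmf_vec_nth tY_def vec_lambda_beta)
    moreover have "marg2 ?s y0 = pmf P (x0, y0) / q"
      by (simp add: marg2_def w_def if_distrib cong: if_cong)
    ultimately have "(1 - \<theta>) * marg2 (pmf_vec P) y0 + \<theta> * (pmf P (x0, y0) / q) = marg2 (pmf_vec P) y0"
      by (simp add: t_def)
    then have "\<theta> * (pmf P (x0, y0) / q) = \<theta> * marg2 (pmf_vec P) y0" by (simp add: algebra_simps)
    then have "pmf P (x0, y0) = q * marg2 (pmf_vec P) y0" using \<theta> q by (simp add: field_simps)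
    then have "info_density P (x0, y0) = 0" by (simp add: info_density_def q_def)
    then show False using const [OF a] i by simp
  qed
  then have "0 < rel_ent (map_pmf snd P) tY"
    using rel_ent_eq_0D [OF tY] rel_ent_nonneg [OF tY] by fastforce
  then have "mut_inf t < i" using mi D by simp
  then show ?thesis using t small by blast
qed

lemma strict_feasibility_near_threshold:
  fixes P :: "('x::finite \<times> 'y::finite) pmf"
  obtains \<epsilon> where "0 < \<epsilon>"
    "\<And>r \<delta>. 0 < r \<Longrightarrow> \<bar>r - mut_inf (pmf_vec P)\<bar> < \<epsilon> \<Longrightarrow> \<not> (degenerate P \<and> r < mut_inf (pmf_vec P)) \<Longrightarrow> 0 < \<delta> \<Longrightarrow>
      \<exists>t\<in>prob_on (set_pmf P). mut_inf t < r \<and> rel_ent P t \<le> penalized_min P r + \<delta>"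
proof -
  define i where "i = mut_inf (pmf_vec P)"
  define F where "F = (\<lambda>r \<delta>. \<exists>t\<in>prob_on (set_pmf P). mut_inf t < r \<and> rel_ent P t \<le> penalized_min P r + \<delta>)"
  have i_nonneg: "0 \<le> i" unfolding i_def by (rule mut_inf_nonneg [OF pmf_vec_in_prob_on])
  have above: "F r \<delta>" if "i < r" "0 < \<delta>" for r \<delta>
    unfolding F_def using that penalized_min_nonneg [of P r]
    by (intro bexI [of _ "pmf_vec P"]) (auto simp: i_def pmf_vec_in_prob_on)
  have "\<exists>\<epsilon>>0. \<forall>r \<delta>. 0 < r \<longrightarrow> \<bar>r - i\<bar> < \<epsilon> \<longrightarrow> \<not> (degenerate P \<and> r < i) \<longrightarrow> 0 < \<delta> \<longrightarrow> F r \<delta>"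
  \<comment> \<open>For \<open>i = 0\<close> every positive rate lies above the threshold, where
    \<open>P\<close> itself is strictly feasible with divergence 0.\<close>
  proof (cases "i = 0")
    case True
    then show ?thesis using above by (intro exI [of _ 1]) auto
  next
    case False
    then have i_pos: "0 < i" using i_nonneg by simp
    show ?thesis
    proof (cases "\<exists>t\<in>prob_on (set_pmf P). rel_ent P t + mut_inf t < i")
      case True
      then obtain t1 where t1: "t1 \<in> prob_on (set_pmf P)" "rel_ent P t1 + mut_inf t1 < i" by blast
      define l where "l = rel_ent P t1 + mut_inf t1"
      have "F r \<delta>" if "\<bar>r - i\<bar> < i - l" "0 < \<delta>" for r \<delta>
        unfolding F_def
        using that t1 by (intro strict_feasibility [of l] feasible_if_not_minimizer [of t1]) (auto simp: l_def)
      then show ?thesis using t1(2) by (intro exI [of _ "i - l"]) (auto simp: l_def)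
    next
      case False
      then have min: "\<And>t. t \<in> prob_on (set_pmf P) \<Longrightarrow> mut_inf (pmf_vec P) \<le> rel_ent P t + mut_inf t"
        by (force simp: i_def not_less)
      have const: "\<And>a. a \<in> set_pmf P \<Longrightarrow> info_density P a = i"
        using minimizer_info_density [OF min] by (simp add: i_def)
      have at: "F i \<delta>" if "0 < \<delta>" for \<delta>
      proof -
        obtain t where "t \<in> prob_on (set_pmf P)" "mut_inf t < i" "rel_ent P t \<le> \<delta>"
          using strict_feasibility_const_info_density [OF const i_pos \<open>0 < \<delta>\<close>] by blast
        then show ?thesis unfolding F_def using penalized_min_nonneg [of P i] by (intro bexI [of _ t]) auto
      qed
      show ?thesis
      proof (cases "degenerate P")
        case True
        then show ?thesis using above at
          by (intro exI [of _ 1]) (metis linorder_cases zero_less_one)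
      next
        case False
        then have "has_common_part P" using const_info_densityI [OF const] by (simp add: degenerate_def)
        then obtain \<epsilon> where \<epsilon>: "0 < \<epsilon>"
          and feas: "\<And>r. i - \<epsilon> < r \<Longrightarrow> r < i \<Longrightarrow> \<exists>t\<in>prob_on (set_pmf P). mut_inf t = r \<and> rel_ent P t = i - r"
          using feasible_common_part [OF const] by blast
        have feas': "\<exists>t\<in>prob_on (set_pmf P). mut_inf t \<le> r \<and> rel_ent P t \<le> penalized_min P r"
          if "i - \<epsilon> < r" "r < i" for r
        proof -
          obtain s where s: "s \<in> prob_on (set_pmf P)" "penalized_min P r = rel_ent P s + max 0 (mut_inf s - r)"
            by (rule penalized_min_attained [of P r]) (rule that)
          \<comment> \<open>The penalized objective dominates \<open>D + I - r\<close>, and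
            \<open>P\<close> minimizes \<open>D + I\<close> with value \<open>i\<close>; the
            distributions from the common part attain this bound.\<close>
          have "i - r \<le> penalized_min P r" using min [OF s(1)] s(2) by (simp add: i_def)
          then show ?thesis using feas [OF that] by force
        qed
        have below: "F r \<delta>" if "\<bar>r - i\<bar> < \<epsilon>" "r < i" "0 < \<delta>" for r \<delta>
          unfolding F_def using that feas' by (intro strict_feasibility [of "i - \<epsilon>"]) auto
        show ?thesis using \<epsilon> above at below
          by (intro exI [of _ \<epsilon>]) (metis linorder_cases)
      qed
    qed
  qed
  then show ?thesis using that unfolding F_def i_def by blast
qed

theorem mainTheorem7:
  fixes b :: real
    and P :: "('x::finite \<times> 'y::finite) pmf"
    and \<Q> :: "nat \<Rightarrow> ('x \<times> 'y) list pmf set"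
  assumes "b > 1"
    and "\<Q> = alt_sym \<or> \<Q> = alt_sym_left \<or> \<Q> = alt_sym_right"
  shows "threshold_rate b P \<Q> = mutual_info b P \<and>
    (\<exists>\<epsilon>>0. \<forall>R>0. \<bar>ereal R - mutual_info b P\<bar> < ereal \<epsilon> \<longrightarrow>
       (\<not> (degenerate P \<and> ereal R < mutual_info b P) \<longrightarrow>
          error_exponent b P \<Q> R =
            (SUP s\<in>{1/2<..<1}. ereal ((1 - s) / s) * (renyi_info_dd b s P - ereal R))) \<and>
       strong_converse_exponent b P \<Q> R =
         (SUP s\<in>{1<..}. ereal ((s - 1) / s) * (ereal R - renyi_info_dd b s P)))"
proof (rule conjI)
  have tb: "\<And>n. type_bounded n (\<Q> n)" by (rule type_bounded_alternatives [OF assms(2)])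
  have lnb: "0 < ln b" using assms(1) by simp
  show "threshold_rate b P \<Q> = mutual_info b P"
    using threshold_rate_eq [where \<Q> = \<Q>, OF assms(1) tb, of P] mutual_info_eq [OF assms(1), of P] by simp
  obtain \<epsilon> where \<epsilon>: "0 < \<epsilon>"
    and approx: "\<And>r \<delta>. 0 < r \<Longrightarrow> \<bar>r - mut_inf (pmf_vec P)\<bar> < \<epsilon> \<Longrightarrow>
      \<not> (degenerate P \<and> r < mut_inf (pmf_vec P)) \<Longrightarrow> 0 < \<delta> \<Longrightarrow>
      \<exists>t\<in>prob_on (set_pmf P). mut_inf t < r \<and> rel_ent P t \<le> penalized_min P r + \<delta>"
    by (rule strict_feasibility_near_threshold [of P]) (rule that)
  show "\<exists>\<epsilon>>0. \<forall>R>0. \<bar>ereal R - mutual_info b P\<bar> < ereal \<epsilon> \<longrightarrow>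
       (\<not> (degenerate P \<and> ereal R < mutual_info b P) \<longrightarrow>
          error_exponent b P \<Q> R =
            (SUP s\<in>{1/2<..<1}. ereal ((1 - s) / s) * (renyi_info_dd b s P - ereal R))) \<and>
       strong_converse_exponent b P \<Q> R =
         (SUP s\<in>{1<..}. ereal ((s - 1) / s) * (ereal R - renyi_info_dd b s P))"
  \<comment> \<open>The radius \<epsilon> was obtained for natural logarithms; rates to base
    \<open>b\<close> are smaller by the factor \<open>ln b\<close>.\<close>
  proof (intro exI [of _ "\<epsilon> / ln b"] conjI allI impI)
    show "0 < \<epsilon> / ln b" using \<epsilon> lnb by simp
    fix R :: real assume R: "0 < R" and close: "\<bar>ereal R - mutual_info b P\<bar> < ereal (\<epsilon> / ln b)"
    show "strong_converse_exponent b P \<Q> R =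
         (SUP s\<in>{1<..}. ereal ((s - 1) / s) * (ereal R - renyi_info_dd b s P))"
      by (rule strong_converse_exponent_eq_renyi [where \<Q> = \<Q>, OF assms(1) tb])
    assume nondeg: "\<not> (degenerate P \<and> ereal R < mutual_info b P)"
    have "\<bar>R - mut_inf (pmf_vec P) / ln b\<bar> < \<epsilon> / ln b"
      using close by (simp add: mutual_info_eq [OF assms(1)])
    then have "\<bar>R - mut_inf (pmf_vec P) / ln b\<bar> * ln b < \<epsilon>" using lnb by (simp add: field_simps)
    also have "\<bar>R - mut_inf (pmf_vec P) / ln b\<bar> * ln b = \<bar>(R - mut_inf (pmf_vec P) / ln b) * ln b\<bar>"
      using lnb by (simp add: abs_mult)
    also have "(R - mut_inf (pmf_vec P) / ln b) * ln b = R * ln b - mut_inf (pmf_vec P)"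
      using lnb by (simp add: left_diff_distrib)
    finally have close': "\<bar>R * ln b - mut_inf (pmf_vec P)\<bar> < \<epsilon>" .
    have nondeg': "\<not> (degenerate P \<and> R * ln b < mut_inf (pmf_vec P))"
      using nondeg lnb by (simp add: mutual_info_eq [OF assms(1)] field_simps)
    have "error_exponent b P \<Q> R = ereal (penalized_min P (R * ln b) / ln b)"
      using R lnb approx [OF _ close' nondeg']
      by (intro error_exponent_eq_penalized_min [where \<Q> = \<Q>, OF assms(1) tb]) simp
    then show "error_exponent b P \<Q> R =
            (SUP s\<in>{1/2<..<1}. ereal ((1 - s) / s) * (renyi_info_dd b s P - ereal R))"
      by (simp only: renyi_error_exponent [OF assms(1)] penalized_min_def)
  qed
qed

end
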